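(* Let $T=\operatorname{diag}(t_1,\dots,t_n)\in M_n(\mathbb Z)$ be an elementary divisor matrix with diagonal entries $1=t_1,t_2,\dots,t_n$ ($t_i\mid t_{i+1}$), and let $L_1\supseteq L_2\supseteq\dots\supseteq L_n$ be lattices of rank $m$ on a positive definite quadratic space $V$ over $\mathbb Q$ such that each $L_j$ is even and $t_j$-modular. Then $\vartheta^{(n)}(L_1,\dots,L_n)$ is a modular form of weight $k=m/2$ for the paramodular group $\Gamma^{(n)}(T)$.
   Context: For the quadratic form $Q$: $b(x,y)=Q(x+y)-Q(x)-Q(y)$, $B=\tfrac12b$, $L^\#=\{y:b(y,L)\subseteq\mathbb Z\}$; $L$ is even if $Q(L)\subseteq\mathbb Z$ and $t$-modular if $L^\#=t^{-1}L$. $\vartheta^{(n)}(L_1,\dots,L_n;Z)=\sum_{x_i\in L_i}\exp(\pi i\,\mathrm{tr}((B(x_i,x_j))_{i,j}Z))$, $Z\in\mathfrak H_n$. $\Gamma^{(n)}(T)=Sp_n(\mathbb Q)\cap\begin{pmatrix}1_n&0\\0&T\end{pmatrix}M_{2n}(\mathbb Z)\begin{pmatrix}1_n&0\\0&T^{-1}\end{pmatrix}$. A modular form of weight $k$ for $\Gamma$ is a holomorphic $f$ on $\mathfrak H_n$ (holomorphic at the cusps if $n=1$) with $\det(CZ+D)^{-k}f((AZ+B)(CZ+D)^{-1})=f(Z)$ for all $\begin{pmatrix}A&B\\C&D\end{pmatrix}\in\Gamma$.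
   Formalization: The theta series is taken with exp(2πi tr(BZ)) instead of exp(πi tr(BZ)), and for even t_j it is also assumed that Q(L_j) ⊆ t_jℤ; as written the claim fails (L_1=E8 for n=1; E8 ⊇ A1^8 with T=diag(1,2)). *)

theory Defs
  imports "HOL-Analysis.Analysis"
begin

definition polar :: "('v::ab_group_add \<Rightarrow> rat) \<Rightarrow> 'v \<Rightarrow> 'v \<Rightarrow> rat" where
  "polar Q x y = Q (x + y) - Q x - Q y"

definition half_polar :: "('v::ab_group_add \<Rightarrow> rat) \<Rightarrow> 'v \<Rightarrow> 'v \<Rightarrow> rat" where
  "half_polar Q x y = polar Q x y / 2"

text \<open>Linearity in the second argument suffices, since the polar form is symmetric.\<close>

definition pos_def_quadratic_space ::
    "(rat \<Rightarrow> 'v \<Rightarrow> 'v) \<Rightarrow> ('v::ab_group_add \<Rightarrow> rat) \<Rightarrow> bool" where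
  "pos_def_quadratic_space smul Q \<longleftrightarrow>
     vector_space smul \<and>
     (\<forall>a x. Q (smul a x) = a\<^sup>2 * Q x) \<and>
     (\<forall>x. Vector_Spaces.linear smul (*) (polar Q x)) \<and>
     (\<forall>x. x \<noteq> 0 \<longrightarrow> 0 < Q x)"

text \<open>A lattice on the space is the integral span of a basis of the whole space, so the rank
  \<open>m\<close> is also the dimension of the space.\<close>

definition lattice_of_rank ::
    "(rat \<Rightarrow> 'v \<Rightarrow> 'v) \<Rightarrow> nat \<Rightarrow> 'v::ab_group_add set \<Rightarrow> bool" where
  "lattice_of_rank smul m L \<longleftrightarrow>
     (\<exists>S. finite S \<and> card S = m \<and> \<not> module.dependent smul S \<and>
          module.span smul S = UNIV \<and>
          L = {\<Sum>v\<in>S. smul (of_int (c v)) v | c :: 'v \<Rightarrow> int. True})"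

definition dual_lattice :: "('v::ab_group_add \<Rightarrow> rat) \<Rightarrow> 'v set \<Rightarrow> 'v set" where
  "dual_lattice Q L = {y. \<forall>x\<in>L. polar Q y x \<in> \<int>}"

definition even_lattice :: "('v::ab_group_add \<Rightarrow> rat) \<Rightarrow> 'v set \<Rightarrow> bool" where
  "even_lattice Q L \<longleftrightarrow> (\<forall>x\<in>L. Q x \<in> \<int>)"

definition modular_lattice ::
    "(rat \<Rightarrow> 'v \<Rightarrow> 'v) \<Rightarrow> ('v::ab_group_add \<Rightarrow> rat) \<Rightarrow> int \<Rightarrow> 'v set \<Rightarrow> bool" where
  "modular_lattice smul Q t L \<longleftrightarrow> dual_lattice Q L = smul (inverse (of_int t)) ` L"

definition map_mat :: "('a \<Rightarrow> 'b) \<Rightarrow> 'a^'n^'m \<Rightarrow> 'b^'n^'m" where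
  "map_mat f A = (\<chi> i j. f (A $ i $ j))"

text \<open>Matrices of size \<open>2n\<close> are indexed by the sum type \<open>'n + 'n\<close>.\<close>

definition block_mat ::
    "'a^'n^'n \<Rightarrow> 'a^'n^'n \<Rightarrow> 'a^'n^'n \<Rightarrow> 'a^'n^'n \<Rightarrow> 'a^('n + 'n)^('n + 'n)" where
  "block_mat A B C D = (\<chi> i j.
     case i of
       Inl p \<Rightarrow> (case j of Inl q \<Rightarrow> A $ p $ q | Inr q \<Rightarrow> B $ p $ q)
     | Inr p \<Rightarrow> (case j of Inl q \<Rightarrow> C $ p $ q | Inr q \<Rightarrow> D $ p $ q))"

definition symplectic_group :: "(rat^('n::finite + 'n)^('n + 'n)) set" where
  "symplectic_group =
     {g. transpose g ** block_mat 0 (mat 1) (- mat 1) 0 ** g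
         = block_mat 0 (mat 1) (- mat 1) 0}"

definition elementary_divisor_matrix :: "int^('n::{finite,linorder})^('n::{finite,linorder}) \<Rightarrow> bool" where
  "elementary_divisor_matrix T \<longleftrightarrow>
     (\<forall>i j. i \<noteq> j \<longrightarrow> T $ i $ j = 0) \<and>
     (\<forall>i. 0 < T $ i $ i) \<and>
     (\<forall>i j. i \<le> j \<longrightarrow> T $ i $ i dvd T $ j $ j)"

definition paramodular_group :: "int^'n^('n::finite) \<Rightarrow> (rat^('n + 'n)^('n + 'n)) set" where
  "paramodular_group T =
     symplectic_group \<inter>
     {block_mat (mat 1) 0 0 (map_mat of_int T) ** map_mat of_int M **
        block_mat (mat 1) 0 0 (matrix_inv (map_mat of_int T)) |
      M :: int^('n + 'n)^('n + 'n). True}"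

definition siegel_upper_half :: "(complex^'n^('n::finite)) set" where
  "siegel_upper_half =
     {Z. transpose Z = Z \<and> (\<forall>v. v \<noteq> 0 \<longrightarrow> 0 < v \<bullet> (map_mat Im Z *v v))}"

text \<open>The Siegel upper half space is open in the space of symmetric matrices but not in the space
  of all matrices.  Holomorphy is therefore complex Frechet differentiability within it; only the
  values of the derivative on symmetric matrices matter.\<close>

definition siegel_holomorphic :: "(complex^'n^('n::finite) \<Rightarrow> complex) \<Rightarrow> bool" where
  "siegel_holomorphic f \<longleftrightarrow>
     (\<forall>Z\<in>siegel_upper_half. \<exists>F.
        (f has_derivative F) (at Z within siegel_upper_half) \<and>
        (\<forall>c X. F (map_mat ((*) c) X) = c * F X))"

definition slash ::
    "int \<Rightarrow> (complex^'n^('n::finite) \<Rightarrow> complex) \<Rightarrow>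
     rat^'n^'n \<Rightarrow> rat^'n^'n \<Rightarrow> rat^'n^'n \<Rightarrow> rat^'n^'n \<Rightarrow> complex^'n^'n \<Rightarrow> complex" where
  "slash k f A B C D Z =
     (let A' = map_mat of_rat A; B' = map_mat of_rat B;
          C' = map_mat of_rat C; D' = map_mat of_rat D
      in det (C' ** Z + D') powi (- k) * f ((A' ** Z + B') ** matrix_inv (C' ** Z + D')))"

text \<open>Used only for \<open>n = 1\<close>, where \<open>trace Z\<close> is the single entry of \<open>Z\<close>.  Every cusp is the image
  of infinity under an integral matrix; at each of them the Fourier expansion, with respect to some
  width \<open>h\<close>, has no terms of negative index.\<close>

definition holomorphic_at_cusps ::
    "int \<Rightarrow> (complex^'n^('n::finite) \<Rightarrow> complex) \<Rightarrow> bool" where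
  "holomorphic_at_cusps k f \<longleftrightarrow>
     (\<forall>A B C D :: int^'n^'n.
        block_mat (map_mat of_int A) (map_mat of_int B) (map_mat of_int C) (map_mat of_int D)
          \<in> symplectic_group \<longrightarrow>
        (\<exists>h>0. \<exists>a :: nat \<Rightarrow> complex. \<forall>Z\<in>siegel_upper_half.
           (\<lambda>l. a l * exp (2 * pi * \<i> * of_nat l * trace Z / of_nat h)) sums
             slash k f (map_mat of_int A) (map_mat of_int B)
               (map_mat of_int C) (map_mat of_int D) Z))"

definition siegel_modular_form ::
    "int \<Rightarrow> (rat^('n + 'n)^('n + 'n)) set \<Rightarrow>
     (complex^'n^('n::finite) \<Rightarrow> complex) \<Rightarrow> bool" where
  "siegel_modular_form k \<Gamma> f \<longleftrightarrow>
     siegel_holomorphic f \<and>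
     (\<forall>A B C D. block_mat A B C D \<in> \<Gamma> \<longrightarrow>
        (\<forall>Z\<in>siegel_upper_half. slash k f A B C D Z = f Z)) \<and>
     (CARD('n) = 1 \<longrightarrow> holomorphic_at_cusps k f)"

text \<open>The exponent is \<open>2 \<pi> i tr (half_polar Q (x i) (x j))\<^sub>i\<^sub>j Z\<close>, that is,
  \<open>\<pi> i tr (polar Q (x i) (x j))\<^sub>i\<^sub>j Z\<close>.  This is the normalization that goes with duality for the
  polar form and with evenness meaning that \<open>Q\<close> is integral: for \<open>n = 1\<close> it is the sum of
  \<open>exp (2 \<pi> i Q x z)\<close>, which is modular for the full modular group if the lattice is even
  unimodular.  The factor \<open>\<pi> i\<close> in front of \<open>half_polar Q\<close> would give a function that is not even
  invariant under \<open>z \<mapsto> z + 1\<close>.\<close>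

definition theta ::
    "('v::ab_group_add \<Rightarrow> rat) \<Rightarrow> ('n \<Rightarrow> 'v set) \<Rightarrow> complex^'n^('n::finite) \<Rightarrow> complex" where
  "theta Q L Z =
     (\<Sum>\<^sub>\<infinity>x\<in>{x. \<forall>i. x i \<in> L i}.
        exp (2 * pi * \<i> * trace ((\<chi> i j. of_rat (half_polar Q (x i) (x j))) ** Z)))"

end

theory Submission
  imports Defs "HOL-Complex_Analysis.Complex_Analysis" "HOL-Probability.Probability"
begin

no_notation fps_nth (infixl "$" 75)

text \<open>The paramodular group is the stabilizer of a lattice with elementary divisors \<open>t\<^sub>1 = 1, \<dots>, t\<^sub>n\<close> in the
  symplectic group.  A Euclidean descent on the coordinates of the image of the first basis vector
  shows that it is generated by transvections, and each generator is conjugate, under the partial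
  inversions \<open>J\<^sub>l\<close> of the single hyperbolic planes, to a translation \<open>Z \<mapsto> Z + S\<close>.  The theta series is
  invariant under these translations by the divisibility properties of the \<open>t\<^sub>j\<close>-modular lattices.
  Poisson summation over the \<open>l\<close>-th lattice alone shows that \<open>J\<^sub>l\<close> multiplies the theta series by some
  nonzero constant; the value of the constant is irrelevant, since it cancels in the conjugation, so
  no Gauss sum or multiplier system has to be computed.

  Poisson summation for a lattice is reduced to the one-dimensional case: the lattice contains an
  orthogonal sublattice of finite index, and the characters of the finite quotient select the dual
  lattice.  The rank is even because the modular relation between \<open>\<tau> \<mapsto> - 1 / \<tau>\<close> and
  \<open>\<tau> \<mapsto> \<tau> + 1\<close>, applied to the degree one theta series of the unimodular lattice \<open>L\<^sub>1\<close>, forces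
  \<open>\<i>\<^sup>m = 1\<close>.\<close>

section \<open>Uniqueness of Fourier coefficients\<close>

text \<open>The delicate point is a factor 2 on the diagonal. The group contains the translation of
  the entry \<open>Z $ j $ j\<close> by \<open>1 / t j\<close>, so \<open>Q / t j\<close> has to be
  integral on \<open>L j\<close>, whereas modularity controls only the polar form, hence only
  \<open>2 * Q / t j\<close>. For odd \<open>t j\<close> the 2 cancels. For even \<open>t j\<close>
  integrality is a condition of its own: E_8 contains an orthogonal sum of eight copies of A_1,
  which is even with dual lattice half of itself, but there Q takes the value 1, and the theta
  series of this pair is changed by the translation by 1/2. The inversion of plane l is scaled by
  \<open>t l\<close> for two reasons that coincide: it then permutes the adapted basis of the
  stabilized lattice up to sign, and its action on Z matches the dual vectors
  \<open>u / t l\<close>, with u in \<open>L l\<close>, that Poisson summation over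
  \<open>L l\<close> produces. The parity of m is what lets this fit an integral weight: Poisson
  summation yields the factor csqrt(-i z)^m with z the l-th diagonal entry, and for even m this is a
  constant times a power of the automorphy factor \<open>t l * z\<close>.\<close>

definition fexp :: "complex \<Rightarrow> complex" where
  "fexp z = exp (2 * pi * \<i> * z)"

lemma fexp_add: "fexp (a + b) = fexp a * fexp b"
  by (simp add: fexp_def ring_distribs exp_add)

lemma fexp_0 [simp]: "fexp 0 = 1"
  by (simp add: fexp_def)

lemma fexp_nonzero [simp]: "fexp z \<noteq> 0"
  by (simp add: fexp_def)

lemma fexp_of_int [simp]: "fexp (of_int k) = 1"
proof -
  have "fexp (of_int k) = exp ((2 * of_int k * pi) * \<i>)"
    by (simp add: fexp_def mult_ac)
  also have "\<dots> = 1" by (rule exp_integer_2pi) simp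
  finally show ?thesis .
qed

lemma fexp_Ints: "z \<in> \<int> \<Longrightarrow> fexp z = 1"
  by (auto elim!: Ints_cases)

lemma fexp_eq_1_iff: "fexp z = 1 \<longleftrightarrow> z \<in> \<int>"
proof
  assume "fexp z = 1"
  then obtain k :: int where "Re (2 * pi * \<i> * z) = 0" "Im (2 * pi * \<i> * z) = of_int (2 * k) * pi"
    unfolding fexp_def exp_eq_1 by blast
  hence "z = of_int k" by (auto simp: complex_eq_iff)
  thus "z \<in> \<int>" by simp
qed (rule fexp_Ints)

lemma fexp_minus: "fexp (- a) = inverse (fexp a)"
  by (simp add: fexp_def exp_minus)

lemma norm_fexp: "norm (fexp z) = exp (- 2 * pi * Im z)"
  by (simp add: fexp_def norm_exp_eq_Re)

lemma fexp_sum: "finite A \<Longrightarrow> fexp (sum f A) = (\<Prod>x\<in>A. fexp (f x))"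
  by (simp add: fexp_def sum_distrib_left exp_sum)

lemma cnj_fexp: "cnj (fexp z) = fexp (- cnj z)"
  by (simp add: fexp_def exp_cnj)

text \<open>The span of the characters of the circle R/Z, with frequencies of both signs so that it
  is closed under conjugation. The inductive form turns a claim that is linear in the function into
  one about single characters.\<close>

inductive trig_poly :: "(real \<Rightarrow> complex) \<Rightarrow> bool" where
  monom: "trig_poly (\<lambda>t. c * fexp (of_int k * of_real t))"
| add: "trig_poly p \<Longrightarrow> trig_poly q \<Longrightarrow> trig_poly (\<lambda>t. p t + q t)"

lemma trig_poly_mult_monom:
  "trig_poly q \<Longrightarrow> trig_poly (\<lambda>t. c * fexp (of_int k * of_real t) * q t)"
proof (induction rule: trig_poly.induct)
  case (monom d l)
  show ?case
    using trig_poly.monom[of "c * d" "k + l"] by (simp add: fexp_add ring_distribs mult_ac)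
next
  case (add p q)
  thus ?case using trig_poly.add by (simp add: ring_distribs)
qed

lemma trig_poly_mult: "trig_poly p \<Longrightarrow> trig_poly q \<Longrightarrow> trig_poly (\<lambda>t. p t * q t)"
proof (induction rule: trig_poly.induct)
  case (monom c k)
  thus ?case by (rule trig_poly_mult_monom)
next
  case (add p r)
  thus ?case using trig_poly.add by (simp add: ring_distribs)
qed

lemma trig_poly_const: "trig_poly (\<lambda>t. c)"
  using trig_poly.monom[of c 0] by simp

text \<open>A real-linear functional on the complex plane is a combination of z and its conjugate,
  and at \<open>z = fexp t\<close> these are the characters of frequency 1 and -1. Sums and products
  stay within trigonometric polynomials.\<close>

lemma trig_poly_real_polynomial:
  assumes "real_polynomial_function p"
  shows "trig_poly (\<lambda>t. of_real (p (fexp (of_real t))))"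
  using assms
proof (induction rule: real_polynomial_function.induct)
  case (linear f)
  interpret bounded_linear f by fact
  have f: "f z = Re z * f 1 + Im z * f \<i>" for z
  proof -
    have "f z = f (Re z *\<^sub>R 1 + Im z *\<^sub>R \<i>)"
      by (metis complex_eq mult.commute mult.right_neutral scaleR_conv_of_real of_real_mult)
    thus ?thesis by (simp only: add scale) simp
  qed
  have conv: "complex_of_real (f (fexp (of_real t))) =
     ((f 1 - \<i> * f \<i>) / 2) * fexp (of_int 1 * of_real t) + ((f 1 + \<i> * f \<i>) / 2) * fexp (of_int (-1) * of_real t)" for t
  proof -
    define z where "z = fexp (of_real t)"
    have cz: "fexp (of_int (-1) * of_real t) = cnj z"
      by (simp add: z_def cnj_fexp)
    have z1: "fexp (of_int 1 * of_real t) = z"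
      by (simp add: z_def)
    show ?thesis
      unfolding z1 cz z_def[symmetric] f[of z] by (simp add: complex_eq_iff field_simps)
  qed
  show ?case unfolding conv by (intro trig_poly.intros)
next
  case (const c)
  show ?case by (rule trig_poly_const)
next
  case (add f g)
  thus ?case using trig_poly.add by simp
next
  case (mult f g)
  thus ?case using trig_poly_mult by simp
qed

lemma trig_poly_polynomial:
  fixes p :: "complex \<Rightarrow> complex"
  assumes "polynomial_function p"
  shows "trig_poly (\<lambda>t. p (fexp (of_real t)))"
proof -
  have "real_polynomial_function (Re \<circ> p)" "real_polynomial_function (Im \<circ> p)"
    using assms bounded_linear_Re bounded_linear_Im unfolding polynomial_function_def by blast+
  hence "trig_poly (\<lambda>t. of_real ((Re \<circ> p) (fexp (of_real t))) + \<i> * of_real ((Im \<circ> p) (fexp (of_real t))))"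
    by (intro trig_poly.add trig_poly_mult trig_poly_const trig_poly_real_polynomial)
  thus ?thesis by (simp flip: complex_eq)
qed

text \<open>\<open>Arg\<close> jumps only on the negative real axis. Near that axis the function is
  rewritten with \<open>Arg (- z) / (2 * pi) + 1 / 2\<close>, which is continuous there and differs
  from \<open>Arg z / (2 * pi)\<close> by 0 or 1, a difference that the period absorbs.\<close>

lemma continuous_on_circle_lift:
  fixes f :: "real \<Rightarrow> complex"
  assumes cont: "continuous_on UNIV f" and per: "\<And>x. f (x + 1) = f x"
  shows "continuous_on (sphere 0 1) (\<lambda>z. f (Arg z / (2 * pi)))"
proof -
  have fc: "isCont f x" for x
    using cont by (simp add: continuous_on_eq_continuous_at)
  have 1: "isCont (\<lambda>z. f (Arg z / (2 * pi)))  z" if "z \<notin> \<real>\<^sub>\<le>\<^sub>0" for z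
    by (rule isCont_o2[OF _ fc]) (use continuous_at_Arg[OF that] in \<open>auto intro!: continuous_intros\<close>)
  have 2: "isCont (\<lambda>z. f (Arg (- z) / (2 * pi) + 1 / 2))  z" if "- z \<notin> \<real>\<^sub>\<le>\<^sub>0" for z
    by (rule isCont_o2[OF _ fc])
       (auto intro!: continuous_intros isCont_o2[where f = uminus and g = Arg] continuous_at_Arg[OF that])
  have per': "f (x - 1) = f x" for x using per[of "x - 1"] by simp
  have eq: "f (Arg (- z) / (2 * pi) + 1 / 2) = f (Arg z / (2 * pi))" if "z \<noteq> 0" for z
  proof (cases "Arg z \<le> 0")
    case True
    hence *: "Arg (- z) / (2 * pi) + 1 / 2 = Arg z / (2*pi) + 1" using that by (simp add: Arg_minus field_simps)
    show ?thesis unfolding * by (rule per)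
  next
    case False
    hence *: "Arg (- z) / (2 * pi) + 1 / 2 = Arg z / (2*pi)" using that by (simp add: Arg_minus field_simps)
    show ?thesis unfolding * by simp
  qed
  have "isCont (\<lambda>z. f (Arg z / (2 * pi))) z" if "z \<noteq> 0" for z
  proof (cases "z \<in> \<real>\<^sub>\<le>\<^sub>0")
    case False thus ?thesis by (rule 1)
  next
    case True
    hence "- z \<notin> \<real>\<^sub>\<le>\<^sub>0" using that by (auto simp: complex_nonpos_Reals_iff complex_eq_iff)
    from 2[OF this] have "isCont (\<lambda>z. f (Arg (- z) / (2 * pi) + 1 / 2)) z" .
    moreover have "\<forall>\<^sub>F y in nhds z. f (Arg (- y) / (2 * pi) + 1 / 2) = f (Arg y / (2 * pi))"
      using t1_space_nhds[OF that] by eventually_elim (rule eq)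
    ultimately show ?thesis by (rule isCont_cong[THEN iffD1, rotated])
  qed
  note cont_at = this
  show ?thesis
  proof (rule continuous_at_imp_continuous_on, rule ballI)
    fix z :: complex assume "z \<in> sphere 0 1"
    hence "z \<noteq> 0" by auto
    thus "isCont (\<lambda>z. f (Arg z / (2 * pi))) z" by (rule cont_at)
  qed
qed

text \<open>Approximating the conjugate of f uniformly by trigonometric polynomials p makes the
  integral of \<open>f * cnj f\<close> arbitrarily close to that of \<open>f * p\<close>, which
  vanishes. So f has square norm 0, and continuity does the rest.\<close>

lemma fourier_uniqueness:
  fixes f :: "real \<Rightarrow> complex"
  assumes cont: "continuous_on UNIV f" and per: "\<And>x. f (x + 1) = f x"
    and zero: "\<And>k::int. integral {0..1} (\<lambda>t. f t * fexp (of_int k * of_real t)) = 0"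
  shows "f x = 0"
proof -
  have fint: "f (y + of_int n) = f y" for y and n :: int
  proof (induction n rule: int_induct[where k = 0])
    case (step1 i) thus ?case using per[of "y + of_int i"] by (simp add: add_ac)
  next
    case (step2 i) thus ?case using per[of "y + of_int i - 1"] by (simp add: algebra_simps)
  qed auto
  have contS: "continuous_on A f" for A using cont continuous_on_subset by blast
  have cf: "continuous_on {0..1} (\<lambda>t. fexp (of_int k * of_real t))" for k
    unfolding fexp_def by (intro continuous_intros)
  have trig_zero: "continuous_on {0..1} p \<and> integral {0..1} (\<lambda>t. f t * p t) = 0" if "trig_poly p" for p
    using that
  proof induction
    case (monom c k)
    have "integral {0..1} (\<lambda>t. f t * (c * fexp (of_int k * of_real t))) =
      integral {0..1} (\<lambda>t. c * (f t * fexp (of_int k * of_real t)))" by (simp add: mult_ac)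
    also have "\<dots> = 0" by (simp add: zero)
    finally show ?case using cf by (auto intro!: continuous_intros)
  next
    case (add p q)
    have "integral {0..1} (\<lambda>t. f t * p t + f t * q t) = 0"
      by (subst Henstock_Kurzweil_Integration.integral_add)
         (use add contS in \<open>auto intro!: integrable_continuous_real continuous_intros\<close>)
    thus ?case using add by (auto intro!: continuous_intros simp: ring_distribs)
  qed
  obtain B where B: "\<And>t. t \<in> {0..1} \<Longrightarrow> norm (f t) \<le> B"
    using compact_imp_bounded[OF compact_continuous_image[OF contS[of "{0..1}"] compact_Icc]]
    unfolding bounded_iff by (metis image_eqI)
  have B0: "B \<ge> 0" using order_trans[OF norm_ge_zero B[of 0]] by simp
  have "norm (integral {0..1} (\<lambda>t. f t * cnj (f t))) \<le> B * e" if e: "e > 0" for e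
  proof -
    \<comment> \<open>Stone-Weierstrass is applied on the unit circle in the real plane: its real
      polynomials in z restrict to trigonometric polynomials in t.\<close>
    have "continuous_on (sphere (0::complex) 1) (\<lambda>z. cnj (f (Arg z / (2 * pi))))"
      by (intro continuous_intros continuous_on_circle_lift cont per)
    from Stone_Weierstrass_polynomial_function[OF compact_sphere this e]
    obtain g where g: "polynomial_function g" "\<And>z. norm z = 1 \<Longrightarrow> norm (cnj (f (Arg z / (2 * pi))) - g z) < e"
      by auto
    define p where "p = (\<lambda>t::real. g (fexp (of_real t)))"
    have p: "trig_poly p" unfolding p_def by (rule trig_poly_polynomial[OF g(1)])
    have near: "norm (cnj (f t) - p t) < e" for t :: real
    proof -
      define z where "z = fexp (of_real t)"
      have nz: "norm z = 1" by (simp add: z_def norm_fexp)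
      have "z = exp (\<i> * Arg z)" using nz complex_norm_eq_1_exp_eq by simp
      also have "\<dots> = fexp (of_real (Arg z / (2 * pi)))" by (simp add: fexp_def)
      finally have "fexp (of_real t - of_real (Arg z / (2 * pi))) = 1"
        unfolding diff_conv_add_uminus fexp_add fexp_minus by (simp add: z_def)
      then obtain n :: int where "of_real t - complex_of_real (Arg z / (2 * pi)) = of_int n"
        unfolding fexp_eq_1_iff by (auto elim: Ints_cases)
      hence "complex_of_real t = complex_of_real (Arg z / (2 * pi) + of_int n)"
        by (simp add: algebra_simps)
      hence "t = Arg z / (2 * pi) + of_int n" by (simp only: of_real_eq_iff)
      hence "f t = f (Arg z / (2 * pi))" by (simp only: fint)
      thus ?thesis using g(2)[OF nz] by (simp add: p_def z_def)
    qed
    have "integral {0..1} (\<lambda>t. f t * cnj (f t)) =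
      integral {0..1} (\<lambda>t. f t * (cnj (f t) - p t) + f t * p t)" by (simp add: ring_distribs)
    also have "\<dots> = integral {0..1} (\<lambda>t. f t * (cnj (f t) - p t)) + integral {0..1} (\<lambda>t. f t * p t)"
    proof (rule Henstock_Kurzweil_Integration.integral_add)
      show "(\<lambda>t. f t * (cnj (f t) - p t)) integrable_on {0..1}"
        by (intro integrable_continuous_real continuous_intros contS conjunct1[OF trig_zero[OF p]])
      show "(\<lambda>t. f t * p t) integrable_on {0..1}"
        by (intro integrable_continuous_real continuous_intros contS conjunct1[OF trig_zero[OF p]])
    qed
    also have "integral {0..1} (\<lambda>t. f t * p t) = 0" using trig_zero[OF p] by simp
    finally have "norm (integral {0..1} (\<lambda>t. f t * cnj (f t))) = norm (integral {0..1} (\<lambda>t. f t * (cnj (f t) - p t)))"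
      by simp
    also have "\<dots> \<le> B * e * (1 - 0)"
    proof (rule integral_bound)
      show "continuous_on {0..1} (\<lambda>t. f t * (cnj (f t) - p t))"
        by (intro continuous_intros contS conjunct1[OF trig_zero[OF p]])
      show "norm (f t * (cnj (f t) - p t)) \<le> B * e" if "t \<in> {0..1}" for t
        unfolding norm_mult using near[of t] B[OF that] B0 by (intro mult_mono) auto
    qed auto
    finally show ?thesis by simp
  qed
  note bound = this
  have "norm (integral {0..1} (\<lambda>t. f t * cnj (f t))) \<le> 0 + e" if "e > 0" for e
  proof -
    \<comment> \<open>The denominator is \<open>B + 1\<close> because the bound B may be 0.\<close>
    have "norm (integral {0..1} (\<lambda>t. f t * cnj (f t))) \<le> B * (e / (B + 1))"
      by (rule bound) (use that B0 in simp)
    also have "\<dots> \<le> e" using B0 that by (simp add: field_simps)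
    finally show ?thesis by simp
  qed
  hence "norm (integral {0..1} (\<lambda>t. f t * cnj (f t))) \<le> 0"
    by (rule field_le_epsilon)
  hence "integral {0..1} (\<lambda>t. f t * cnj (f t)) = 0" by simp
  moreover have "(\<lambda>t. f t * cnj (f t)) = (\<lambda>t. of_real ((norm (f t))\<^sup>2))"
    by (rule ext) (simp only: complex_norm_square)
  moreover have "integral {0..1} (\<lambda>t. complex_of_real ((norm (f t))\<^sup>2)) = of_real (integral {0..1} (\<lambda>t. (norm (f t))\<^sup>2))"
  proof -
    have "continuous_on {0..1} (\<lambda>t. (norm (f t))\<^sup>2)" using contS by (intro continuous_intros)
    from integral_linear[OF integrable_continuous_real[OF this] bounded_linear_of_real]
    have "integral {0..1} (complex_of_real \<circ> (\<lambda>t. (norm (f t))\<^sup>2)) = of_real (integral {0..1} (\<lambda>t. (norm (f t))\<^sup>2))" .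
    thus ?thesis by (simp only: o_def)
  qed
  ultimately have "integral {0..1} (\<lambda>t. (norm (f t))\<^sup>2) = 0" by simp
  hence z: "f t = 0" if "t \<in> {0..1}" for t
  proof -
    have c: "continuous_on {0..1} (\<lambda>t. (norm (f t))\<^sup>2)" using contS by (intro continuous_intros)
    have "\<forall>t\<in>{0..1}. (norm (f t))\<^sup>2 = 0"
      by (subst integral_eq_0_iff[OF c, symmetric]) (use \<open>integral {0..1} (\<lambda>t. (norm (f t))\<^sup>2) = 0\<close> in auto)
    thus ?thesis using that by simp
  qed
  have "f x = f (frac x)" using fint[of "frac x" "\<lfloor>x\<rfloor>"] by (simp add: frac_def)
  also have "\<dots> = 0" using z[of "frac x"] frac_lt_1[of x] by simp
  finally show ?thesis .
qed

section \<open>Poisson summation for Gaussians on the line\<close>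

lemma gauss_summable_int:
  assumes "c > 0"
  shows "(\<lambda>n::int. exp (- c * (of_int n)\<^sup>2 :: real)) summable_on UNIV"
proof -
  define g where "g = (\<lambda>n::int. exp (- c * \<bar>real_of_int n\<bar>))"
  have geo: "(\<lambda>n::nat. exp (- c * real n)) summable_on UNIV"
  proof -
    have "exp (- c * real n) = exp (- c) ^ n" for n :: nat
      by (simp add: exp_of_nat_mult[symmetric] mult_ac)
    moreover have "summable (\<lambda>n. exp (- c) ^ n)"
      using assms by (intro summable_geometric) auto
    ultimately show ?thesis by (simp add: summable_nonneg_imp_summable_on)
  qed
  have 1: "g summable_on range int"
    by (subst summable_on_reindex) (use geo in \<open>auto simp: g_def o_def inj_def\<close>)
  have 2: "g summable_on range (\<lambda>n. - int n)"
    by (subst summable_on_reindex) (use geo in \<open>auto simp: g_def o_def inj_def\<close>)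
  have "g summable_on (range int \<union> range (\<lambda>n. - int n))"
    by (rule summable_on_union[OF 1 2])
  moreover have "n \<in> range int \<union> range (\<lambda>n. - int n)" for n
    by (cases n rule: int_cases2) auto
  hence "range int \<union> range (\<lambda>n. - int n) = UNIV" by blast
  ultimately have "g summable_on UNIV" by simp
  thus ?thesis
  proof (rule summable_on_comparison_test)
    fix n :: int
    have "\<bar>real_of_int n\<bar> * 1 \<le> \<bar>real_of_int n\<bar> * \<bar>real_of_int n\<bar>"
    proof (cases "n = 0")
      case False
      hence "1 \<le> \<bar>n\<bar>" by simp
      hence "1 \<le> \<bar>real_of_int n\<bar>" by linarith
      thus ?thesis by (intro mult_left_mono) auto
    qed auto
    hence "\<bar>real_of_int n\<bar> \<le> (real_of_int n)\<^sup>2" by (simp add: power2_eq_square)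
    thus "exp (- c * (of_int n)\<^sup>2) \<le> g n" using assms by (simp add: g_def)
  qed auto
qed

text \<open>From \<open>(x + 2 * b)\<^sup>2 \<ge> 0\<close> one gets
  \<open>(x + b)\<^sup>2 \<ge> x\<^sup>2 / 2 - b\<^sup>2\<close>. Halving the rate thus buys a
  summable majorant that is uniform for bounded shifts b.\<close>

lemma gauss_shift_le:
  fixes c x b B :: real
  assumes "c \<ge> 0" "\<bar>b\<bar> \<le> B"
  shows "exp (- c * (x + b)\<^sup>2) \<le> exp (c * B\<^sup>2) * exp (- (c / 2) * x\<^sup>2)"
proof -
  have "b\<^sup>2 \<le> B\<^sup>2" using assms(2) abs_le_square_iff by fastforce
  moreover have "0 \<le> (x + 2 * b)\<^sup>2" by simp
  ultimately have "x\<^sup>2 / 2 - B\<^sup>2 \<le> (x + b)\<^sup>2" by (simp add: power2_eq_square algebra_simps)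
  hence "c * (x\<^sup>2 / 2 - B\<^sup>2) \<le> c * (x + b)\<^sup>2" using assms(1) by (rule mult_left_mono)
  thus ?thesis by (simp add: algebra_simps flip: exp_add)
qed

lemma gauss_summable_int_shift:
  assumes "c > 0"
  shows "(\<lambda>n::int. exp (- c * (of_int n + b)\<^sup>2 :: real)) summable_on UNIV"
proof (rule summable_on_comparison_test)
  show "(\<lambda>n::int. exp (c * \<bar>b\<bar>\<^sup>2) * exp (- (c / 2) * (of_int n)\<^sup>2 :: real)) summable_on UNIV"
    using gauss_summable_int[of "c / 2"] assms by (intro summable_on_cmult_right) auto
qed (use gauss_shift_le[of c b "\<bar>b\<bar>"] assms in auto)

text \<open>The general term of the classical theta constant with real characteristics b (shift) and
  a (twist). Both are carried along because the inversion exchanges them.\<close>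

definition gterm :: "real \<Rightarrow> real \<Rightarrow> complex \<Rightarrow> int \<Rightarrow> complex" where
  "gterm a b \<tau> n = fexp (\<tau> * (of_int n + of_real b)\<^sup>2 / 2 + (of_int n + of_real b) * of_real a)"

definition gsum :: "real \<Rightarrow> real \<Rightarrow> complex \<Rightarrow> complex" where
  "gsum a b \<tau> = (\<Sum>\<^sub>\<infinity>n. gterm a b \<tau> n)"

lemma norm_gterm: "norm (gterm a b \<tau> n) = exp (- (pi * Im \<tau>) * (of_int n + b)\<^sup>2)"
proof -
  have "Im (\<tau> * (of_int n + of_real b)\<^sup>2 / 2 + (of_int n + of_real b) * of_real a) = Im \<tau> * (of_int n + b)\<^sup>2 / 2"
    by (simp add: power2_eq_square algebra_simps)
  thus ?thesis unfolding gterm_def norm_fexp by simp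
qed

lemma gterm_abs_summable: "Im \<tau> > 0 \<Longrightarrow> (\<lambda>n. norm (gterm a b \<tau> n)) summable_on UNIV"
  unfolding norm_gterm by (rule gauss_summable_int_shift) simp

lemma gterm_summable: "Im \<tau> > 0 \<Longrightarrow> gterm a b \<tau> summable_on UNIV"
  using gterm_abs_summable abs_summable_summable by blast

lemma gsum_has_sum: "Im \<tau> > 0 \<Longrightarrow> (gterm a b \<tau> has_sum gsum a b \<tau>) UNIV"
  unfolding gsum_def by (intro has_sum_infsum gterm_summable)

lemma gsum_uniform_limit_b:
  assumes "Im \<tau> > 0"
  shows "uniform_limit {- B..B} (\<lambda>X b. \<Sum>n\<in>X. gterm a b \<tau> n) (\<lambda>b. gsum a b \<tau>) (finite_subsets_at_top UNIV)"
  unfolding gsum_def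
proof (rule Weierstrass_m_test_general)
  show "norm (gterm a b \<tau> n) \<le> exp (pi * Im \<tau> * B\<^sup>2) * exp (- (pi * Im \<tau> / 2) * (of_int n)\<^sup>2)"
    if "b \<in> {- B..B}" for n b
    unfolding norm_gterm using assms that by (intro gauss_shift_le) auto
  show "(\<lambda>n. exp (pi * Im \<tau> * B\<^sup>2) * exp (- (pi * Im \<tau> / 2) * (of_int n)\<^sup>2)) summable_on UNIV"
    using gauss_summable_int[of "pi * Im \<tau> / 2"] assms by (intro summable_on_cmult_right) auto
qed

lemma gterm_continuous_b: "continuous_on A (\<lambda>b. gterm a b \<tau> n)"
  unfolding gterm_def fexp_def by (auto intro!: continuous_intros)

lemma gsum_continuous_b:
  assumes "Im \<tau> > 0"
  shows "continuous_on UNIV (\<lambda>b. gsum a b \<tau>)"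
proof (rule continuous_at_imp_continuous_on, rule ballI)
  fix b :: real
  have "continuous_on {- (\<bar>b\<bar> + 1)..\<bar>b\<bar> + 1} (\<lambda>b. gsum a b \<tau>)"
    by (rule uniform_limit_theorem[OF _ gsum_uniform_limit_b[OF assms]])
       (auto intro!: always_eventually continuous_intros gterm_continuous_b)
  thus "isCont (\<lambda>b. gsum a b \<tau>) b"
    by (rule continuous_on_interior) (auto simp: interior_atLeastAtMost_real)
qed

lemma gsum_period: "gsum a (b + 1) \<tau> = gsum a b \<tau>"
proof -
  have "gsum a (b + 1) \<tau> = (\<Sum>\<^sub>\<infinity>n. gterm a b \<tau> (n + 1))"
    unfolding gsum_def gterm_def by (simp add: add_ac)
  also have "\<dots> = gsum a b \<tau>"
    unfolding gsum_def by (rule infsum_reindex_bij_witness[where i = "\<lambda>n. n - 1" and j = "\<lambda>n. n + 1"]) auto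
  finally show ?thesis .
qed

text \<open>A rescaling of the characteristic function of the standard normal distribution: the
  substitution by \<open>c = sqrt (2 * pi * t)\<close> turns the normal density into the Gaussian
  \<open>exp (- pi * t * x\<^sup>2)\<close>.\<close>

lemma gaussian_fourier:
  fixes t s :: real
  assumes t: "t > 0"
  shows "integrable lborel (\<lambda>x. exp (- pi * t * x\<^sup>2) * fexp (of_real (- s * x)))"
    and "(LINT x|lborel. exp (- pi * t * x\<^sup>2) * fexp (of_real (- s * x))) = of_real (exp (- pi * s\<^sup>2 / t) / sqrt t)"
proof -
  define c where "c = sqrt (2 * pi * t)"
  have c: "c > 0" "c\<^sup>2 = 2 * pi * t" using t by (auto simp: c_def)
  define u where "u = - 2 * pi * s / c"
  define F where "F = (\<lambda>x. std_normal_density x *\<^sub>R exp (\<i> * of_real (u * x)))"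
  have F: "F (0 + c * x) = (1 / sqrt (2 * pi)) *\<^sub>R (exp (- pi * t * x\<^sup>2) * fexp (of_real (- s * x)))" for x
  proof -
    have "std_normal_density (c * x) = (1 / sqrt (2 * pi)) * exp (- pi * t * x\<^sup>2)"
      unfolding std_normal_density_def power_mult_distrib c(2) by simp
    moreover have "u * (c * x) = 2 * pi * (- s * x)" using c by (simp add: u_def)
    hence "exp (\<i> * of_real (u * (c * x))) = fexp (of_real (- s * x))"
      unfolding fexp_def by (simp add: mult_ac)
    ultimately show ?thesis unfolding F_def
      by (simp add: scaleR_conv_of_real)
  qed
  have "integrable lborel F"
  proof (rule Bochner_Integration.integrable_bound[of _ "std_normal_density"])
    show "F \<in> borel_measurable lborel" unfolding F_def by measurable
  qed (auto simp: F_def norm_mult)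
  hence int: "integrable lborel (\<lambda>x. F (0 + c * x))"
    using lborel_integrable_real_affine[of F c 0] c by simp
  have "integrable lborel (\<lambda>x. sqrt (2 * pi) *\<^sub>R F (0 + c * x))"
    by (rule integrable_scaleR_right[OF int])
  thus "integrable lborel (\<lambda>x. exp (- pi * t * x\<^sup>2) * fexp (of_real (- s * x)))"
    unfolding F by simp
  have "complex_of_real (exp (- u\<^sup>2 / 2)) = char std_normal_distribution u"
    by (simp add: char_std_normal_distribution)
  also have "\<dots> = (LINT x|lborel. F x)"
    unfolding char_def F_def by (subst integral_density) auto
  also have "\<dots> = c *\<^sub>R (LINT x|lborel. F (0 + c * x))"
    using lborel_integral_real_affine[of c F 0] c by simp
  also have "\<dots> = (c / sqrt (2 * pi)) *\<^sub>R (LINT x|lborel. exp (- pi * t * x\<^sup>2) * fexp (of_real (- s * x)))"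
    unfolding F by simp
  also have "c / sqrt (2 * pi) = sqrt t" by (simp add: c_def real_sqrt_mult)
  also have "exp (- u\<^sup>2 / 2) = exp (- pi * s\<^sup>2 / t)"
    using c t by (simp add: u_def power_divide power_mult_distrib field_simps power2_eq_square)
  finally show "(LINT x|lborel. exp (- pi * t * x\<^sup>2) * fexp (of_real (- s * x))) = of_real (exp (- pi * s\<^sup>2 / t) / sqrt t)"
    using t by (simp add: scaleR_conv_of_real field_simps)
qed

section \<open>Fourier coefficients of a periodized Gaussian\<close>

lemma integral_unit_intervals:
  fixes H :: "real \<Rightarrow> complex"
  assumes cont: "continuous_on UNIV H"
  shows "(\<Sum>n\<in>{- int N..<int N}. integral {0..1} (\<lambda>x. H (of_int n + x))) = integral {- real N..real N} H"
proof (induction N)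
  case 0 show ?case by simp
next
  case (Suc N)
  have I: "H integrable_on {a..b}" for a b
    using continuous_on_subset[OF cont] by (intro integrable_continuous_real) auto
  have shift: "integral {0..1} (\<lambda>x. H (of_int n + x)) = integral {of_int n..of_int n + 1} H" for n :: int
    using integral_shift_Icc_real[of 0 1 H "of_int n"] by (simp add: add_ac o_def)
  have "{- int (Suc N)..<int (Suc N)} = insert (- int (Suc N)) (insert (int N) {- int N..<int N})" by auto
  hence "(\<Sum>n\<in>{- int (Suc N)..<int (Suc N)}. integral {0..1} (\<lambda>x. H (of_int n + x))) =
     integral {- real (Suc N)..- real N} H + (integral {real N..real (Suc N)} H + integral {- real N..real N} H)"
    using Suc by (simp add: shift del: of_nat_Suc) (simp add: add_ac)
  also have "\<dots> = integral {- real (Suc N)..real (Suc N)} H"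
    using Henstock_Kurzweil_Integration.integral_combine[OF _ _ I, of "- real N" "real N" "real (Suc N)"]
      Henstock_Kurzweil_Integration.integral_combine[OF _ _ I, of "- real (Suc N)" "- real N" "real (Suc N)"]
    by (simp add: add_ac)
  finally show ?case .
qed

lemma integral_symmetric_intervals_tendsto:
  fixes H :: "real \<Rightarrow> complex"
  assumes cont: "continuous_on UNIV H" and int: "integrable lborel H"
  shows "(\<lambda>N. integral {- real N..real N} H) \<longlonglongrightarrow> (LINT x|lborel. H x)"
proof -
  have eq: "(LINT x|lborel. indicator {- real N..real N} x *\<^sub>R H x) = integral {- real N..real N} H" for N
  proof -
    have "set_integrable lborel {- real N..real N} H"
      by (rule borel_integrable_atLeastAtMost') (auto intro: continuous_on_subset[OF cont])
    thus ?thesis using set_borel_integral_eq_integral(2)[of "{- real N..real N}" H]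
      by (simp add: set_lebesgue_integral_def)
  qed
  have "(\<lambda>N. LINT x|lborel. indicator {- real N..real N} x *\<^sub>R H x) \<longlonglongrightarrow> (LINT x|lborel. H x)"
  proof (rule integral_dominated_convergence[where w = "\<lambda>x. norm (H x)"])
    show "AE x in lborel. (\<lambda>N. indicator {- real N..real N} x *\<^sub>R H x) \<longlonglongrightarrow> H x"
    proof (rule AE_I2)
      fix x :: real
      have "eventually (\<lambda>N. indicator {- real N..real N} x *\<^sub>R H x = H x) sequentially"
        using eventually_ge_at_top[of "nat \<lceil>\<bar>x\<bar>\<rceil>"]
      proof eventually_elim
        case (elim N)
        hence "\<bar>x\<bar> \<le> real N" by linarith
        thus ?case by (auto simp: indicator_def abs_le_iff)
      qed
      thus "(\<lambda>N. indicator {- real N..real N} x *\<^sub>R H x) \<longlonglongrightarrow> H x"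
        by (rule tendsto_eventually)
    qed
  qed (use int in \<open>auto simp: indicator_def\<close>)
  thus ?thesis unfolding eq .
qed

text \<open>Unfolding: in the variable b the sum is the periodization of a function on the line, so
  integrating it against a character over one period gives the Fourier transform of that function.
  Uniform convergence justifies the exchange of sum and integral.\<close>

lemma gsum_fourier_coeff:
  fixes t :: real and j :: int
  assumes t: "t > 0"
  shows "integral {0..1} (\<lambda>b. gsum a b (\<i> * t) * fexp (of_int j * of_real b)) =
    of_real (exp (- pi * (of_int j + a)\<^sup>2 / t) / sqrt t)"
proof -
  define s where "s = - (of_int j + a)"
  define H where "H = (\<lambda>x. exp (- pi * t * x\<^sup>2) * fexp (of_real (- s * x)))"
  have H: "gterm a b (\<i> * t) n * fexp (of_int j * of_real b) = H (of_int n + b)" for n b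
  proof -
    \<comment> \<open>A factor \<open>fexp (j * n) = 1\<close> is inserted, so that the character at
      b becomes the character at n + b and the whole term depends on n + b alone.\<close>
    have "gterm a b (\<i> * t) n * fexp (of_int j * of_real b) =
        fexp (of_int (j * n)) * (gterm a b (\<i> * t) n * fexp (of_int j * of_real b))"
      by (simp only: fexp_of_int mult_1)
    also have "\<dots> = fexp (\<i> * of_real (t * (of_int n + b)\<^sup>2 / 2) + of_real (- s * (of_int n + b)))"
      unfolding gterm_def fexp_add[symmetric] s_def by (rule arg_cong[where f = fexp]) (simp add: algebra_simps)
    also have "\<dots> = H (of_int n + b)"
    proof -
      have "fexp (\<i> * of_real (t * (of_int n + b)\<^sup>2 / 2)) = exp (of_real (- pi * t * (of_int n + b)\<^sup>2))"
        unfolding fexp_def by (rule arg_cong[where f = exp]) (simp add: algebra_simps)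
      thus ?thesis unfolding H_def fexp_add exp_of_real by (simp only:)
    qed
    finally show ?thesis .
  qed
  have contH: "continuous_on A H" for A
    unfolding H_def fexp_def by (auto intro!: continuous_intros)
  have ul: "uniform_limit {0..1} (\<lambda>X b. \<Sum>n\<in>X. gterm a b (\<i> * t) n * fexp (of_int j * of_real b))
     (\<lambda>b. gsum a b (\<i> * t) * fexp (of_int j * of_real b)) (finite_subsets_at_top UNIV)"
  proof (rule Weierstrass_m_test_general')
    show "norm (gterm a b (\<i> * t) n * fexp (of_int j * of_real b)) \<le>
        exp (pi * t * 1\<^sup>2) * exp (- (pi * t / 2) * (of_int n)\<^sup>2)" if "b \<in> {0..1}" for n b
      unfolding norm_mult norm_gterm using t that gauss_shift_le[of "pi * t" b 1 "of_int n"]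
      by (simp add: norm_fexp)
    show "((\<lambda>n. gterm a b (\<i> * t) n * fexp (of_int j * of_real b)) has_sum
        gsum a b (\<i> * t) * fexp (of_int j * of_real b)) UNIV" for b
      by (intro has_sum_cmult_left gsum_has_sum) (use t in auto)
    show "(\<lambda>n. exp (pi * t * 1\<^sup>2) * exp (- (pi * t / 2) * (of_int n)\<^sup>2)) summable_on UNIV"
      using gauss_summable_int[of "pi * t / 2"] t by (intro summable_on_cmult_right) auto
  qed
  obtain I J where I: "\<And>X. ((\<lambda>b. \<Sum>n\<in>X. gterm a b (\<i> * t) n * fexp (of_int j * of_real b)) has_integral I X) {0..1}"
    and J: "((\<lambda>b. gsum a b (\<i> * t) * fexp (of_int j * of_real b)) has_integral J) {0..1}"
    and IJ: "(I \<longlongrightarrow> J) (finite_subsets_at_top UNIV)"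
    by (rule uniform_limit_integral[OF ul])
       (auto intro!: continuous_intros gterm_continuous_b simp: fexp_def)
  have I': "I X = (\<Sum>n\<in>X. integral {0..1} (\<lambda>b. H (of_int n + b)))" if "finite X" for X
  proof -
    have "continuous_on {0..1} (\<lambda>b. H (of_int n + b))" for n
      by (rule continuous_on_compose2[OF contH[of UNIV]]) (auto intro!: continuous_intros)
    hence "((\<lambda>b. H (of_int n + b)) has_integral integral {0..1} (\<lambda>b. H (of_int n + b))) {0..1}" for n
      by (intro integrable_integral integrable_continuous_real)
    hence "((\<lambda>b. \<Sum>n\<in>X. H (of_int n + b)) has_integral (\<Sum>n\<in>X. integral {0..1} (\<lambda>b. H (of_int n + b)))) {0..1}"
      by (rule has_integral_sum[OF that])
    thus ?thesis using I[of X] unfolding H by (rule has_integral_unique[symmetric])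
  qed
  \<comment> \<open>Termwise integration converges along all finite sets of integers; the intervals
    from -N to N - 1 form a cofinal sequence for which the unit intervals join up to
    [-N, N].\<close>
  have "filterlim (\<lambda>N. {- int N..<int N}) (finite_subsets_at_top UNIV) sequentially"
    unfolding filterlim_finite_subsets_at_top
  proof (intro allI impI)
    fix X :: "int set" assume "finite X \<and> X \<subseteq> UNIV"
    hence "finite X" by simp
    show "\<forall>\<^sub>F N in sequentially. finite {- int N..<int N} \<and> X \<subseteq> {- int N..<int N} \<and> {- int N..<int N} \<subseteq> UNIV"
      using eventually_gt_at_top[of "nat (Max (insert 0 (abs ` X)))"]
    proof eventually_elim
      case (elim N)
      have "\<bar>x\<bar> < int N" if "x \<in> X" for x
      proof -
        have "\<bar>x\<bar> \<le> Max (insert 0 (abs ` X))" using \<open>finite X\<close> that by (intro Max_ge) auto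
        thus ?thesis using elim by linarith
      qed
      thus ?case by fastforce
    qed
  qed
  from filterlim_compose[OF IJ this] have "(\<lambda>N. I {- int N..<int N}) \<longlonglongrightarrow> J" .
  hence 1: "(\<lambda>N. integral {- real N..real N} H) \<longlonglongrightarrow> J"
    using integral_unit_intervals[OF contH[of UNIV]] by (simp add: I')
  have 2: "(\<lambda>N. integral {- real N..real N} H) \<longlonglongrightarrow> (LINT x|lborel. H x)"
    by (rule integral_symmetric_intervals_tendsto[OF contH]) (unfold H_def, rule gaussian_fourier(1)[OF t])
  have "J = (LINT x|lborel. H x)" by (rule LIMSEQ_unique[OF 1 2])
  also have "\<dots> = of_real (exp (- pi * s\<^sup>2 / t) / sqrt t)"
    unfolding H_def by (rule gaussian_fourier(2)[OF t])
  finally show ?thesis using integral_unique[OF J] unfolding s_def power2_minus by simp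
qed

text \<open>After multiplication by \<open>fexp (a * b)\<close> the dual sum is already an
  absolutely convergent Fourier series in b with frequency k in its k-th term. Integration against
  the character j therefore selects \<open>k = - j\<close>.\<close>

lemma gsum_dual_fourier:
  fixes a b t :: real and j :: int
  assumes t: "t > 0"
  defines "F \<equiv> \<lambda>b. fexp (of_real (a * b)) * gsum b (- a) (\<i> / t)"
  shows "continuous_on UNIV F" "F (b + 1) = F b"
    "integral {0..1} (\<lambda>b. F b * fexp (of_int j * of_real b)) = of_real (exp (- pi * (of_int j + a)\<^sup>2 / t))"
proof -
  define c where "c = (\<lambda>k::int. exp (- (pi / t) * (of_int k + (- a))\<^sup>2))"
  have Im: "Im (\<i> / t) = 1 / t" by (simp add: Im_divide power2_eq_square)
  have trm: "fexp (of_real (a * b)) * gterm b (- a) (\<i> / t) k = of_real (c k) * fexp (of_int k * of_real b)" for k b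
  proof -
    have "fexp (of_real (a * b)) * gterm b (- a) (\<i> / t) k =
      fexp (\<i> * of_real ((of_int k + (- a))\<^sup>2 / t / 2) + of_int k * of_real b)"
      unfolding gterm_def fexp_add[symmetric] by (rule arg_cong[where f = fexp]) (simp add: algebra_simps)
    also have "fexp (\<i> * of_real ((of_int k + (- a))\<^sup>2 / t / 2) + of_int k * of_real b) = fexp (\<i> * of_real ((of_int k + (- a))\<^sup>2 / t / 2)) * fexp (of_int k * of_real b)"
      by (rule fexp_add)
    also have "fexp (\<i> * of_real ((of_int k + (- a))\<^sup>2 / t / 2)) = exp (of_real (- (pi / t) * (of_int k + (- a))\<^sup>2))"
      unfolding fexp_def by (rule arg_cong[where f = exp]) (simp add: algebra_simps)
    finally show ?thesis unfolding fexp_add c_def exp_of_real by (simp only:)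
  qed
  have hs: "((\<lambda>k. of_real (c k) * fexp (of_int k * of_real b)) has_sum F b) UNIV" for b
    unfolding trm[symmetric] F_def by (intro has_sum_cmult_right gsum_has_sum) (use t in \<open>auto simp: Im\<close>)
  have csum: "c summable_on UNIV" unfolding c_def by (rule gauss_summable_int_shift) (use t in auto)
  have ul: "uniform_limit A (\<lambda>X b. \<Sum>k\<in>X. of_real (c k) * fexp (of_int k * of_real b)) F (finite_subsets_at_top UNIV)" for A
    by (rule Weierstrass_m_test_general'[OF _ hs csum]) (auto simp: norm_mult norm_fexp c_def)
  have fc: "continuous_on A (\<lambda>b. of_real (c k) * fexp (of_int k * of_real b))" for A k
    unfolding fexp_def by (auto intro!: continuous_intros)
  show "continuous_on UNIV F"
    by (rule uniform_limit_theorem[OF _ ul]) (auto intro!: always_eventually continuous_on_sum fc)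
  show "F (b + 1) = F b"
  proof (rule has_sum_unique[OF hs])
    have "fexp (of_int k * of_real (b + 1)) = fexp (of_int k * of_real b)" for k
      by (simp add: ring_distribs fexp_add)
    thus "((\<lambda>k. of_real (c k) * fexp (of_int k * of_real (b + 1))) has_sum F b) UNIV"
      using hs[of b] by simp
  qed
  have hs2: "((\<lambda>k. of_real (c k) * fexp (of_int (k + j) * of_real b)) has_sum F b * fexp (of_int j * of_real b)) UNIV" for b
    using has_sum_cmult_left[OF hs[of b], of "fexp (of_int j * of_real b)"]
    by (simp add: mult.assoc flip: fexp_add) (simp add: algebra_simps)
  have ul2: "uniform_limit {0..1} (\<lambda>X b. \<Sum>k\<in>X. of_real (c k) * fexp (of_int (k + j) * of_real b))
      (\<lambda>b. F b * fexp (of_int j * of_real b)) (finite_subsets_at_top UNIV)"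
    by (rule Weierstrass_m_test_general'[OF _ hs2 csum]) (auto simp: norm_mult norm_fexp c_def)
  obtain I J where I: "\<And>X. ((\<lambda>b. \<Sum>k\<in>X. of_real (c k) * fexp (of_int (k + j) * of_real b)) has_integral I X) {0..1}"
    and J: "((\<lambda>b. F b * fexp (of_int j * of_real b)) has_integral J) {0..1}"
    and IJ: "(I \<longlongrightarrow> J) (finite_subsets_at_top UNIV)"
    by (rule uniform_limit_integral[OF ul2]) (auto intro!: continuous_intros simp: fexp_def)
  have unit: "((\<lambda>b. fexp (of_int n * of_real b)) has_integral (if n = 0 then 1 else 0)) {0..1}" for n :: int
  proof (cases "n = 0")
    case True
    thus ?thesis using has_integral_const_real[of "1::complex" 0 1] by simp
  next
    case False
    have "((\<lambda>b. fexp (of_int n * of_real b)) has_integral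
        (fexp (of_int n * of_real 1) / (2 * pi * \<i> * of_int n) - fexp (of_int n * of_real 0) / (2 * pi * \<i> * of_int n))) {0..1}"
      by (rule fundamental_theorem_of_calculus)
         (use False in \<open>auto simp: fexp_def has_real_derivative_iff_has_vector_derivative[symmetric]
           intro!: derivative_eq_intros has_vector_derivative_real_field\<close>)
    thus ?thesis using False by simp
  qed
  have I': "I X = of_real (c (- j))" if "finite X" "- j \<in> X" for X
  proof -
    have "((\<lambda>b. \<Sum>k\<in>X. of_real (c k) * fexp (of_int (k + j) * of_real b)) has_integral
       (\<Sum>k\<in>X. of_real (c k) * (if k + j = 0 then 1 else 0))) {0..1}"
      by (intro has_integral_sum that has_integral_mult_right unit)
    also have "(\<Sum>k\<in>X. complex_of_real (c k) * (if k + j = 0 then 1 else 0)) = (\<Sum>k\<in>X. if k = - j then of_real (c k) else 0)"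
      by (rule sum.cong) auto
    also have "\<dots> = of_real (c (- j))" using that by (simp add: sum.delta)
    finally show ?thesis using I by (rule has_integral_unique[symmetric])
  qed
  have "\<forall>\<^sub>F X in finite_subsets_at_top UNIV. I X = of_real (c (- j))"
    unfolding eventually_finite_subsets_at_top by (rule exI[of _ "{- j}"]) (auto intro: I')
  hence "(I \<longlongrightarrow> of_real (c (- j))) (finite_subsets_at_top UNIV)" by (rule tendsto_eventually)
  hence "J = of_real (c (- j))" using IJ tendsto_unique finite_subsets_at_top_neq_bot by blast
  moreover have "(- real_of_int j - a)\<^sup>2 = (of_int j + a)\<^sup>2" by (simp add: power2_eq_square algebra_simps)
  ultimately show "integral {0..1} (\<lambda>b. F b * fexp (of_int j * of_real b)) = of_real (exp (- pi * (of_int j + a)\<^sup>2 / t))"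
    using integral_unique[OF J] unfolding c_def by simp
qed

text \<open>Both sides are continuous of period 1 in b with the same Fourier coefficients, so the
  identity holds for every b and no pointwise convergence theorem for Fourier series enters.\<close>

lemma gsum_transform_real:
  fixes t :: real
  assumes t: "t > 0"
  shows "gsum a b (\<i> * t) = fexp (of_real (a * b)) * gsum b (- a) (\<i> / t) / sqrt t"
proof -
  define F where "F = (\<lambda>b. fexp (of_real (a * b)) * gsum b (- a) (\<i> / t))"
  define D where "D = (\<lambda>b. gsum a b (\<i> * t) - F b / sqrt t)"
  have F1: "continuous_on UNIV F"
    unfolding F_def by (rule gsum_dual_fourier(1)[OF t])
  have F2: "F (x + 1) = F x" for x
    unfolding F_def by (rule gsum_dual_fourier(2)[OF t])
  have F3: "integral {0..1} (\<lambda>b. F b * fexp (of_int j * of_real b)) = of_real (exp (- pi * (of_int j + a)\<^sup>2 / t))" for j :: int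
    unfolding F_def by (rule gsum_dual_fourier(3)[OF t])
  have c: "continuous_on UNIV (\<lambda>b. gsum a b (\<i> * t))" by (rule gsum_continuous_b) (use t in auto)
  have "D b = 0"
  proof (rule fourier_uniqueness)
    show "continuous_on UNIV D" unfolding D_def using t by (intro continuous_intros c F1) auto
    show "D (x + 1) = D x" for x unfolding D_def gsum_period F2 ..
    fix j :: int
    have fe: "continuous_on {0..1} (\<lambda>b. fexp (of_int j * complex_of_real b))"
      unfolding fexp_def by (auto intro!: continuous_intros)
    have i1: "(\<lambda>b. gsum a b (\<i> * t) * fexp (of_int j * of_real b)) integrable_on {0..1}"
      by (intro integrable_continuous_real continuous_intros fe continuous_on_subset[OF c]) auto
    have i2: "(\<lambda>b. F b * fexp (of_int j * of_real b)) integrable_on {0..1}"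
      by (intro integrable_continuous_real continuous_intros fe continuous_on_subset[OF F1]) auto
    have "integral {0..1} (\<lambda>b. D b * fexp (of_int j * of_real b)) =
       integral {0..1} (\<lambda>b. gsum a b (\<i> * t) * fexp (of_int j * of_real b) - F b * fexp (of_int j * of_real b) / sqrt t)"
      by (simp add: D_def algebra_simps)
    also have "\<dots> = integral {0..1} (\<lambda>b. gsum a b (\<i> * t) * fexp (of_int j * of_real b)) -
       integral {0..1} (\<lambda>b. F b * fexp (of_int j * of_real b)) / sqrt t"
      by (subst Henstock_Kurzweil_Integration.integral_diff)
         (use i1 i2 integrable_on_divide in auto)
    also have "\<dots> = 0" unfolding gsum_fourier_coeff[OF t] F3 by simp
    finally show "integral {0..1} (\<lambda>b. D b * fexp (of_int j * of_real b)) = 0" .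
  qed
  thus ?thesis unfolding D_def F_def by simp
qed

lemma gsum_holomorphic: "gsum a b holomorphic_on {\<tau>. Im \<tau> > 0}"
proof -
  have "\<exists>r>0. gsum a b holomorphic_on ball \<tau> r" if "Im \<tau> > 0" for \<tau>
  proof -
    define r where "r = Im \<tau> / 2"
    have Im: "Im \<tau> / 2 \<le> Im z" if "z \<in> cball \<tau> r" for z
      using that abs_Im_le_cmod[of "\<tau> - z"] by (auto simp: r_def dist_norm)
    have "uniform_limit (cball \<tau> r) (\<lambda>X z. \<Sum>n\<in>X. gterm a b z n) (gsum a b) (finite_subsets_at_top UNIV)"
      unfolding gsum_def
    proof (rule Weierstrass_m_test_general)
      show "norm (gterm a b z n) \<le> exp (- (pi * (Im \<tau> / 2)) * (of_int n + b)\<^sup>2)" if "z \<in> cball \<tau> r" for z n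
      proof -
        have "pi * (Im \<tau> / 2) * (of_int n + b)\<^sup>2 \<le> pi * Im z * (of_int n + b)\<^sup>2"
          using Im[OF that] by (intro mult_right_mono mult_left_mono) auto
        thus ?thesis unfolding norm_gterm by simp
      qed
      show "(\<lambda>n. exp (- (pi * (Im \<tau> / 2)) * (of_int n + b)\<^sup>2)) summable_on UNIV"
        using gauss_summable_int_shift[of "pi * (Im \<tau> / 2)"] that by auto
    qed
    moreover have hol: "(\<lambda>z. \<Sum>n\<in>X. gterm a b z n) holomorphic_on A" for X A
      unfolding gterm_def fexp_def by (intro holomorphic_intros) auto
    ultimately have "gsum a b holomorphic_on ball \<tau> r"
      using holomorphic_uniform_limit[where F = "finite_subsets_at_top UNIV" and f = "\<lambda>X z. \<Sum>n\<in>X. gterm a b z n"]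
      by (metis (no_types, lifting) always_eventually finite_subsets_at_top_neq_bot holomorphic_on_imp_continuous_on)
    thus ?thesis using that by (intro exI[of _ r]) (auto simp: r_def)
  qed
  hence "gsum a b analytic_on {\<tau>. Im \<tau> > 0}" unfolding analytic_on_def by blast
  thus ?thesis by (rule analytic_imp_holomorphic)
qed

lemma Im_neg_inverse_pos: "Im \<tau> > 0 \<Longrightarrow> Im (- 1 / \<tau>) > 0"
  by (simp add: Im_divide complex_neq_0 sum_power2_gt_zero_iff)

text \<open>Both sides are holomorphic in the upper half plane, since \<open>- \<i> * \<tau>\<close>
  then lies in the right half plane, off the branch cut of \<open>csqrt\<close>. They agree on the
  imaginary axis.\<close>

theorem gsum_transform:
  assumes "Im \<tau> > 0"
  shows "gsum a b \<tau> = fexp (of_real (a * b)) * gsum b (- a) (- 1 / \<tau>) / csqrt (- \<i> * \<tau>)"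
proof -
  define H where "H = {\<tau>. Im \<tau> > 0}"
  define f where "f = (\<lambda>\<tau>. gsum a b \<tau> - fexp (of_real (a * b)) * gsum b (- a) (- 1 / \<tau>) / csqrt (- \<i> * \<tau>))"
  have ho: "gsum a b holomorphic_on H" for a b using gsum_holomorphic unfolding H_def .
  have nz: "\<tau> \<noteq> 0" "csqrt (- \<i> * \<tau>) \<noteq> 0" "- \<i> * \<tau> \<notin> \<real>\<^sub>\<le>\<^sub>0" if "\<tau> \<in> H" for \<tau>
    using that by (auto simp: H_def complex_nonpos_Reals_iff)
  have "f holomorphic_on H" unfolding f_def
  proof (intro holomorphic_intros ho)
    have "(gsum b (- a) \<circ> (\<lambda>\<tau>. - 1 / \<tau>)) holomorphic_on H"
    proof (rule holomorphic_on_compose_gen[OF _ ho])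
      show "(\<lambda>\<tau>. - 1 / \<tau>) holomorphic_on H" using nz by (intro holomorphic_intros) auto
      show "(\<lambda>\<tau>. - 1 / \<tau>) ` H \<subseteq> H" using Im_neg_inverse_pos by (auto simp: H_def)
    qed
    thus "(\<lambda>\<tau>. gsum b (- a) (- 1 / \<tau>)) holomorphic_on H" by (simp add: o_def)
  qed (use nz in auto)
  have "f \<tau> = 0"
  proof (rule analytic_continuation[OF \<open>f holomorphic_on H\<close>])
    show "open H" unfolding H_def by (rule open_halfspace_Im_gt)
    show "connected H" unfolding H_def by (intro convex_connected convex_halfspace_Im_gt)
    define U where "U = (\<lambda>t. \<i> * of_real t) ` {0<..} "
    show "U \<subseteq> H" by (auto simp: U_def H_def)
    show "\<i> \<in> H" by (simp add: H_def)
    show "\<i> islimpt U" unfolding islimpt_approachable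
    proof (intro allI impI)
      fix e :: real assume "e > 0"
      have "\<i> * of_real (1 + e / 2) \<in> U" unfolding U_def using \<open>e > 0\<close> by (intro imageI) auto
      moreover have "\<i> * of_real (1 + e / 2) \<noteq> \<i>" using \<open>e > 0\<close> by (auto simp: complex_eq_iff)
      moreover have "dist (\<i> * of_real (1 + e / 2)) \<i> < e"
        using \<open>e > 0\<close> by (simp add: dist_norm algebra_simps norm_mult)
      ultimately show "\<exists>x'\<in>U. x' \<noteq> \<i> \<and> dist x' \<i> < e" by blast
    qed
    show "f z = 0" if "z \<in> U" for z
    proof -
      from that obtain t :: real where t: "t > 0" "z = \<i> * t" by (auto simp: U_def)
      have "- \<i> * z = of_real t" "- 1 / z = \<i> / t" using t by (auto simp: field_simps)
      moreover have "csqrt (of_real t) = of_real (sqrt t)" using t by (simp add: csqrt_of_real_nonneg)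
      ultimately show ?thesis unfolding f_def t(2) using gsum_transform_real[OF t(1), of a b] by simp
    qed
    show "\<tau> \<in> H" using assms by (simp add: H_def)
  qed
  thus ?thesis by (simp add: f_def)
qed

section \<open>Positive definite rational quadratic spaces\<close>

text \<open>One coordinate of a shifted lattice Gaussian: d is the value of the form on a basis
  vector, r the coordinate of a coset representative. The linear coefficient W is complex because it
  will be built from entries of Z. In \<open>dterm\<close>, \<open>k / (2 * d)\<close> is the
  coordinate of the dual vector that pairs to k with the basis vector.\<close>

definition lterm :: "real \<Rightarrow> complex \<Rightarrow> real \<Rightarrow> complex \<Rightarrow> int \<Rightarrow> complex" where
  "lterm d W r \<tau> n = fexp (of_real d * (\<tau> * (of_int n + of_real r)\<^sup>2 + 2 * (of_int n + of_real r) * W))"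

definition dterm :: "real \<Rightarrow> complex \<Rightarrow> real \<Rightarrow> complex \<Rightarrow> int \<Rightarrow> complex" where
  "dterm d W r \<tau> k = fexp (- of_real d * (of_int k / (2 * of_real d) - W)\<^sup>2 / \<tau>) * fexp (of_int k * of_real r)"

text \<open>The complex linear term is removed by completing the square, which moves it into the two
  real characteristics and a common factor C; then the inversion formula for the theta constant
  applies.\<close>

lemma line_poisson:
  assumes d: "d > 0" and \<tau>: "Im \<tau> > 0"
  shows "(\<lambda>n. norm (lterm d W r \<tau> n)) summable_on UNIV"
    and "(\<lambda>k. norm (dterm d W r \<tau> k)) summable_on UNIV"
    and "infsum (lterm d W r \<tau>) UNIV = infsum (dterm d W r \<tau>) UNIV / (sqrt (2 * d) * csqrt (- \<i> * \<tau>))"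
proof -
  define \<sigma> where "\<sigma> = 2 * of_real d * \<tau>"
  have \<sigma>: "Im \<sigma> > 0" using d \<tau> by (simp add: \<sigma>_def)
  \<comment> \<open>1 and the non-real number \<sigma> form a basis of the complex plane over the
    reals; g and a are the coordinates of \<open>2 * d * W\<close> in it. The part along \<sigma>
    shifts the summation variable, the real part becomes the twist.\<close>
  define g where "g = Im (2 * of_real d * W) / Im \<sigma>"
  define a where "a = Re (2 * of_real d * W - of_real g * \<sigma>)"
  have W: "2 * of_real d * W = of_real a + of_real g * \<sigma>"
    using \<sigma> by (simp add: complex_eq_iff a_def g_def)
  define C where "C = fexp (- \<sigma> * (of_real g)\<^sup>2 / 2 - of_real g * of_real a)"
  have l: "lterm d W r \<tau> n = C * gterm a (r + g) \<sigma> n" for n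
  proof -
    have "of_real d * (\<tau> * (of_int n + of_real r)\<^sup>2 + 2 * (of_int n + of_real r) * W) =
       \<sigma> * (of_int n + of_real r)\<^sup>2 / 2 + (of_int n + of_real r) * (2 * of_real d * W)"
      by (simp add: \<sigma>_def algebra_simps)
    also have "\<dots> = (- \<sigma> * (of_real g)\<^sup>2 / 2 - of_real g * of_real a) + (\<sigma> * (of_int n + of_real (r + g))\<^sup>2 / 2 +
        (of_int n + of_real (r + g)) * of_real a)"
      unfolding W by (simp add: power2_eq_square field_simps)
    finally show ?thesis
      unfolding lterm_def C_def gterm_def fexp_add[symmetric] by simp
  qed
  have dd: "dterm d W r \<tau> k = C * fexp (of_real (a * (r + g))) * gterm (r + g) (- a) (- 1 / \<sigma>) k" for k
  proof -
    have nz: "\<tau> \<noteq> 0" "\<sigma> \<noteq> 0" using \<tau> \<sigma> by auto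
    have "- of_real d * (of_int k / (2 * of_real d) - W)\<^sup>2 / \<tau> = - (of_int k - 2 * of_real d * W)\<^sup>2 / (2 * \<sigma>)"
      using d nz by (simp add: \<sigma>_def power2_eq_square field_simps)
    also have "\<dots> + of_int k * of_real r = (- \<sigma> * (of_real g)\<^sup>2 / 2 - of_real g * of_real a) + of_real (a * (r + g)) +
       (- 1 / \<sigma> * (of_int k + of_real (- a))\<^sup>2 / 2 + (of_int k + of_real (- a)) * of_real (r + g))"
      unfolding W using nz by (simp add: power2_eq_square field_simps)
    finally show ?thesis
      unfolding dterm_def C_def gterm_def fexp_add[symmetric] by simp
  qed
  show "(\<lambda>n. norm (lterm d W r \<tau> n)) summable_on UNIV"
    unfolding l norm_mult by (intro summable_on_cmult_right gterm_abs_summable \<sigma>)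
  show "(\<lambda>k. norm (dterm d W r \<tau> k)) summable_on UNIV"
    unfolding dd norm_mult by (intro summable_on_cmult_right gterm_abs_summable Im_neg_inverse_pos \<sigma>)
  \<comment> \<open>A positive real factor does not change the argument, so the principal root is
    multiplicative here.\<close>
  have "csqrt (- \<i> * \<sigma>) = csqrt (of_real (2 * d) * (- \<i> * \<tau>))"
    by (simp add: \<sigma>_def mult_ac)
  also have "\<dots> = of_real (sqrt (2 * d)) * csqrt (- \<i> * \<tau>)"
    using d by (subst csqrt_mult) (auto simp: csqrt_of_real_nonneg Arg_of_real Arg_bounded mpi_less_Arg Arg_le_pi)
  finally have s: "csqrt (- \<i> * \<sigma>) = of_real (sqrt (2 * d)) * csqrt (- \<i> * \<tau>)" .
  have "infsum (lterm d W r \<tau>) UNIV = C * gsum a (r + g) \<sigma>"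
    unfolding l[abs_def] gsum_def by (rule infsum_cmult_right')
  also have "\<dots> = C * fexp (of_real (a * (r + g))) * gsum (r + g) (- a) (- 1 / \<sigma>) / csqrt (- \<i> * \<sigma>)"
    by (subst gsum_transform[OF \<sigma>, of a]) (simp add: mult_ac)
  also have "C * fexp (of_real (a * (r + g))) * gsum (r + g) (- a) (- 1 / \<sigma>) = infsum (dterm d W r \<tau>) UNIV"
    unfolding dd[abs_def] gsum_def by (rule infsum_cmult_right'[symmetric])
  finally show "infsum (lterm d W r \<tau>) UNIV = infsum (dterm d W r \<tau>) UNIV / (sqrt (2 * d) * csqrt (- \<i> * \<tau>))"
    unfolding s .
qed

lemma abs_summable_prod_PiE_int:
  fixes f :: "'a \<Rightarrow> int \<Rightarrow> complex"
  assumes "finite A" "\<And>x. x \<in> A \<Longrightarrow> (\<lambda>n. norm (f x n)) summable_on UNIV"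
  shows "(\<lambda>g. norm (\<Prod>x\<in>A. f x (g x))) summable_on (PiE A (\<lambda>_. UNIV))"
  using assms abs_summable_on_prod_PiE[of A "\<lambda>_. UNIV" f] by (simp add: abs_summable_equivalent)

section \<open>Bilinear algebra and orthogonal bases\<close>

locale quad_space =
  fixes smul :: "rat \<Rightarrow> 'v::ab_group_add \<Rightarrow> 'v" and Q :: "'v \<Rightarrow> rat"
  assumes pdq: "pos_def_quadratic_space smul Q"
begin

sublocale vector_space smul
  using pdq unfolding pos_def_quadratic_space_def by blast

lemma Q_scale: "Q (smul a x) = a\<^sup>2 * Q x"
  using pdq unfolding pos_def_quadratic_space_def by blast

lemma Q_pos: "x \<noteq> 0 \<Longrightarrow> 0 < Q x"
  using pdq unfolding pos_def_quadratic_space_def by blast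

lemma polar_linear: "module_hom smul (*) (polar Q x)"
  using pdq module_hom_iff_linear unfolding pos_def_quadratic_space_def by blast

lemma polar_sym: "polar Q x y = polar Q y x"
  unfolding polar_def by (simp add: add.commute)

lemma polar_add_right: "polar Q x (y + z) = polar Q x y + polar Q x z"
  by (rule module_hom.add[OF polar_linear])

lemma polar_scale_right: "polar Q x (smul a y) = a * polar Q x y"
  by (rule module_hom.scale[OF polar_linear])

lemma polar_add_left: "polar Q (y + z) x = polar Q y x + polar Q z x"
  using polar_add_right polar_sym by metis

lemma polar_scale_left: "polar Q (smul a y) x = a * polar Q y x"
  using polar_scale_right polar_sym by metis

lemma polar_sum_right: "polar Q x (sum f A) = (\<Sum>a\<in>A. polar Q x (f a))"
  by (rule module_hom.sum[OF polar_linear])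

lemma polar_sum_left: "polar Q (sum f A) x = (\<Sum>a\<in>A. polar Q (f a) x)"
  using polar_sum_right[of x f A] by (simp add: polar_sym)

lemma polar_0_right [simp]: "polar Q x 0 = 0"
  by (rule module_hom.zero[OF polar_linear])

lemma polar_0_left [simp]: "polar Q 0 x = 0"
  using polar_0_right polar_sym by metis

lemma polar_diff_right: "polar Q x (y - z) = polar Q x y - polar Q x z"
  by (rule module_hom.diff[OF polar_linear])

lemma polar_diff_left: "polar Q (y - z) x = polar Q y x - polar Q z x"
  using polar_diff_right polar_sym by metis

lemma Q_0 [simp]: "Q 0 = 0"
  using Q_scale[of 0 0] by simp

lemma polar_self: "polar Q x x = 2 * Q x"
proof -
  have "x + x = smul 2 x" using scale_left_distrib[of 1 1 x] by simp
  thus ?thesis by (simp add: polar_def Q_scale)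
qed

lemma Q_eq: "Q x = polar Q x x / 2"
  by (simp add: polar_self)

lemma Q_nonneg: "Q x \<ge> 0"
  using Q_pos[of x] by (cases "x = 0") auto

definition orth_basis :: "'v set \<Rightarrow> bool" where
  "orth_basis E \<longleftrightarrow> finite E \<and> 0 \<notin> E \<and> (\<forall>e\<in>E. \<forall>f\<in>E. e \<noteq> f \<longrightarrow> polar Q e f = 0) \<and> span E = UNIV"

text \<open>The coefficient of the orthogonal projection onto e, whose denominator is the polar form
  of e with itself. It is a coordinate only if e belongs to an orthogonal basis.\<close>

definition coord :: "'v \<Rightarrow> 'v \<Rightarrow> rat" where
  "coord e x = polar Q x e / (2 * Q e)"

lemma gram_schmidt:
  assumes "finite S"
  shows "\<exists>E. finite E \<and> 0 \<notin> E \<and> (\<forall>e\<in>E. \<forall>f\<in>E. e \<noteq> f \<longrightarrow> polar Q e f = 0) \<and> span E = span S"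
  using assms
proof induction
  case empty
  show ?case by (rule exI[of _ "{}"]) auto
next
  case (insert v S)
  then obtain E where E: "finite E" "0 \<notin> E" "\<forall>e\<in>E. \<forall>f\<in>E. e \<noteq> f \<longrightarrow> polar Q e f = 0" "span E = span S"
    by blast
  define p where "p = (\<Sum>e\<in>E. smul (coord e v) e)"
  have p: "p \<in> span E" unfolding p_def by (intro span_sum span_scale span_base)
  have orth: "polar Q (v - p) f = 0" if "f \<in> E" for f
  proof -
    have "polar Q p f = (\<Sum>e\<in>E. if e = f then polar Q v f else 0)"
      unfolding p_def polar_sum_left polar_scale_left
    proof (rule sum.cong)
      fix e assume "e \<in> E"
      have "Q f \<noteq> 0" using Q_pos[of f] E(2) that by force
      thus "coord e v * polar Q e f = (if e = f then polar Q v f else 0)"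
        using E(3) \<open>e \<in> E\<close> that by (auto simp: coord_def polar_self)
    qed simp
    thus ?thesis using that E(1) by (simp add: polar_diff_left)
  qed
  have sp: "span (insert (v - p) E) = span (insert v S)"
  proof (rule antisym)
    have sub: "span S \<subseteq> span (insert v S)" "span E \<subseteq> span (insert (v - p) E)" by (auto intro!: span_mono)
    have "v - p \<in> span (insert v S)"
      using p E(4) sub by (intro span_diff) (auto intro: span_base)
    moreover have "E \<subseteq> span (insert v S)" using E(4) sub span_superset by blast
    ultimately show "span (insert (v - p) E) \<subseteq> span (insert v S)"
      by (intro span_minimal subspace_span) auto
    have "(v - p) + p \<in> span (insert (v - p) E)"
      using p sub by (intro span_add) (auto intro: span_base)
    moreover have "S \<subseteq> span (insert (v - p) E)" using E(4) sub span_superset by blast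
    ultimately show "span (insert v S) \<subseteq> span (insert (v - p) E)"
      by (intro span_minimal subspace_span) auto
  qed
  \<comment> \<open>If v already lies in the span, its remainder v - p is 0 and the family must not
    be enlarged by it.\<close>
  show ?case
  proof (cases "v - p = 0")
    case True
    hence "span (insert v S) = span E" using sp by (simp add: True)
    thus ?thesis using E by blast
  next
    case False
    have "polar Q f (v - p) = 0" if "f \<in> E" for f using orth[OF that] by (simp only: polar_sym)
    hence "\<forall>e\<in>insert (v - p) E. \<forall>f\<in>insert (v - p) E. e \<noteq> f \<longrightarrow> polar Q e f = 0"
      using E(3) orth by blast
    moreover have "0 \<notin> insert (v - p) E" using False E(2) by auto
    ultimately show ?thesis using E(1) sp by blast
  qed
qed

context
  fixes E assumes E: "orth_basis E"
begin

lemma finE: "finite E" and spanE: "span E = UNIV"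
  using E by (auto simp: orth_basis_def)

lemma orthE: "e \<in> E \<Longrightarrow> f \<in> E \<Longrightarrow> e \<noteq> f \<Longrightarrow> polar Q e f = 0"
  using E by (auto simp: orth_basis_def)

lemma QE_pos: "e \<in> E \<Longrightarrow> Q e > 0"
  using E Q_pos unfolding orth_basis_def by metis

lemma coord_comb:
  assumes "f \<in> E"
  shows "coord f (\<Sum>e\<in>E. smul (u e) e) = u f"
proof -
  have "polar Q (\<Sum>e\<in>E. smul (u e) e) f = (\<Sum>e\<in>E. if e = f then u f * (2 * Q f) else 0)"
    unfolding polar_sum_left polar_scale_left by (rule sum.cong) (use orthE assms in \<open>auto simp: polar_self\<close>)
  thus ?thesis using QE_pos[OF assms] finE assms by (simp add: coord_def)
qed

lemma comb_coord: "(\<Sum>e\<in>E. smul (coord e x) e) = x"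
proof -
  have "x \<in> span E" using spanE by simp
  then obtain u where "x = (\<Sum>e\<in>E. smul (u e) e)"
    unfolding span_finite[OF finE] by auto
  moreover have "coord e x = u e" if "e \<in> E" for e
    unfolding \<open>x = _\<close> by (rule coord_comb[OF that])
  ultimately show ?thesis by simp
qed

lemma indepE: "independent E"
proof (rule independent_if_scalars_zero[OF finE])
  fix f x assume "(\<Sum>x\<in>E. smul (f x) x) = 0" "x \<in> E"
  thus "f x = 0" using coord_comb[of x f] by (simp add: coord_def)
qed

lemma polar_coord: "polar Q x y = (\<Sum>e\<in>E. 2 * Q e * coord e x * coord e y)"
proof -
  have "polar Q x y = polar Q x (\<Sum>e\<in>E. smul (coord e y) e)" by (simp add: comb_coord)
  also have "\<dots> = (\<Sum>e\<in>E. 2 * Q e * coord e x * coord e y)"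
    unfolding polar_sum_right polar_scale_right
    by (rule sum.cong) (use QE_pos in \<open>force simp: coord_def\<close>)+
  finally show ?thesis .
qed

lemma Q_coord: "Q x = (\<Sum>e\<in>E. Q e * (coord e x)\<^sup>2)"
  unfolding Q_eq[of x] polar_coord by (simp add: power2_eq_square sum_divide_distrib)

lemma coord_eqI: "(\<And>e. e \<in> E \<Longrightarrow> coord e x = coord e y) \<Longrightarrow> x = y"
proof -
  assume "\<And>e. e \<in> E \<Longrightarrow> coord e x = coord e y"
  hence "(\<Sum>e\<in>E. smul (coord e x) e) = (\<Sum>e\<in>E. smul (coord e y) e)" by simp
  thus "x = y" unfolding comb_coord .
qed

end

lemma coord_add: "coord e (x + y) = coord e x + coord e y"
  by (simp add: coord_def polar_add_left add_divide_distrib)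

lemma coord_diff: "coord e (x - y) = coord e x - coord e y"
  by (simp add: coord_def polar_diff_left diff_divide_distrib)

lemma card_orth_basis:
  assumes "orth_basis E" "lattice_of_rank smul m L"
  shows "card E = m"
proof -
  from assms(2) obtain S where S: "finite S" "card S = m" "independent S" "span S = UNIV"
    unfolding lattice_of_rank_def by blast
  have "dim UNIV = card S" by (rule dim_eq_card) (use S in auto)
  moreover have "dim UNIV = card E" by (rule dim_eq_card) (use assms(1) indepE spanE in auto)
  ultimately show ?thesis using S by simp
qed

end

section \<open>Poisson summation for lattices\<close>

lemma of_real_of_rat: "complex_of_real (of_rat q) = of_rat q"
  by (cases q) (simp add: of_rat_rat)

lemma of_rat_Ints: "q \<in> \<int> \<Longrightarrow> (of_rat q :: 'a :: field_char_0) \<in> \<int>"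
  by (auto elim!: Ints_cases)

lemma of_rat_Ints_iff: "(of_rat q :: complex) \<in> \<int> \<longleftrightarrow> q \<in> \<int>"
proof
  assume "(of_rat q :: complex) \<in> \<int>"
  then obtain n :: int where "(of_rat q :: complex) = of_int n" by (auto elim: Ints_cases)
  hence "(of_rat q :: complex) = of_rat (of_int n)" by simp
  thus "q \<in> \<int>" by (simp only: of_rat_eq_iff Ints_of_int)
qed (rule of_rat_Ints)

lemma infsum_sum_finite:
  fixes f :: "'a \<Rightarrow> 'b \<Rightarrow> complex"
  assumes "finite R" "\<And>r. r \<in> R \<Longrightarrow> f r summable_on A"
  shows "(\<lambda>y. \<Sum>r\<in>R. f r y) summable_on A \<and> (\<Sum>\<^sub>\<infinity>y\<in>A. \<Sum>r\<in>R. f r y) = (\<Sum>r\<in>R. \<Sum>\<^sub>\<infinity>y\<in>A. f r y)"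
  using assms by (induction R) (auto simp: infsum_add summable_on_add)

context quad_space
begin

definition comb :: "'v set \<Rightarrow> ('v \<Rightarrow> rat) \<Rightarrow> 'v" where
  "comb E u = (\<Sum>e\<in>E. smul (u e) e)"

abbreviation int_comb :: "'v set \<Rightarrow> ('v \<Rightarrow> int) \<Rightarrow> 'v" where
  "int_comb E n \<equiv> comb E (\<lambda>e. of_int (n e))"

abbreviation dual_comb :: "'v set \<Rightarrow> ('v \<Rightarrow> int) \<Rightarrow> 'v" where
  "dual_comb E k \<equiv> comb E (\<lambda>e. of_int (k e) / (2 * Q e))"

abbreviation dual_span :: "'v set \<Rightarrow> 'v set" where
  "dual_span E \<equiv> {y. \<forall>e\<in>E. polar Q y e \<in> \<int>}"

text \<open>\<open>Q x * \<tau>\<close> plus the polar form of x with the complex vector whose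
  coordinates are W. The space is rational, so a complex vector exists only through its coordinates
  in E. In the same sense \<open>qdual\<close> is the value of Q at y - W, divided by
  \<open>- \<tau>\<close>.\<close>

definition qexp :: "'v set \<Rightarrow> complex \<Rightarrow> ('v \<Rightarrow> complex) \<Rightarrow> 'v \<Rightarrow> complex" where
  "qexp E \<tau> W x = (\<Sum>e\<in>E. of_rat (Q e) * (\<tau> * (of_rat (coord e x))\<^sup>2 + 2 * of_rat (coord e x) * W e))"

definition qdual :: "'v set \<Rightarrow> complex \<Rightarrow> ('v \<Rightarrow> complex) \<Rightarrow> 'v \<Rightarrow> complex" where
  "qdual E \<tau> W y = - (\<Sum>e\<in>E. of_rat (Q e) * (of_rat (coord e y) - W e)\<^sup>2) / \<tau>"

context
  fixes E assumes E: "orth_basis E"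
begin

lemma coord_comb': "e \<in> E \<Longrightarrow> coord e (comb E u) = u e"
  unfolding comb_def by (rule coord_comb[OF E])

lemma polar_eq_coord: "e \<in> E \<Longrightarrow> polar Q x e = 2 * Q e * coord e x"
  using QE_pos[OF E, of e] by (simp add: coord_def)

text \<open>The polar form of e with itself is \<open>2 * Q e\<close>, so the vectors
  \<open>e / (2 * Q e)\<close> are the dual basis of E.\<close>

lemma orth_dual_bij:
  "bij_betw (dual_comb E) (E \<rightarrow>\<^sub>E (UNIV :: int set)) (dual_span E)"
proof (rule bij_betw_byWitness[where f' = "\<lambda>y. \<lambda>e\<in>E. \<lfloor>polar Q y e\<rfloor>"])
  have *: "polar Q (dual_comb E k) e = of_int (k e)" if "e \<in> E" for k e
    using QE_pos[OF E that] by (simp add: polar_eq_coord[OF that] coord_comb'[OF that])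
  show "\<forall>k\<in>E \<rightarrow>\<^sub>E UNIV. (\<lambda>e\<in>E. \<lfloor>polar Q (dual_comb E k) e\<rfloor>) = (k :: 'v \<Rightarrow> int)"
    using * by (auto simp: PiE_def extensional_def)
  show "\<forall>y\<in>dual_span E. comb E (\<lambda>e. of_int ((\<lambda>e\<in>E. \<lfloor>polar Q y e\<rfloor>) e) / (2 * Q e)) = y"
  proof
    fix y assume y: "y \<in> dual_span E"
    show "comb E (\<lambda>e. of_int ((\<lambda>e\<in>E. \<lfloor>polar Q y e\<rfloor>) e) / (2 * Q e)) = y"
    proof (rule coord_eqI[OF E])
      fix e assume e: "e \<in> E"
      have "of_int \<lfloor>polar Q y e\<rfloor> = polar Q y e" using y e by (auto elim!: Ints_cases)
      thus "coord e (comb E (\<lambda>e. of_int ((\<lambda>e\<in>E. \<lfloor>polar Q y e\<rfloor>) e) / (2 * Q e))) = coord e y"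
        using e by (simp add: coord_comb'[OF e] coord_def[of e y])
    qed
  qed
  show "(dual_comb E) ` (E \<rightarrow>\<^sub>E UNIV) \<subseteq> dual_span E"
    using * by auto
qed auto

text \<open>Summability is shown on the dual of the integral span of E because that set contains
  every integral lattice through E as well as the dual of such a lattice.\<close>

lemma qexp_summable:
  assumes \<tau>: "Im \<tau> > 0"
  shows "(\<lambda>x. norm (fexp (qexp E \<tau> W x))) summable_on dual_span E"
proof -
  \<comment> \<open>At a point with coordinate \<open>k / (2 * Q e)\<close> the quadratic
    coefficient \<open>Q e\<close> turns into \<open>1 / (4 * Q e)\<close>, and the linear
    coefficient is rescaled accordingly.\<close>
  define f where "f = (\<lambda>e. lterm (1 / (4 * of_rat (Q e))) (2 * of_rat (Q e) * W e) 0 \<tau>)"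
  have "fexp (qexp E \<tau> W (dual_comb E k)) = (\<Prod>e\<in>E. f e (k e))" for k
    unfolding qexp_def fexp_sum[OF finE[OF E]]
  proof (rule prod.cong)
    fix e assume e: "e \<in> E"
    have nz: "(of_rat (Q e) :: complex) \<noteq> 0" using QE_pos[OF E e] by simp
    show "fexp (of_rat (Q e) * (\<tau> * (of_rat (coord e (dual_comb E k)))\<^sup>2 +
         2 * of_rat (coord e (dual_comb E k)) * W e)) = f e (k e)"
      unfolding f_def lterm_def coord_comb'[OF e] using nz
      by (intro arg_cong[where f = fexp]) (simp add: of_rat_divide of_rat_mult of_real_of_rat power2_eq_square field_simps)
  qed simp
  moreover have "(\<lambda>k. norm (\<Prod>e\<in>E. f e (k e))) summable_on (E \<rightarrow>\<^sub>E UNIV)"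
    by (rule abs_summable_prod_PiE_int[OF finE[OF E]])
       (use QE_pos[OF E] in \<open>auto simp: f_def intro!: line_poisson \<tau>\<close>)
  ultimately show ?thesis
    by (subst summable_on_reindex_bij_betw[OF orth_dual_bij, symmetric]) simp
qed

lemma qdual_factor:
  "fexp (qdual E \<tau> W (dual_comb E k)) *
     fexp (of_rat (polar Q (dual_comb E k) r)) =
   (\<Prod>e\<in>E. dterm (of_rat (Q e)) (W e) (of_rat (coord e r)) \<tau> (k e))"
proof -
  have "qdual E \<tau> W (dual_comb E k) =
     (\<Sum>e\<in>E. - of_real (of_rat (Q e)) * (of_int (k e) / (2 * of_real (of_rat (Q e))) - W e)\<^sup>2 / \<tau>)"
    unfolding qdual_def sum_divide_distrib sum_negf[symmetric]
    by (rule sum.cong) (auto simp: coord_comb' of_rat_divide of_rat_mult of_real_of_rat)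
  moreover have "(of_rat (polar Q (dual_comb E k) r) :: complex) =
    (\<Sum>e\<in>E. of_int (k e) * of_real (of_rat (coord e r)))"
    unfolding polar_coord[OF E] of_rat_sum
  proof (rule sum.cong)
    fix e assume e: "e \<in> E"
    have "2 * Q e * coord e (dual_comb E k) * coord e r = of_int (k e) * coord e r"
      using QE_pos[OF E e] by (simp add: coord_comb'[OF e])
    thus "(of_rat (2 * Q e * coord e (dual_comb E k) * coord e r) :: complex) =
        of_int (k e) * of_real (of_rat (coord e r))"
      by (simp only: of_rat_mult of_real_of_rat of_rat_of_int_eq)
  qed simp
  ultimately show ?thesis
    unfolding dterm_def prod.distrib fexp_sum[OF finE[OF E], symmetric] by simp
qed

lemma qdual_summable:
  assumes \<tau>: "Im \<tau> > 0"
  shows "(\<lambda>y. norm (fexp (qdual E \<tau> W y))) summable_on dual_span E"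
proof -
  have "(\<lambda>k. norm (\<Prod>e\<in>E. dterm (of_rat (Q e)) (W e) (of_rat (coord e 0)) \<tau> (k e))) summable_on (E \<rightarrow>\<^sub>E UNIV)"
    by (rule abs_summable_prod_PiE_int[OF finE[OF E]]) (use QE_pos[OF E] in \<open>auto intro!: line_poisson \<tau>\<close>)
  thus ?thesis
    unfolding qdual_factor[symmetric] by (subst summable_on_reindex_bij_betw[OF orth_dual_bij, symmetric]) simp
qed

text \<open>Along an orthogonal basis the exponential is a product of functions of one coordinate,
  so the formula for a coset of the integral span of E is a product of one-dimensional ones. The
  representative r survives only as a character on the dual side.\<close>

lemma coset_poisson:
  assumes \<tau>: "Im \<tau> > 0"
  shows "(\<Sum>\<^sub>\<infinity>n\<in>E \<rightarrow>\<^sub>E (UNIV :: int set). fexp (qexp E \<tau> W (r + int_comb E n))) =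
    (\<Prod>e\<in>E. 1 / sqrt (2 * of_rat (Q e))) / csqrt (- \<i> * \<tau>) ^ card E *
    (\<Sum>\<^sub>\<infinity>y\<in>dual_span E. fexp (qdual E \<tau> W y) * fexp (of_rat (polar Q y r)))"
proof -
  define f where "f = (\<lambda>e. lterm (of_rat (Q e)) (W e) (of_rat (coord e r)) \<tau>)"
  define g where "g = (\<lambda>e. dterm (of_rat (Q e)) (W e) (of_rat (coord e r)) \<tau>)"
  have fn: "fexp (qexp E \<tau> W (r + int_comb E n)) = (\<Prod>e\<in>E. f e (n e))" for n
    unfolding qexp_def fexp_sum[OF finE[OF E]]
    by (rule prod.cong) (auto simp: f_def lterm_def coord_add coord_comb' of_rat_add of_real_of_rat add_ac)
  have "(\<Sum>\<^sub>\<infinity>n\<in>E \<rightarrow>\<^sub>E (UNIV :: int set). fexp (qexp E \<tau> W (r + int_comb E n))) = (\<Prod>e\<in>E. infsum (f e) UNIV)"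
    unfolding fn by (rule infsum_prod_PiE_abs[OF finE[OF E]])
      (use QE_pos[OF E] in \<open>auto simp: f_def intro!: line_poisson \<tau>\<close>)
  also have "\<dots> = (\<Prod>e\<in>E. (1 / sqrt (2 * of_rat (Q e))) / csqrt (- \<i> * \<tau>) * infsum (g e) UNIV)"
  proof (rule prod.cong)
    fix e assume "e \<in> E"
    hence "(of_rat (Q e) :: real) > 0" using QE_pos[OF E] by simp
    from line_poisson(3)[OF this \<tau>, of "W e" "of_rat (coord e r)"]
    show "infsum (f e) UNIV = (1 / sqrt (2 * of_rat (Q e))) / csqrt (- \<i> * \<tau>) * infsum (g e) UNIV"
      unfolding f_def g_def by simp
  qed simp
  also have "\<dots> = (\<Prod>e\<in>E. 1 / sqrt (2 * of_rat (Q e))) / csqrt (- \<i> * \<tau>) ^ card E * (\<Prod>e\<in>E. infsum (g e) UNIV)"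
    by (simp add: prod.distrib prod_dividef)
  also have "(\<Prod>e\<in>E. infsum (g e) UNIV) = (\<Sum>\<^sub>\<infinity>k\<in>E \<rightarrow>\<^sub>E UNIV. \<Prod>e\<in>E. g e (k e))"
    by (rule infsum_prod_PiE_abs[OF finE[OF E], symmetric])
      (use QE_pos[OF E] in \<open>auto simp: g_def intro!: line_poisson \<tau>\<close>)
  also have "\<dots> = (\<Sum>\<^sub>\<infinity>y\<in>dual_span E. fexp (qdual E \<tau> W y) * fexp (of_rat (polar Q y r)))"
    unfolding g_def qdual_factor[symmetric] by (rule infsum_reindex_bij_betw[OF orth_dual_bij])
  finally show ?thesis .
qed

end

text \<open>K is the index of the integral span of E in L times the product of the numbers
  \<open>1 / sqrt (2 * Q e)\<close>, the reciprocal of the covolume of L for the polar form. It is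
  quantified before \<tau> and W: one constant serves all Gaussians.\<close>

lemma lattice_poisson:
  assumes E: "orth_basis E" and EL: "E \<subseteq> L" and L0: "0 \<in> L"
    and Ladd: "\<And>x y. x \<in> L \<Longrightarrow> y \<in> L \<Longrightarrow> x + y \<in> L" and Ldiff: "\<And>x y. x \<in> L \<Longrightarrow> y \<in> L \<Longrightarrow> x - y \<in> L"
    and int: "\<And>x y. x \<in> L \<Longrightarrow> y \<in> L \<Longrightarrow> polar Q x y \<in> \<int>"
  shows "\<exists>K>0. \<forall>\<tau> W. Im \<tau> > 0 \<longrightarrow>
    (\<Sum>\<^sub>\<infinity>x\<in>L. fexp (qexp E \<tau> W x)) =
    of_real K / csqrt (- \<i> * \<tau>) ^ card E * (\<Sum>\<^sub>\<infinity>y\<in>dual_lattice Q L. fexp (qdual E \<tau> W y))"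
proof -
  define M where "M = dual_span E"
  \<comment> \<open>Representatives of L modulo the integral span of E: the lattice points in the
    half-open box spanned by E. \<open>red\<close> subtracts the integral parts of the
    coordinates.\<close>
  define R where "R = {x \<in> L. \<forall>e\<in>E. 0 \<le> coord e x \<and> coord e x < 1}"
  define red where "red = (\<lambda>x. x - comb E (\<lambda>e. of_int \<lfloor>coord e x\<rfloor>))"
  have LM: "L \<subseteq> M" using int EL by (auto simp: M_def)
  have DM: "dual_lattice Q L \<subseteq> M" using EL by (auto simp: M_def dual_lattice_def)
  have Lsmul: "smul (of_int n) x \<in> L" if "x \<in> L" for x and n :: int
  proof (induction n rule: int_induct[where k = 0])
    case base show ?case using L0 by simp
  next
    case (step1 i)
    thus ?case using Ladd[OF _ that] by (simp add: scale_left_distrib)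
  next
    case (step2 i)
    thus ?case using Ldiff[OF _ that] by (simp add: scale_left_diff_distrib)
  qed
  have Lsum: "(\<Sum>x\<in>A. f x) \<in> L" if "\<And>x. x \<in> A \<Longrightarrow> f x \<in> L" "finite A" for f and A :: "'v set"
    using that(2,1) by induction (auto intro: L0 Ladd)
  have combL: "int_comb E n \<in> L" for n
    unfolding comb_def using EL finE[OF E] by (intro Lsum Lsmul) auto
  have coord_red: "coord e (red x) = frac (coord e x)" if "e \<in> E" for e x
    by (simp add: red_def coord_diff coord_comb'[OF E that] frac_def)
  have redR: "red x \<in> R" if "x \<in> L" for x
    using that coord_red Ldiff[OF that combL] unfolding R_def by (auto simp: frac_lt_1 red_def)
  \<comment> \<open>A point of R is determined by its pairings with the vectors of E, which are
    integers between 0 and \<open>2 * Q e\<close>.\<close>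
  have finR: "finite R"
  proof -
    define h where "h = (\<lambda>x. \<lambda>e\<in>E. \<lfloor>polar Q x e\<rfloor>)"
    have "inj_on h R"
    proof (rule inj_onI)
      fix x y assume xy: "x \<in> R" "y \<in> R" "h x = h y"
      show "x = y"
      proof (rule coord_eqI[OF E])
        fix e assume e: "e \<in> E"
        have "\<lfloor>polar Q x e\<rfloor> = \<lfloor>polar Q y e\<rfloor>" using fun_cong[OF xy(3), of e] e by (simp add: h_def)
        moreover have "polar Q x e \<in> \<int>" "polar Q y e \<in> \<int>" using xy e EL by (auto simp: R_def intro: int)
        ultimately have "polar Q x e = polar Q y e" by (auto elim!: Ints_cases)
        thus "coord e x = coord e y" by (simp add: coord_def)
      qed
    qed
    moreover have "h ` R \<subseteq> (PiE E (\<lambda>e. {0..\<lfloor>2 * Q e\<rfloor>}))"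
    proof (clarsimp simp: h_def)
      fix x e assume x: "x \<in> R" and e: "e \<in> E"
      hence "0 \<le> coord e x" "coord e x \<le> 1" by (auto simp: R_def less_imp_le)
      hence "0 \<le> 2 * Q e * coord e x" "2 * Q e * coord e x \<le> 2 * Q e * 1"
        using QE_pos[OF E e] by (auto intro!: mult_nonneg_nonneg mult_left_mono)
      thus "0 \<le> polar Q x e \<and> \<lfloor>polar Q x e\<rfloor> \<le> \<lfloor>2 * Q e\<rfloor>"
        by (auto simp: polar_eq_coord[OF E e] intro!: floor_mono)
    qed
    moreover have "finite (PiE E (\<lambda>e. {0..\<lfloor>2 * Q e\<rfloor>}))" using finE[OF E] by (intro finite_PiE) auto
    ultimately show ?thesis using finite_imageD finite_subset by blast
  qed
  have R0: "0 \<in> R" using L0 by (simp add: R_def coord_def)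
  \<comment> \<open>Orthogonality of characters on the finite quotient: r is sent to
    \<open>fexp (polar Q y r)\<close>, and this character is trivial exactly when y lies in the dual
    of L.\<close>
  have charsum: "(\<Sum>r\<in>R. fexp (of_rat (polar Q y r))) = (if y \<in> dual_lattice Q L then of_nat (card R) else 0)"
    if y: "y \<in> M" for y
  proof (cases "y \<in> dual_lattice Q L")
    case True
    hence "fexp (of_rat (polar Q y r)) = 1" if "r \<in> R" for r
      using that by (intro fexp_Ints of_rat_Ints) (auto simp: dual_lattice_def R_def)
    thus ?thesis using True by simp
  next
    case False
    then obtain x where x: "x \<in> L" "polar Q y x \<notin> \<int>" by (auto simp: dual_lattice_def)
    \<comment> \<open>Translation by x on the quotient, expressed on representatives. It permutes R
      and multiplies the character sum by \<open>fexp (polar Q y x)\<close>, which is not 1.\<close>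
    define \<phi> where "\<phi> = (\<lambda>r. red (r + x))"
    have \<phi>R: "\<phi> ` R \<subseteq> R" using redR Ladd[OF _ x(1)] by (auto simp: \<phi>_def R_def)
    have "inj_on \<phi> R"
    proof (rule inj_onI)
      fix r s assume rs: "r \<in> R" "s \<in> R" "\<phi> r = \<phi> s"
      show "r = s"
      proof (rule coord_eqI[OF E])
        fix e assume e: "e \<in> E"
        have "frac (coord e r + coord e x) = frac (coord e s + coord e x)"
          using arg_cong[OF rs(3), of "coord e"] by (simp add: \<phi>_def coord_red[OF e] coord_add)
        hence "coord e r - coord e s = of_int (\<lfloor>coord e r + coord e x\<rfloor> - \<lfloor>coord e s + coord e x\<rfloor>)"
          by (simp add: frac_def algebra_simps)
        moreover have "0 \<le> coord e r" "coord e r < 1" "0 \<le> coord e s" "coord e s < 1"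
          using rs e by (auto simp: R_def)
        hence "\<bar>coord e r - coord e s\<bar> < 1" by linarith
        ultimately have "\<bar>rat_of_int (\<lfloor>coord e r + coord e x\<rfloor> - \<lfloor>coord e s + coord e x\<rfloor>)\<bar> < 1" by metis
        hence "\<lfloor>coord e r + coord e x\<rfloor> - \<lfloor>coord e s + coord e x\<rfloor> = 0" by linarith
        with \<open>coord e r - coord e s = _\<close> show "coord e r = coord e s" by simp
      qed
    qed
    hence bij: "bij_betw \<phi> R R"
      unfolding bij_betw_def using endo_inj_surj[OF finR \<phi>R] by blast
    have "(\<Sum>r\<in>R. fexp (of_rat (polar Q y r))) = (\<Sum>r\<in>R. fexp (of_rat (polar Q y (\<phi> r))))"
      by (rule sum.reindex_bij_betw[OF bij, symmetric])
    also have "\<dots> = (\<Sum>r\<in>R. fexp (of_rat (polar Q y x)) * fexp (of_rat (polar Q y r)))"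
    proof (rule sum.cong)
      fix r
      define c where "c = polar Q y (comb E (\<lambda>e. of_int \<lfloor>coord e (r + x)\<rfloor>))"
      have "c \<in> \<int>" unfolding c_def comb_def polar_sum_right polar_scale_right
        using y by (intro Ints_sum Ints_mult) (auto simp: M_def)
      hence "fexp (of_rat (- c)) = 1" by (intro fexp_Ints of_rat_Ints) auto
      moreover have "polar Q y (\<phi> r) = polar Q y x + polar Q y r + (- c)"
        by (simp add: \<phi>_def red_def c_def polar_diff_right polar_add_right)
      ultimately show "fexp (of_rat (polar Q y (\<phi> r))) = fexp (of_rat (polar Q y x)) * fexp (of_rat (polar Q y r))"
        by (simp only: of_rat_add fexp_add mult_1_right)
    qed simp
    also have "\<dots> = fexp (of_rat (polar Q y x)) * (\<Sum>r\<in>R. fexp (of_rat (polar Q y r)))"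
      by (rule sum_distrib_left[symmetric])
    finally have "(\<Sum>r\<in>R. fexp (of_rat (polar Q y r))) * (1 - fexp (of_rat (polar Q y x))) = 0"
      unfolding right_diff_distrib by (simp add: mult.commute)
    moreover have "fexp (of_rat (polar Q y x)) \<noteq> 1" unfolding fexp_eq_1_iff of_rat_Ints_iff by fact
    ultimately show ?thesis using False by simp
  qed
  define k0 where "k0 = (\<Prod>e\<in>E. 1 / sqrt (2 * of_rat (Q e)))"
  have k0: "k0 > 0" unfolding k0_def using QE_pos[OF E] by (intro prod_pos) auto
  define K where "K = k0 * card R"
  have "card R > 0" using finR R0 card_gt_0_iff by blast
  hence "K > 0" using k0 by (simp add: K_def)
  moreover have "(\<Sum>\<^sub>\<infinity>x\<in>L. fexp (qexp E \<tau> W x)) =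
    of_real K / csqrt (- \<i> * \<tau>) ^ card E * (\<Sum>\<^sub>\<infinity>y\<in>dual_lattice Q L. fexp (qdual E \<tau> W y))"
    if \<tau>: "Im \<tau> > 0" for \<tau> W
  proof -
    let ?s = "csqrt (- \<i> * \<tau>) ^ card E"
    have bij: "bij_betw (\<lambda>(r, n). r + int_comb E n) (R \<times> (E \<rightarrow>\<^sub>E (UNIV :: int set))) L"
    proof (rule bij_betw_byWitness[where f' = "\<lambda>x. (red x, \<lambda>e\<in>E. \<lfloor>coord e x\<rfloor>)"])
      show "\<forall>p\<in>R \<times> (E \<rightarrow>\<^sub>E UNIV). (red (case p of (r, n) \<Rightarrow> r + int_comb E n),
          \<lambda>e\<in>E. \<lfloor>coord e (case p of (r, n) \<Rightarrow> r + int_comb E n)\<rfloor>) = p"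
      proof (clarify)
        fix r and n :: "'v \<Rightarrow> int" assume r: "r \<in> R" and n: "n \<in> E \<rightarrow>\<^sub>E UNIV"
        have fl: "\<lfloor>coord e (r + int_comb E n)\<rfloor> = n e" if "e \<in> E" for e
        proof -
          have "\<lfloor>coord e r\<rfloor> = 0" using r that by (auto simp: R_def floor_eq_iff)
          thus ?thesis by (simp add: coord_add coord_comb'[OF E that])
        qed
        have "comb E (\<lambda>e. of_int \<lfloor>coord e (r + int_comb E n)\<rfloor>) = int_comb E n"
          unfolding comb_def by (rule sum.cong) (use fl[unfolded comb_def] in auto)
        hence "red (r + int_comb E n) = r" by (simp add: red_def)
        moreover have "(\<lambda>e\<in>E. \<lfloor>coord e (r + int_comb E n)\<rfloor>) = n"
          using n fl by (auto simp: PiE_def extensional_def)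
        ultimately show "red (r + int_comb E n) = r \<and>
           (\<lambda>e\<in>E. \<lfloor>coord e (r + int_comb E n)\<rfloor>) = n" ..
      qed
      show "\<forall>x\<in>L. (case (red x, \<lambda>e\<in>E. \<lfloor>coord e x\<rfloor>) of (r, n) \<Rightarrow> r + int_comb E n) = x"
        by (auto simp: red_def comb_def)
      show "(\<lambda>(r, n). r + int_comb E n) ` (R \<times> (E \<rightarrow>\<^sub>E UNIV)) \<subseteq> L"
        using combL by (auto simp: R_def intro: Ladd)
      show "(\<lambda>x. (red x, \<lambda>e\<in>E. \<lfloor>coord e x\<rfloor>)) ` L \<subseteq> R \<times> (E \<rightarrow>\<^sub>E UNIV)"
        using redR by auto
    qed
    have sumL: "(\<lambda>x. fexp (qexp E \<tau> W x)) summable_on L"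
      by (rule summable_on_subset_banach[OF abs_summable_summable[OF qexp_summable[OF E \<tau>]] LM[unfolded M_def]])
    have sumM: "(\<lambda>y. norm (fexp (qdual E \<tau> W y))) summable_on M"
      unfolding M_def by (rule qdual_summable[OF E \<tau>])
    have sumMr: "(\<lambda>y. fexp (qdual E \<tau> W y) * fexp (of_rat (polar Q y r))) summable_on M" for r
    proof (rule abs_summable_summable)
      have "norm (fexp (of_rat q)) = 1" for q
        unfolding of_real_of_rat[symmetric] by (simp add: norm_fexp)
      thus "(\<lambda>y. norm (fexp (qdual E \<tau> W y) * fexp (of_rat (polar Q y r)))) summable_on M"
        using sumM by (simp add: norm_mult)
    qed
    have "(\<Sum>\<^sub>\<infinity>x\<in>L. fexp (qexp E \<tau> W x)) =
       (\<Sum>\<^sub>\<infinity>(r, n)\<in>R \<times> (E \<rightarrow>\<^sub>E (UNIV :: int set)). fexp (qexp E \<tau> W (r + int_comb E n)))"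
      by (subst infsum_reindex_bij_betw[OF bij, symmetric]) (simp add: case_prod_unfold)
    also have "\<dots> = (\<Sum>\<^sub>\<infinity>r\<in>R. \<Sum>\<^sub>\<infinity>n\<in>E \<rightarrow>\<^sub>E (UNIV :: int set). fexp (qexp E \<tau> W (r + int_comb E n)))"
    proof (rule infsum_Sigma'_banach[symmetric])
      show "(\<lambda>(r, n). fexp (qexp E \<tau> W (r + int_comb E n))) summable_on (R \<times> (E \<rightarrow>\<^sub>E (UNIV :: int set)))"
        using sumL by (subst (asm) summable_on_reindex_bij_betw[OF bij, symmetric]) (simp add: case_prod_unfold)
    qed
    also have "\<dots> = (\<Sum>r\<in>R. k0 / ?s * (\<Sum>\<^sub>\<infinity>y\<in>M. fexp (qdual E \<tau> W y) * fexp (of_rat (polar Q y r))))"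
      unfolding infsum_finite[OF finR] M_def k0_def by (rule sum.cong[OF refl]) (rule coset_poisson[OF E \<tau>])
    also have "\<dots> = k0 / ?s * (\<Sum>r\<in>R. \<Sum>\<^sub>\<infinity>y\<in>M. fexp (qdual E \<tau> W y) * fexp (of_rat (polar Q y r)))"
      by (rule sum_distrib_left[symmetric])
    also have "(\<Sum>r\<in>R. \<Sum>\<^sub>\<infinity>y\<in>M. fexp (qdual E \<tau> W y) * fexp (of_rat (polar Q y r))) =
        (\<Sum>\<^sub>\<infinity>y\<in>M. \<Sum>r\<in>R. fexp (qdual E \<tau> W y) * fexp (of_rat (polar Q y r)))"
      using infsum_sum_finite[OF finR, of "\<lambda>r y. fexp (qdual E \<tau> W y) * fexp (of_rat (polar Q y r))" M] sumMr by simp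
    also have "\<dots> = (\<Sum>\<^sub>\<infinity>y\<in>M. fexp (qdual E \<tau> W y) * (if y \<in> dual_lattice Q L then of_nat (card R) else 0))"
      by (rule infsum_cong) (simp only: sum_distrib_left[symmetric] charsum)
    also have "\<dots> = (\<Sum>\<^sub>\<infinity>y\<in>dual_lattice Q L. fexp (qdual E \<tau> W y) * of_nat (card R))"
      by (rule infsum_cong_neutral) (use DM in auto)
    also have "\<dots> = (\<Sum>\<^sub>\<infinity>y\<in>dual_lattice Q L. fexp (qdual E \<tau> W y)) * of_nat (card R)"
      by (rule infsum_cmult_left')
    finally show ?thesis by (simp add: K_def mult_ac)
  qed
  ultimately show ?thesis by blast
qed

end

section \<open>The action on the Siegel upper half space\<close>

lemma sum_UNIV_Plus: "(\<Sum>i\<in>(UNIV :: ('a::finite + 'b::finite) set). f i) = (\<Sum>i\<in>UNIV. f (Inl i)) + (\<Sum>i\<in>UNIV. f (Inr i))"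
proof -
  have "(\<Sum>i\<in>(UNIV :: ('a + 'b) set). f i) = (\<Sum>i\<in>(UNIV :: 'a set) <+> (UNIV :: 'b set). f i)" by simp
  also have "\<dots> = (\<Sum>i\<in>UNIV. f (Inl i)) + (\<Sum>i\<in>UNIV. f (Inr i))"
    by (subst sum.Plus) auto
  finally show ?thesis .
qed

lemma matrix_add_rdistrib: "(A + B) ** C = A ** C + B ** (C :: 'a::semiring_1^'n^'m)"
  by (simp add: vec_eq_iff matrix_matrix_mult_def distrib_right sum.distrib)

lemma matrix_inv_inverse:
  assumes "invertible (A :: 'a::semiring_1^'n^'m)"
  shows matrix_inv_right: "A ** matrix_inv A = mat 1" and matrix_inv_left: "matrix_inv A ** A = mat 1"
proof -
  have "A ** matrix_inv A = mat 1 \<and> matrix_inv A ** A = mat 1"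
    using assms unfolding invertible_def matrix_inv_def by (rule someI_ex)
  thus "A ** matrix_inv A = mat 1" "matrix_inv A ** A = mat 1" by auto
qed

lemma matrix_minus_left: "(- A) ** C = - (A ** (C :: 'a::ring_1^'n^'m))"
  by (simp add: vec_eq_iff matrix_matrix_mult_def sum_negf)

lemma matrix_minus_right: "A ** (- C) = - (A ** (C :: 'a::ring_1^'n^'m))"
  by (simp add: vec_eq_iff matrix_matrix_mult_def sum_negf)

lemma transpose_add: "transpose (A + B) = transpose A + transpose B"
  by (simp add: vec_eq_iff transpose_def)

lemma transpose_diff: "transpose (A - B) = transpose A - transpose B"
  by (simp add: vec_eq_iff transpose_def)

lemma matrix_inv_unique:
  fixes A B :: "'a::field^'n^'n"
  assumes "A ** B = mat 1"
  shows "matrix_inv A = B"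
proof -
  have BA: "B ** A = mat 1" using assms by (rule matrix_left_right_inverse1)
  hence "invertible A" using assms invertible_def by blast
  hence "matrix_inv A ** A = mat 1" by (rule matrix_inv_left)
  have "matrix_inv A = matrix_inv A ** (A ** B)" by (simp add: assms)
  also have "\<dots> = (matrix_inv A ** A) ** B" by (simp only: matrix_mul_assoc)
  also have "\<dots> = B" using \<open>matrix_inv A ** A = mat 1\<close> by simp
  finally show ?thesis .
qed

lemma map_mat_mult:
  fixes A :: "'a::semiring_1^'c^'m" and B :: "'a^'n^'c"
  assumes "\<And>x y. h (x * y) = h x * h y" "\<And>x y. h (x + y) = h x + h y" "h 0 = 0"
  shows "map_mat h (A ** B) = map_mat h A ** map_mat h B"
proof -
  have "h (sum f S) = (\<Sum>x\<in>S. h (f x))" if "finite S" for f and S :: "'c set"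
    using that by induction (auto simp: assms)
  hence "h (\<Sum>k\<in>UNIV. f k) = (\<Sum>k\<in>UNIV. h (f k))" for f :: "'c \<Rightarrow> 'a" by simp
  thus ?thesis by (simp add: vec_eq_iff map_mat_def matrix_matrix_mult_def assms(1))
qed

lemma map_mat_transpose: "map_mat h (transpose A) = transpose (map_mat h A)"
  by (simp add: vec_eq_iff map_mat_def transpose_def)

lemma map_mat_of_rat_mult: "map_mat (of_rat :: rat \<Rightarrow> 'a::field_char_0) (A ** B) = map_mat of_rat A ** map_mat of_rat B"
  by (rule map_mat_mult) (auto simp: of_rat_mult of_rat_add)

lemma map_mat_of_rat_add: "map_mat of_rat (A + B) = map_mat of_rat A + map_mat of_rat B"
  by (simp add: vec_eq_iff map_mat_def of_rat_add)

lemma map_mat_of_rat_diff: "map_mat of_rat (A - B) = map_mat of_rat A - map_mat of_rat B"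
  by (simp add: vec_eq_iff map_mat_def of_rat_diff)

lemma map_mat_of_rat_1: "map_mat of_rat (mat 1) = mat 1"
  by (simp add: vec_eq_iff map_mat_def mat_def)

lemma map_mat_of_rat_0: "map_mat of_rat 0 = 0"
  by (simp add: vec_eq_iff map_mat_def)

definition blk11 :: "'a^('n + 'n)^('n + 'n) \<Rightarrow> 'a^'n^'n" where "blk11 g = (\<chi> i j. g $ Inl i $ Inl j)"
definition blk12 :: "'a^('n + 'n)^('n + 'n) \<Rightarrow> 'a^'n^'n" where "blk12 g = (\<chi> i j. g $ Inl i $ Inr j)"
definition blk21 :: "'a^('n + 'n)^('n + 'n) \<Rightarrow> 'a^'n^'n" where "blk21 g = (\<chi> i j. g $ Inr i $ Inl j)"
definition blk22 :: "'a^('n + 'n)^('n + 'n) \<Rightarrow> 'a^'n^'n" where "blk22 g = (\<chi> i j. g $ Inr i $ Inr j)"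

lemmas blk_defs = blk11_def blk12_def blk21_def blk22_def

lemma block_mat_blocks: "block_mat (blk11 g) (blk12 g) (blk21 g) (blk22 g) = g"
  by (auto simp: vec_eq_iff block_mat_def blk_defs split: sum.splits)

lemma blk_block_mat [simp]:
  "blk11 (block_mat A B C D) = A" "blk12 (block_mat A B C D) = B"
  "blk21 (block_mat A B C D) = C" "blk22 (block_mat A B C D) = D"
  by (simp_all add: vec_eq_iff block_mat_def blk_defs)

lemma block_mat_eq_iff:
  "block_mat A B C D = block_mat A' B' C' D' \<longleftrightarrow> A = A' \<and> B = B' \<and> C = C' \<and> D = D'"
  by (metis blk_block_mat)

lemma block_mat_mult:
  fixes A B C D :: "'a::semiring_1^('n::finite)^'n"
  shows "block_mat A B C D ** block_mat A' B' C' D' =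
    block_mat (A ** A' + B ** C') (A ** B' + B ** D') (C ** A' + D ** C') (C ** B' + D ** D')"
  by (auto simp: vec_eq_iff block_mat_def matrix_matrix_mult_def sum_UNIV_Plus split: sum.splits)

lemma transpose_block_mat:
  "transpose (block_mat A B C D) = block_mat (transpose A) (transpose C) (transpose B) (transpose D)"
  by (auto simp: vec_eq_iff block_mat_def transpose_def split: sum.splits)

lemma symplectic_block_iff:
  "block_mat A B C D \<in> symplectic_group \<longleftrightarrow>
     transpose A ** C = transpose C ** A \<and> transpose B ** D = transpose D ** B \<and>
     transpose A ** D - transpose C ** B = mat 1"
proof -
  have "block_mat A B C D \<in> symplectic_group \<longleftrightarrow>
    transpose A ** C - transpose C ** A = 0 \<and> transpose A ** D - transpose C ** B = mat 1 \<and>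
    transpose B ** C - transpose D ** A = - mat 1 \<and> transpose B ** D - transpose D ** B = 0"
    unfolding symplectic_group_def mem_Collect_eq transpose_block_mat block_mat_mult block_mat_eq_iff
    by (simp add: matrix_minus_left matrix_minus_right)
  \<comment> \<open>The lower left block condition is minus the transpose of the upper right one,
    which reduces four conditions to three.\<close>
  moreover have "transpose B ** C - transpose D ** A = - transpose (transpose A ** D - transpose C ** B)"
    by (simp add: transpose_diff matrix_transpose_mul)
  ultimately show ?thesis by auto
qed

section \<open>The fractional linear action and its automorphy factor\<close>

definition cblk :: "(rat^('n + 'n)^('n + 'n) \<Rightarrow> rat^'n^'n) \<Rightarrow> rat^('n + 'n)^('n + 'n) \<Rightarrow> complex^'n^'n" where
  "cblk b g = map_mat of_rat (b g)"

definition num :: "rat^('n + 'n)^('n::finite + 'n) \<Rightarrow> complex^'n^'n \<Rightarrow> complex^'n^'n" where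
  "num g Z = cblk blk11 g ** Z + cblk blk12 g"

definition den :: "rat^('n + 'n)^('n::finite + 'n) \<Rightarrow> complex^'n^'n \<Rightarrow> complex^'n^'n" where
  "den g Z = cblk blk21 g ** Z + cblk blk22 g"

definition moeb :: "rat^('n + 'n)^('n::finite + 'n) \<Rightarrow> complex^'n^'n \<Rightarrow> complex^'n^'n" where
  "moeb g Z = num g Z ** matrix_inv (den g Z)"

lemma slash_eq: "slash k f A B C D Z = det (den (block_mat A B C D) Z) powi (- k) * f (moeb (block_mat A B C D) Z)"
  by (simp add: slash_def Let_def den_def num_def moeb_def cblk_def)

text \<open>g sends the column with blocks W, 1 to the column with blocks \<open>num g W\<close>,
  \<open>den g W\<close>; the two sides are the symplectic pairing of two such columns after and
  before applying g. Taking \<open>W = Z\<close> will give symmetry of the image, W conjugate to Z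
  its positivity.\<close>

lemma symplectic_relation:
  fixes g :: "rat^('n::finite + 'n)^('n + 'n)"
  assumes g: "g \<in> symplectic_group" and W: "transpose W = W" and Z: "transpose Z = Z"
  shows "transpose (num g W) ** den g Z - transpose (den g W) ** num g Z = W - Z"
proof -
  obtain A B C D where g_eq: "g = block_mat A B C D" by (metis block_mat_blocks)
  define a b c d where "a = (map_mat of_rat A :: complex^'n^'n)" and "b = (map_mat of_rat B :: complex^'n^'n)"
    and "c = (map_mat of_rat C :: complex^'n^'n)" and "d = (map_mat of_rat D :: complex^'n^'n)"
  note abcd = a_def b_def c_def d_def
  have 1: "transpose A ** C = transpose C ** A" "transpose B ** D = transpose D ** B"
     "transpose A ** D - transpose C ** B = mat 1"
    using g unfolding g_eq symplectic_block_iff by auto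
  have ac: "transpose a ** c = transpose c ** a"
    using arg_cong[OF 1(1), of "map_mat of_rat"] by (simp add: abcd map_mat_of_rat_mult map_mat_transpose)
  have bd: "transpose b ** d = transpose d ** b"
    using arg_cong[OF 1(2), of "map_mat of_rat"] by (simp add: abcd map_mat_of_rat_mult map_mat_transpose)
  have ad: "transpose a ** d = mat 1 + transpose c ** b"
    using arg_cong[OF 1(3), of "map_mat of_rat"]
    by (simp add: abcd map_mat_of_rat_mult map_mat_transpose map_mat_of_rat_diff map_mat_of_rat_1 diff_eq_eq)
  have da: "transpose d ** a = mat 1 + transpose b ** c"
    using arg_cong[OF ad, of transpose] by (simp add: transpose_add matrix_transpose_mul)
  have N: "num g X = a ** X + b" "den g X = c ** X + d" for X
    by (simp_all add: num_def den_def cblk_def g_eq abcd)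
  have "transpose (num g W) ** den g Z =
     W ** (transpose a ** c) ** Z + W ** (transpose a ** d) + transpose b ** c ** Z + transpose b ** d"
    unfolding N by (simp add: transpose_add matrix_transpose_mul W matrix_add_ldistrib matrix_add_rdistrib matrix_mul_assoc)
  moreover have "transpose (den g W) ** num g Z =
     W ** (transpose c ** a) ** Z + W ** (transpose c ** b) + transpose d ** a ** Z + transpose d ** b"
    unfolding N by (simp add: transpose_add matrix_transpose_mul W matrix_add_ldistrib matrix_add_rdistrib matrix_mul_assoc)
  ultimately show ?thesis
    by (simp add: ac bd ad da matrix_add_ldistrib matrix_add_rdistrib algebra_simps)
qed

text \<open>Bilinear rather than Hermitian, so that a matrix crosses over by plain transposition.
  Conjugation is added explicitly by \<open>cnjv\<close> where a Hermitian form is meant.\<close>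

definition cdot :: "complex^'n \<Rightarrow> complex^('n::finite) \<Rightarrow> complex" where
  "cdot u v = (\<Sum>i\<in>UNIV. u $ i * v $ i)"

definition cnjv :: "complex^'n \<Rightarrow> complex^'n" where
  "cnjv u = (\<chi> i. cnj (u $ i))"

lemma cdot_transpose: "cdot (transpose M *v u) v = cdot u (M *v v)"
proof -
  have "cdot (transpose M *v u) v = (\<Sum>i\<in>UNIV. \<Sum>j\<in>UNIV. M $ j $ i * u $ j * v $ i)"
    by (simp add: cdot_def matrix_vector_mult_def transpose_def sum_distrib_right)
  also have "\<dots> = (\<Sum>j\<in>UNIV. \<Sum>i\<in>UNIV. M $ j $ i * u $ j * v $ i)" by (rule sum.swap)
  also have "\<dots> = cdot u (M *v v)"
    by (simp add: cdot_def matrix_vector_mult_def sum_distrib_left mult_ac)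
  finally show ?thesis .
qed

lemma cnjv_mult: "cnjv (M *v v) = map_mat cnj M *v cnjv v"
  by (simp add: vec_eq_iff cnjv_def map_mat_def matrix_vector_mult_def)

lemma map_cnj_blk: "map_mat cnj (cblk b g) = cblk b g"
proof -
  have "cnj (of_rat q) = of_rat q" for q by (cases q) (simp add: of_rat_rat)
  thus ?thesis by (simp add: vec_eq_iff map_mat_def cblk_def)
qed

lemma map_cnj_add: "map_mat cnj (A + B) = map_mat cnj A + map_mat cnj B"
  by (simp add: vec_eq_iff map_mat_def)

lemma map_cnj_mult: "map_mat cnj (A ** B) = map_mat cnj A ** map_mat cnj B"
  by (rule map_mat_mult) auto

lemma map_cnj_num: "map_mat cnj (num g Z) = num g (map_mat cnj Z)"
  by (simp add: num_def map_cnj_add map_cnj_mult map_cnj_blk)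

lemma map_cnj_den: "map_mat cnj (den g Z) = den g (map_mat cnj Z)"
  by (simp add: den_def map_cnj_add map_cnj_mult map_cnj_blk)

text \<open>The mixed terms between real and imaginary part of v cancel because Y is symmetric. This
  is how positivity on real vectors extends to complex ones.\<close>

lemma hermitian_form_eq:
  fixes Y :: "real^'n^('n::finite)"
  assumes "transpose Y = Y"
  defines "re \<equiv> \<lambda>v. (\<chi> i. Re (v $ i))" and "im \<equiv> \<lambda>v. (\<chi> i. Im (v $ i))"
  shows "cdot (cnjv v) (map_mat of_real Y *v v) = of_real (re v \<bullet> (Y *v re v) + im v \<bullet> (Y *v im v))"
proof -
  have Y: "Y $ i $ j = Y $ j $ i" for i j using assms(1) by (metis transpose_def vec_lambda_beta)
  have L: "cdot (cnjv v) (map_mat of_real Y *v v) = (\<Sum>i\<in>UNIV. \<Sum>j\<in>UNIV. cnj (v $ i) * (of_real (Y $ i $ j) * v $ j))"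
    by (simp add: cdot_def cnjv_def map_mat_def matrix_vector_mult_def sum_distrib_left)
  show ?thesis
  proof (rule complex_eqI)
    show "Re (cdot (cnjv v) (map_mat of_real Y *v v)) = Re (of_real (re v \<bullet> (Y *v re v) + im v \<bullet> (Y *v im v)))"
      unfolding L re_def im_def
      by (simp add: inner_vec_def matrix_vector_mult_def sum_distrib_left sum.distrib[symmetric] algebra_simps)
    have "(\<Sum>i\<in>UNIV. \<Sum>j\<in>UNIV. Im (v $ i) * (Y $ i $ j * Re (v $ j))) = (\<Sum>i\<in>UNIV. \<Sum>j\<in>UNIV. Re (v $ i) * (Y $ i $ j * Im (v $ j)))"
      by (subst sum.swap) (simp add: Y mult_ac)
    thus "Im (cdot (cnjv v) (map_mat of_real Y *v v)) = Im (of_real (re v \<bullet> (Y *v re v) + im v \<bullet> (Y *v im v)))"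
      unfolding L by (simp add: sum_subtractf)
  qed
qed

lemma siegel_hermitian_pos:
  assumes Z: "Z \<in> siegel_upper_half" and v: "v \<noteq> 0"
  shows "\<exists>r>0. cdot (cnjv v) ((Z - map_mat cnj Z) *v v) = 2 * \<i> * of_real r"
proof -
  let ?Y = "map_mat Im Z"
  define re im where "re = (\<chi> i. Re (v $ i))" and "im = (\<chi> i. Im (v $ i))"
  have symY: "transpose ?Y = ?Y" using Z by (simp add: siegel_upper_half_def flip: map_mat_transpose)
  have pos: "x \<noteq> 0 \<Longrightarrow> 0 < x \<bullet> (?Y *v x)" for x using Z by (auto simp: siegel_upper_half_def)
  have nonneg: "0 \<le> x \<bullet> (?Y *v x)" for x using pos[of x] by (cases "x = 0") auto
  have "re \<noteq> 0 \<or> im \<noteq> 0" using v by (auto simp: re_def im_def vec_eq_iff complex_eq_iff)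
  hence "re \<bullet> (?Y *v re) + im \<bullet> (?Y *v im) > 0"
    using pos nonneg add_pos_nonneg add_nonneg_pos by metis
  moreover have "cdot (cnjv v) ((Z - map_mat cnj Z) *v v) = 2 * \<i> * cdot (cnjv v) (map_mat of_real ?Y *v v)"
  proof -
    have "(Z - map_mat cnj Z) $ i $ j = 2 * \<i> * of_real (Im (Z $ i $ j))" for i j
      by (simp add: map_mat_def complex_eq_iff)
    thus ?thesis
      by (simp add: cdot_def matrix_vector_mult_def map_mat_def sum_distrib_left mult_ac)
  qed
  ultimately show ?thesis
    unfolding hermitian_form_eq[OF symY] re_def[symmetric] im_def[symmetric] by blast
qed

context
  fixes g :: "rat^('n::finite + 'n)^('n + 'n)" and Z :: "complex^'n^'n"
  assumes g: "g \<in> symplectic_group" and Z: "Z \<in> siegel_upper_half"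
begin

lemma symZ: "transpose Z = Z" and symZc: "transpose (map_mat cnj Z) = map_mat cnj Z"
  using Z by (auto simp: siegel_upper_half_def map_mat_transpose[symmetric])

text \<open>\<open>symplectic_relation\<close> with W the conjugate of Z, evaluated as a Hermitian
  form at v.\<close>

lemma den_relation:
  "cdot (cnjv v) ((Z - map_mat cnj Z) *v v) =
    cdot (cnjv (den g Z *v v)) (num g Z *v v) - cdot (cnjv (num g Z *v v)) (den g Z *v v)"
proof -
  have "cdot (cnjv (num g Z *v v)) (den g Z *v v) =
      cdot (cnjv v) ((transpose (num g (map_mat cnj Z)) ** den g Z) *v v)"
    unfolding cnjv_mult map_cnj_num matrix_vector_mul_assoc[symmetric] cdot_transpose[symmetric] transpose_transpose ..
  moreover have "cdot (cnjv (den g Z *v v)) (num g Z *v v) =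
      cdot (cnjv v) ((transpose (den g (map_mat cnj Z)) ** num g Z) *v v)"
    unfolding cnjv_mult map_cnj_den matrix_vector_mul_assoc[symmetric] cdot_transpose[symmetric] transpose_transpose ..
  moreover have "(transpose (den g (map_mat cnj Z)) ** num g Z) *v v - (transpose (num g (map_mat cnj Z)) ** den g Z) *v v
     = (Z - map_mat cnj Z) *v v"
    using symplectic_relation[OF g symZc symZ] by (metis matrix_vector_mult_diff_rdistrib minus_diff_eq)
  moreover have "cdot u (a - b) = cdot u a - cdot u b" for u a b :: "complex^'n"
    by (simp add: cdot_def sum_subtractf right_diff_distrib)
  ultimately show ?thesis by metis
qed

text \<open>A kernel vector of the denominator would make the right side of
  \<open>den_relation\<close> vanish, while the left side is \<open>2 * \<i>\<close> times a
  positive number unless the vector is 0.\<close>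

lemma den_invertible: "invertible (den g Z)"
proof -
  have "v = 0" if "den g Z *v v = 0" for v
  proof (rule ccontr)
    assume "v \<noteq> 0"
    then obtain r where r: "r > 0" "cdot (cnjv v) ((Z - map_mat cnj Z) *v v) = 2 * \<i> * of_real r"
      using siegel_hermitian_pos[OF Z] by blast
    have "cdot (cnjv v) ((Z - map_mat cnj Z) *v v) = 0"
      unfolding den_relation that by (simp add: cdot_def cnjv_def)
    thus False using r by simp
  qed
  hence "\<exists>B. B ** den g Z = mat 1" unfolding matrix_left_invertible_ker by blast
  thus ?thesis unfolding invertible_def using matrix_left_right_inverse1 by blast
qed

lemma moeb_den: "moeb g Z ** den g Z = num g Z"
  by (simp add: moeb_def matrix_mul_assoc[symmetric] matrix_inv_left[OF den_invertible])

lemma moeb_in_siegel: "moeb g Z \<in> siegel_upper_half"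
proof -
  let ?P = "den g Z" and ?N = "num g Z" and ?W = "moeb g Z"
  define I where "I = matrix_inv ?P"
  have IP: "?P ** I = mat 1" "I ** ?P = mat 1"
    using matrix_inv_left matrix_inv_right den_invertible unfolding I_def by blast+
  have tIP: "transpose I ** transpose ?P = mat 1"
    using arg_cong[OF IP(1), of transpose] by (simp add: matrix_transpose_mul)
  have W: "?W = ?N ** I" by (simp add: moeb_def I_def)
  have NP: "transpose ?N ** ?P = transpose ?P ** ?N"
    using symplectic_relation[OF g symZ symZ] by simp
  have "transpose ?W = transpose I ** (transpose ?N ** ?P) ** I"
    unfolding W by (simp add: matrix_transpose_mul IP matrix_mul_assoc[symmetric])
  also have "\<dots> = ?W" unfolding NP W by (simp add: matrix_mul_assoc tIP)
  finally have symW: "transpose ?W = ?W" .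
  moreover have "0 < x \<bullet> (map_mat Im ?W *v x)" if "x \<noteq> 0" for x
  proof -
    define w where "w = (\<chi> i. complex_of_real (x $ i))"
    \<comment> \<open>The preimage of the real vector w under the denominator. Then
      \<open>den_relation\<close> at v reads off the imaginary part of the form of the image matrix
      at w.\<close>
    define v where "v = I *v w"
    have Pv: "?P *v v = w" by (simp add: v_def matrix_vector_mul_assoc IP)
    have Nv: "?N *v v = ?W *v w" by (simp add: v_def W matrix_vector_mul_assoc)
    have cw: "cnjv w = w" by (simp add: vec_eq_iff cnjv_def w_def)
    have "w \<noteq> 0" using that by (auto simp: w_def vec_eq_iff)
    hence "v \<noteq> 0" using Pv by auto
    then obtain r where r: "r > 0" "cdot (cnjv v) ((Z - map_mat cnj Z) *v v) = 2 * \<i> * of_real r"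
      using siegel_hermitian_pos[OF Z] by blast
    have "cdot (cnjv (?W *v w)) w = cnj (cdot w (?W *v w))"
      by (simp add: cdot_def cnjv_def w_def mult_ac)
    hence "2 * \<i> * of_real r = cdot w (?W *v w) - cnj (cdot w (?W *v w))"
      using r(2) unfolding den_relation Pv Nv cw by simp
    hence "Im (2 * \<i> * of_real r) = Im (cdot w (?W *v w) - cnj (cdot w (?W *v w)))" by (rule arg_cong)
    hence "r = Im (cdot w (?W *v w))" by simp
    also have "\<dots> = x \<bullet> (map_mat Im ?W *v x)"
      by (simp add: cdot_def w_def inner_vec_def matrix_vector_mult_def map_mat_def sum_distrib_left)
    finally show ?thesis using r(1) by simp
  qed
  ultimately show ?thesis by (simp add: siegel_upper_half_def)
qed

end

lemma symplectic_mult: "g \<in> symplectic_group \<Longrightarrow> h \<in> symplectic_group \<Longrightarrow> g ** h \<in> symplectic_group"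
  unfolding symplectic_group_def mem_Collect_eq
  by (metis (no_types, lifting) matrix_mul_assoc matrix_transpose_mul)

text \<open>The cocycle relation. By \<open>moeb_den\<close> the column \<open>num h Z\<close>,
  \<open>den h Z\<close> is the column \<open>moeb h Z\<close>, 1 multiplied on the right by
  \<open>den h Z\<close>, and g acts from the left.\<close>

lemma num_den_mult:
  fixes g h :: "rat^('n::finite + 'n)^('n + 'n)"
  assumes h: "h \<in> symplectic_group" and Z: "Z \<in> siegel_upper_half"
  shows "num (g ** h) Z = num g (moeb h Z) ** den h Z" "den (g ** h) Z = den g (moeb h Z) ** den h Z"
proof -
  obtain A B C D where g: "g = block_mat A B C D" by (metis block_mat_blocks)
  obtain A' B' C' D' where h_eq: "h = block_mat A' B' C' D'" by (metis block_mat_blocks)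
  note md = moeb_den[OF h Z]
  show "num (g ** h) Z = num g (moeb h Z) ** den h Z"
    unfolding num_def[of g] matrix_add_rdistrib matrix_mul_assoc[symmetric] md
    by (simp add: num_def den_def cblk_def g h_eq block_mat_mult map_mat_of_rat_add map_mat_of_rat_mult
        matrix_add_ldistrib matrix_add_rdistrib matrix_mul_assoc)
  show "den (g ** h) Z = den g (moeb h Z) ** den h Z"
    unfolding den_def[of g] matrix_add_rdistrib matrix_mul_assoc[symmetric] md
    by (simp add: num_def den_def cblk_def g h_eq block_mat_mult map_mat_of_rat_add map_mat_of_rat_mult
        matrix_add_ldistrib matrix_add_rdistrib matrix_mul_assoc)
qed

lemma moeb_mult:
  fixes g h :: "rat^('n::finite + 'n)^('n + 'n)"
  assumes g: "g \<in> symplectic_group" and h: "h \<in> symplectic_group" and Z: "Z \<in> siegel_upper_half"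
  shows "moeb (g ** h) Z = moeb g (moeb h Z)"
proof -
  have hZ: "moeb h Z \<in> siegel_upper_half" by (rule moeb_in_siegel[OF h Z])
  have "moeb (g ** h) Z ** (den g (moeb h Z) ** den h Z) = moeb g (moeb h Z) ** (den g (moeb h Z) ** den h Z)"
    using moeb_den[OF symplectic_mult[OF g h] Z] unfolding num_den_mult[OF h Z]
    by (simp add: matrix_mul_assoc moeb_den[OF g hZ])
  moreover have "invertible (den g (moeb h Z) ** den h Z)"
    by (intro invertible_mult den_invertible g h Z hZ)
  ultimately show ?thesis by (metis matrix_inv_right matrix_mul_assoc matrix_mul_rid)
qed

text \<open>An eigenfunction equation for the slash operator. The eigenvalue is left free because a
  partial inversion is only known to act by some nonzero number.\<close>

definition semi_invariant ::
    "int \<Rightarrow> (complex^'n^'n \<Rightarrow> complex) \<Rightarrow> rat^('n + 'n)^('n::finite + 'n) \<Rightarrow> complex \<Rightarrow> bool" where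
  "semi_invariant k f g c \<longleftrightarrow> (\<forall>Z\<in>siegel_upper_half. det (den g Z) powi (- k) * f (moeb g Z) = c * f Z)"

lemma semi_invariant_mult:
  fixes g h :: "rat^('n::finite + 'n)^('n + 'n)"
  assumes g: "g \<in> symplectic_group" and h: "h \<in> symplectic_group"
    and sg: "semi_invariant k f g c" and sh: "semi_invariant k f h d"
  shows "semi_invariant k f (g ** h) (c * d)"
  unfolding semi_invariant_def
proof
  fix Z :: "complex^'n^'n" assume Z: "Z \<in> siegel_upper_half"
  have hZ: "moeb h Z \<in> siegel_upper_half" by (rule moeb_in_siegel[OF h Z])
  have "det (den (g ** h) Z) powi (- k) * f (moeb (g ** h) Z) =
    det (den h Z) powi (- k) * (det (den g (moeb h Z)) powi (- k) * f (moeb g (moeb h Z)))"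
    by (simp add: num_den_mult[OF h Z] moeb_mult[OF g h Z] det_mul power_int_mult_distrib)
  also have "\<dots> = c * (det (den h Z) powi (- k) * f (moeb h Z))"
    using sg hZ by (simp add: semi_invariant_def)
  also have "\<dots> = c * d * f Z" using sh Z by (simp add: semi_invariant_def)
  finally show "det (den (g ** h) Z) powi (- k) * f (moeb (g ** h) Z) = c * d * f Z" .
qed

lemma mat_1_symplectic: "mat 1 \<in> symplectic_group"
  by (simp add: symplectic_group_def)

lemma mat_1_block: "mat 1 = block_mat (mat 1) 0 0 (mat 1)"
  by (auto simp: vec_eq_iff mat_def block_mat_def split: sum.splits)

lemma den_1: "den (mat 1) Z = mat 1" and moeb_1: "moeb (mat 1) Z = Z"
proof -
  show d: "den (mat 1) Z = mat 1"
    by (simp add: den_def cblk_def mat_1_block map_mat_of_rat_0 map_mat_of_rat_1)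
  have "num (mat 1) Z = Z"
    by (simp add: num_def cblk_def mat_1_block map_mat_of_rat_0 map_mat_of_rat_1)
  thus "moeb (mat 1) Z = Z" using matrix_inv_unique[of "mat 1 :: complex^'a^'a" "mat 1"] by (simp add: moeb_def d)
qed

text \<open>The cocycle relation is solved for the factor h. With \<open>g ** h = mat 1\<close> it
  yields the constant of the inverse; in the descent it strips a word off a group element.\<close>

lemma semi_invariant_cancel:
  fixes g h :: "rat^('n::finite + 'n)^('n + 'n)"
  assumes g: "g \<in> symplectic_group" and h: "h \<in> symplectic_group"
    and sg: "semi_invariant k f g c" and c: "c \<noteq> 0" and gh: "semi_invariant k f (g ** h) d"
  shows "semi_invariant k f h (d / c)"
  unfolding semi_invariant_def
proof
  fix Z :: "complex^'n^'n" assume Z: "Z \<in> siegel_upper_half"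
  have hZ: "moeb h Z \<in> siegel_upper_half" by (rule moeb_in_siegel[OF h Z])
  have "d * f Z = det (den (g ** h) Z) powi (- k) * f (moeb (g ** h) Z)"
    using gh Z by (simp add: semi_invariant_def)
  also have "\<dots> = det (den h Z) powi (- k) * (det (den g (moeb h Z)) powi (- k) * f (moeb g (moeb h Z)))"
    by (simp add: num_den_mult[OF h Z] moeb_mult[OF g h Z] det_mul power_int_mult_distrib)
  also have "\<dots> = c * (det (den h Z) powi (- k) * f (moeb h Z))"
    using sg hZ by (simp add: semi_invariant_def)
  finally show "det (den h Z) powi (- k) * f (moeb h Z) = d / c * f Z" using c by (simp add: field_simps)
qed

lemma semi_invariant_1: "semi_invariant k f (mat 1) 1"
  by (simp add: semi_invariant_def den_1 moeb_1 det_I)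

section \<open>Generators of the paramodular group\<close>

definition omega :: "rat^('n + 'n) \<Rightarrow> rat^('n::finite + 'n) \<Rightarrow> rat" where
  "omega x y = (\<Sum>i\<in>UNIV. x $ Inl i * y $ Inr i - x $ Inr i * y $ Inl i)"

lemma omega_add_left: "omega (x + y) z = omega x z + omega y z"
  by (simp add: omega_def sum.distrib[symmetric] algebra_simps)

lemma omega_add_right: "omega z (x + y) = omega z x + omega z y"
  by (simp add: omega_def sum.distrib[symmetric] algebra_simps)

lemma omega_scale_left: "omega (c *s x) z = c * omega x z"
  by (simp add: omega_def sum_distrib_left algebra_simps)

lemma omega_scale_right: "omega z (c *s x) = c * omega z x"
  by (simp add: omega_def sum_distrib_left algebra_simps)

lemma omega_self: "omega x x = 0"
  by (simp add: omega_def)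

lemma omega_skew: "omega x y = - omega y x"
  by (simp add: omega_def sum_negf[symmetric] algebra_simps)

lemma omega_axis_left_Inl: "omega (axis (Inl i) c) y = c * y $ Inr i"
  by (simp add: omega_def axis_def if_distrib if_distribR sum.If_cases cong: if_cong)

lemma omega_axis_left_Inr: "omega (axis (Inr i) c) y = - c * y $ Inl i"
  by (simp add: omega_def axis_def if_distrib if_distribR sum.If_cases sum_negf cong: if_cong)

lemma symplectic_iff_omega:
  "g \<in> symplectic_group \<longleftrightarrow> (\<forall>x y. omega (g *v x) (g *v y) = omega x y)"
proof -
  define J :: "rat^('a + 'a)^('a + 'a)" where "J = block_mat 0 (mat 1) (- mat 1) 0"
  define dp :: "rat^('a + 'a) \<Rightarrow> rat^('a + 'a) \<Rightarrow> rat" where "dp x y = (\<Sum>i\<in>UNIV. x $ i * y $ i)" for x y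
  have J: "(J *v y) $ Inl i = y $ Inr i" "(J *v y) $ Inr i = - y $ Inl i" for y i
    by (simp_all add: J_def block_mat_def matrix_vector_mult_def sum_UNIV_Plus mat_def if_distrib if_distribR sum.If_cases sum_negf cong: if_cong)
  have om: "omega x y = dp x (J *v y)" for x y
    by (simp add: dp_def omega_def sum_UNIV_Plus J sum.distrib[symmetric] sum_subtractf sum_negf)
  have tr: "dp (M *v x) y = dp x (transpose M *v y)" for M x y
  proof -
    have "dp (M *v x) y = (\<Sum>i\<in>UNIV. \<Sum>j\<in>UNIV. M $ i $ j * x $ j * y $ i)"
      by (simp add: dp_def matrix_vector_mult_def sum_distrib_right)
    also have "\<dots> = (\<Sum>j\<in>UNIV. \<Sum>i\<in>UNIV. M $ i $ j * x $ j * y $ i)" by (rule sum.swap)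
    also have "\<dots> = dp x (transpose M *v y)"
      by (simp add: dp_def matrix_vector_mult_def transpose_def sum_distrib_left mult_ac)
    finally show ?thesis .
  qed
  have ent: "dp (axis i 1) (M *v axis j 1) = M $ i $ j" for M i j
    by (simp add: dp_def matrix_vector_mult_def axis_def if_distrib if_distribR sum.If_cases cong: if_cong)
  have "omega (g *v x) (g *v y) = dp x ((transpose g ** J ** g) *v y)" for x y
    by (simp add: om tr matrix_vector_mul_assoc matrix_mul_assoc)
  hence "(\<forall>x y. omega (g *v x) (g *v y) = omega x y) \<longleftrightarrow> transpose g ** J ** g = J"
    unfolding om by (metis ent vec_eq_iff)
  thus ?thesis by (simp add: symplectic_group_def J_def)
qed

text \<open>One family for both kinds of generators. If \<open>omega p q = 0\<close>, the map
  sending x to \<open>(c * omega x p) *s q + (c * omega x q) *s p\<close> has square 0 and is skew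
  for \<open>omega\<close>, so adding the identity gives its exponential, a symplectic map.\<close>

definition transv :: "rat \<Rightarrow> rat^('n + 'n) \<Rightarrow> rat^('n + 'n) \<Rightarrow> rat^('n + 'n)^('n::finite + 'n)" where
  "transv c p q = matrix (\<lambda>x. x + (c * omega x p) *s q + (c * omega x q) *s p)"

lemma transv_apply: "transv c p q *v x = x + (c * omega x p) *s q + (c * omega x q) *s p"
proof -
  have "Vector_Spaces.linear (*s) (*s) (\<lambda>x. x + (c * omega x p) *s q + (c * omega x q) *s p)"
    unfolding Vector_Spaces.linear_iff
    by (auto simp: vec.vector_space_axioms omega_add_left omega_scale_left vec_eq_iff algebra_simps)
  thus ?thesis unfolding transv_def by (rule matrix_works)
qed

lemma transv_symplectic:
  assumes "omega p q = 0"
  shows "transv c p q \<in> symplectic_group"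
proof -
  have q: "omega q p = 0" using assms omega_skew[of q p] by simp
  have "omega (transv c p q *v x) (transv c p q *v y) = omega x y" for x y
  proof -
    have sk: "omega p y = - omega y p" "omega q y = - omega y q" by (rule omega_skew)+
    have "omega (transv c p q *v x) (transv c p q *v y) = omega x y +
        c * omega y p * omega x q + c * omega y q * omega x p + c * omega x p * omega q y + c * omega x q * omega p y"
      unfolding transv_apply
      by (simp add: omega_add_left omega_add_right omega_scale_left omega_scale_right omega_self assms q)
    thus ?thesis unfolding sk by simp
  qed
  thus ?thesis unfolding symplectic_iff_omega by blast
qed

text \<open>Basis indices are grouped into hyperbolic planes: \<open>idx\<close> is the plane,
  \<open>part\<close> the partner in the same plane, and \<open>sg\<close> the sign of the form on
  the pair, in the order \<open>part s\<close>, s.\<close>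

fun part :: "'n + 'n \<Rightarrow> 'n + 'n" where
  "part (Inl i) = Inr i" | "part (Inr i) = Inl i"

fun idx :: "'n + 'n \<Rightarrow> 'n" where
  "idx (Inl i) = i" | "idx (Inr i) = i"

fun sg :: "'n + 'n \<Rightarrow> int" where
  "sg (Inl i) = - 1" | "sg (Inr i) = 1"

lemma part_part [simp]: "part (part s) = s"
  by (cases s) auto

lemma idx_part [simp]: "idx (part s) = idx s"
  by (cases s) auto

lemma part_neq [simp]: "part s \<noteq> s" "s \<noteq> part s"
  by (cases s; auto)+

lemma sg_sq [simp]: "sg s * sg s = 1"
  by (cases s) auto

lemma of_int_sg_sq [simp]: "of_int (sg s) * of_int (sg s) = (1 :: 'a::ring_1)"
  by (cases s) auto

lemma sg_part [simp]: "sg (part s) = - sg s"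
  by (cases s) auto

lemma idx_eq_iff: "idx s = idx s' \<longleftrightarrow> s = s' \<or> s = part s'"
  by (cases s; cases s') auto

lemma idx_cases: "idx r = i \<Longrightarrow> r = Inl i \<or> r = Inr i"
  by (cases r) auto

locale divisor_chain =
  fixes t :: "'n::{finite,linorder} \<Rightarrow> int"
  assumes t_pos: "\<And>i. 0 < t i" and t_dvd: "\<And>i j. i \<le> j \<Longrightarrow> t i dvd t j"
begin

text \<open>The paramodular group is the stabilizer in the symplectic group of the lattice \<open>Lam\<close>, whose
  basis is formed by the vectors \<open>bv s\<close>.\<close>

fun wt :: "'n + 'n \<Rightarrow> rat" where
  "wt (Inl i) = 1" | "wt (Inr i) = of_int (t i)"

definition bv :: "'n + 'n \<Rightarrow> rat^('n + 'n)" where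
  "bv s = axis s (wt s)"

definition co :: "rat^('n + 'n) \<Rightarrow> 'n + 'n \<Rightarrow> rat" where
  "co x s = x $ s / wt s"

definition Lam :: "(rat^('n + 'n)) set" where
  "Lam = {x. \<forall>s. co x s \<in> \<int>}"

lemma wt_nz [simp]: "wt s \<noteq> 0"
  using t_pos by (cases s) (auto simp: less_imp_neq[symmetric])

lemma t_nz [simp]: "t i \<noteq> 0"
  using t_pos[of i] by simp

lemma co_add: "co (x + y) s = co x s + co y s"
  by (simp add: co_def add_divide_distrib)

lemma co_scale: "co (c *s x) s = c * co x s"
  by (simp add: co_def)

lemma co_bv: "co (bv s) s' = (if s' = s then 1 else 0)"
  by (simp add: co_def bv_def axis_def)

lemma co_eqI: "(\<And>s. co x s = co y s) \<Longrightarrow> x = y"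
  by (simp add: co_def vec_eq_iff)

lemma omega_bv: "omega x (bv s) = of_int (sg s * t (idx s)) * co x (part s)"
  by (subst omega_skew, cases s) (simp_all add: bv_def co_def omega_axis_left_Inl omega_axis_left_Inr)

lemma omega_bv_bv: "omega (bv s') (bv s) = (if s' = part s then of_int (sg s * t (idx s)) else 0)"
  by (auto simp: omega_bv co_bv)

lemma omega_co: "omega x y = (\<Sum>i\<in>UNIV. of_int (t i) * (co x (Inl i) * co y (Inr i) - co x (Inr i) * co y (Inl i)))"
  unfolding omega_def by (rule sum.cong) (auto simp: co_def field_simps)

lemma bv_Lam: "bv s \<in> Lam"
  by (simp add: Lam_def co_bv)

text \<open>Integrality of the mixed generators on \<open>Lam\<close> uses that \<open>t i\<close> divides \<open>t (idx s')\<close>.  The factor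
  2 in the second rule compensates for \<open>transv c p p\<close> being the transvection with coefficient \<open>2 c\<close>.\<close>

inductive_set gens :: "'n \<Rightarrow> (rat^('n + 'n)^('n + 'n)) set" for i where
  mixed: "idx s = i \<Longrightarrow> i < idx s' \<Longrightarrow> transv (of_int k / of_int (t i)) (bv s) (bv s') \<in> gens i"
| plane: "idx s = i \<Longrightarrow> transv (of_int k / (2 * of_int (t i))) (bv s) (bv s) \<in> gens i"

text \<open>Words in the generators attached to plane i; they fix the basis vectors of all lower
  planes, which is what allows an induction over the planes. Negative k already provide the inverses
  of the generators.\<close>

inductive_set wds :: "'n \<Rightarrow> (rat^('n + 'n)^('n + 'n)) set" for i where
  one: "mat 1 \<in> wds i"
| step: "a \<in> gens i \<Longrightarrow> w \<in> wds i \<Longrightarrow> a ** w \<in> wds i"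

lemma wds_mult: "v \<in> wds i \<Longrightarrow> w \<in> wds i \<Longrightarrow> v ** w \<in> wds i"
  by (induction rule: wds.induct) (auto simp: matrix_mul_assoc[symmetric] intro: wds.step)

section \<open>Elementary operations on lattice vectors\<close>

definition tq :: "'n \<Rightarrow> 'n \<Rightarrow> int" where
  "tq i l = t l div t i"

lemma tq: "i \<le> l \<Longrightarrow> t l = tq i l * t i"
  unfolding tq_def using t_dvd by simp

text \<open>The asymmetry between the two changed coordinates comes from the form: the coefficient
  has denominator \<open>t i\<close>, which cancels against \<open>omega x (bv s)\<close> but leaves
  the quotient \<open>tq i (idx s')\<close> against \<open>omega x (bv s')\<close>.\<close>

lemma co_mixed:
  assumes "idx s = i" "i < idx s'"
  shows "co (transv (of_int k / of_int (t i)) (bv s) (bv s') *v x) r = co x r +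
     (if r = s' then of_int (k * sg s) * co x (part s) else 0) +
     (if r = s then of_int (k * sg s' * tq i (idx s')) * co x (part s') else 0)"
  using assms by (simp add: transv_apply co_add co_scale co_bv omega_bv tq[OF less_imp_le[OF assms(2)]])

lemma co_plane:
  assumes "idx s = i"
  shows "co (transv (of_int k / (2 * of_int (t i))) (bv s) (bv s) *v x) r = co x r +
     (if r = s then of_int (k * sg s) * co x (part s) else 0)"
  unfolding transv_apply co_add co_scale co_bv omega_bv assms by simp

lemma gens_symplectic: "a \<in> gens i \<Longrightarrow> a \<in> symplectic_group"
  by (induction rule: gens.induct) (auto intro!: transv_symplectic simp: omega_bv_bv)

lemma wds_symplectic: "w \<in> wds i \<Longrightarrow> w \<in> symplectic_group"
  by (induction rule: wds.induct) (auto intro: symplectic_mult gens_symplectic mat_1_symplectic)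

lemma gens_Lam: "a \<in> gens i \<Longrightarrow> x \<in> Lam \<Longrightarrow> a *v x \<in> Lam"
  by (induction rule: gens.induct) (auto simp: Lam_def co_mixed co_plane intro!: Ints_add Ints_mult)

lemma wds_Lam: "w \<in> wds i \<Longrightarrow> x \<in> Lam \<Longrightarrow> w *v x \<in> Lam"
  by (induction rule: wds.induct) (auto simp: matrix_vector_mul_assoc[symmetric] intro: gens_Lam)

lemma gens_fix: "a \<in> gens i \<Longrightarrow> idx s < i \<Longrightarrow> a *v bv s = bv s"
  by (induction rule: gens.induct) (auto simp: transv_apply omega_bv_bv)

lemma wds_fix: "w \<in> wds i \<Longrightarrow> idx s < i \<Longrightarrow> w *v bv s = bv s"
  by (induction rule: wds.induct) (auto simp: matrix_vector_mul_assoc[symmetric] gens_fix)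

text \<open>The coordinate 1 at \<open>part s\<close> serves as a pivot: a mixed generator in
  \<open>bv s\<close>, \<open>bv s'\<close> subtracts any integral multiple of it at s'. Its only
  side effect is at the coordinate s, and it fixes \<open>bv s\<close>, since this vector is
  orthogonal to both vectors involved.\<close>

lemma kill_aux:
  assumes fin: "finite F" and F: "\<And>r. r \<in> F \<Longrightarrow> i < idx r" and s: "idx s = i"
    and x: "x \<in> Lam" "co x (part s) = 1"
  shows "\<exists>w\<in>wds i. w *v bv s = bv s \<and> co (w *v x) (part s) = 1 \<and> (\<forall>r\<in>F. co (w *v x) r = 0) \<and>
    (\<forall>r. r \<notin> F \<and> r \<noteq> s \<longrightarrow> co (w *v x) r = co x r)"
  using fin F
proof induction
  case empty
  show ?case using x(2) by (intro bexI[of _ "mat 1"] wds.one) auto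
next
  case (insert s' F)
  then obtain w where w: "w \<in> wds i" "w *v bv s = bv s" "co (w *v x) (part s) = 1"
    "\<forall>r\<in>F. co (w *v x) r = 0" "\<forall>r. r \<notin> F \<and> r \<noteq> s \<longrightarrow> co (w *v x) r = co x r"
    by auto
  have s': "i < idx s'" using insert by simp
  have "co (w *v x) s' \<in> \<int>" using wds_Lam[OF w(1) x(1)] by (simp add: Lam_def)
  then obtain k where k: "co (w *v x) s' = of_int k" by (auto elim: Ints_cases)
  define a where "a = transv (of_int (- sg s * k) / of_int (t i)) (bv s) (bv s')"
  have a: "a \<in> gens i" unfolding a_def using s s' by (rule gens.mixed)
  have ne: "s' \<noteq> s" "part s' \<noteq> s" "part s \<noteq> s'" using s s' by auto
  have co_a: "co (a *v (w *v x)) r = co (w *v x) r + (if r = s' then - of_int k else 0) +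
     (if r = s then of_int (- sg s * k * sg s' * tq i (idx s')) * co (w *v x) (part s') else 0)" for r
    unfolding a_def co_mixed[OF s s'] w(3) by (simp add: mult.assoc)
  show ?case
  proof (intro bexI[of _ "a ** w"] conjI)
    show "(a ** w) *v bv s = bv s"
      using ne s by (auto simp: matrix_vector_mul_assoc[symmetric] w(2) a_def transv_apply omega_bv_bv)
    show "co ((a ** w) *v x) (part s) = 1"
      unfolding matrix_vector_mul_assoc[symmetric] co_a using w(3) ne by simp
    show "\<forall>r\<in>insert s' F. co ((a ** w) *v x) r = 0"
    proof
      fix r assume r: "r \<in> insert s' F"
      hence "r \<noteq> s" using insert.prems s by auto
      thus "co ((a ** w) *v x) r = 0"
        unfolding matrix_vector_mul_assoc[symmetric] co_a using r w(4) k insert.hyps by auto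
    qed
    show "\<forall>r. r \<notin> insert s' F \<and> r \<noteq> s \<longrightarrow> co ((a ** w) *v x) r = co x r"
      unfolding matrix_vector_mul_assoc[symmetric] co_a using w(5) by auto
  qed (rule wds.step[OF a w(1)])
qed

text \<open>The vector x is moved to the partner of \<open>bv s\<close> without disturbing
  \<open>bv s\<close>. Once the higher planes are cleared, the plane generator, with the same pivot,
  clears the remaining coordinate s.\<close>

lemma kill:
  assumes s: "idx s = i" and x: "x \<in> Lam" "co x (part s) = 1" and low: "\<And>r. idx r < i \<Longrightarrow> co x r = 0"
  shows "\<exists>w\<in>wds i. w *v bv s = bv s \<and> w *v x = bv (part s)"
proof -
  have "\<exists>w\<in>wds i. w *v bv s = bv s \<and> co (w *v x) (part s) = 1 \<and> (\<forall>r\<in>{r. i < idx r}. co (w *v x) r = 0) \<and>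
    (\<forall>r. r \<notin> {r. i < idx r} \<and> r \<noteq> s \<longrightarrow> co (w *v x) r = co x r)"
    by (rule kill_aux) (use s x in auto)
  then obtain w where w: "w \<in> wds i" "w *v bv s = bv s" "co (w *v x) (part s) = 1"
    "\<forall>r\<in>{r. i < idx r}. co (w *v x) r = 0" "\<forall>r. r \<notin> {r. i < idx r} \<and> r \<noteq> s \<longrightarrow> co (w *v x) r = co x r"
    by blast
  have "co (w *v x) s \<in> \<int>" using wds_Lam[OF w(1) x(1)] by (simp add: Lam_def)
  then obtain k where k: "co (w *v x) s = of_int k" by (auto elim: Ints_cases)
  define a where "a = transv (of_int (- sg s * k) / (2 * of_int (t i))) (bv s) (bv s)"
  have a: "a \<in> gens i" unfolding a_def using s by (rule gens.plane)
  have co_a: "co (a *v (w *v x)) r = co (w *v x) r + (if r = s then - of_int k else 0)" for r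
    unfolding a_def co_plane[OF s] w(3) by simp
  have "a *v (w *v x) = bv (part s)"
  proof (rule co_eqI)
    fix r
    consider "r = s" | "r = part s" | "idx r < i" "r \<noteq> s" "r \<noteq> part s" | "i < idx r" "r \<noteq> s" "r \<noteq> part s"
      using idx_eq_iff[of r s] s by (metis linorder_less_linear)
    thus "co (a *v (w *v x)) r = co (bv (part s)) r"
      by cases (use w k low s in \<open>auto simp: co_a co_bv\<close>)
  qed
  moreover have "a *v bv s = bv s" by (simp add: a_def transv_apply omega_self)
  ultimately show ?thesis
    using w wds.step[OF a w(1)] by (intro bexI[of _ "a ** w"]) (simp_all add: matrix_vector_mul_assoc[symmetric])
qed

text \<open>A vector whose pairing with some lattice vector attains \<open>t i\<close> is primitive
  in the sense relevant here. The least positive value \<mu> of the coordinate \<open>Inl i\<close>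
  over the orbit divides every integer that the generators can add to a coordinate of plane i, and
  these integers have greatest common divisor 1.\<close>

lemma reduce_to_one:
  assumes v: "v \<in> Lam" and low: "\<And>r. idx r < i \<Longrightarrow> co v r = 0"
    and y: "y \<in> Lam" "omega v y = of_int (t i)"
  shows "\<exists>w\<in>wds i. co (w *v v) (Inl i) = 1"
proof -
  define orb where "orb = {w *v v | w. w \<in> wds i}"
  have orb_step: "a *v u \<in> orb" if "u \<in> orb" "a \<in> gens i" for u a
    using that wds.step unfolding orb_def by (auto simp: matrix_vector_mul_assoc)
  have orbL: "u \<in> Lam" if "u \<in> orb" for u using that wds_Lam[OF _ v] by (auto simp: orb_def)
  define c :: "rat^('n + 'n) \<Rightarrow> 'n + 'n \<Rightarrow> int" where "c u r = \<lfloor>co u r\<rfloor>" for u r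
  have c: "co u r = of_int (c u r)" if "u \<in> Lam" for u r
    using that by (auto simp: Lam_def c_def elim!: Ints_cases)
  have cI: "c z r = m" if "co z r = of_int m" for z r m
    using that by (simp only: c_def floor_of_int)
  \<comment> \<open>Words fix the lower basis vectors and preserve \<open>omega\<close>, so the
    pairings of v with these vectors, which are 0, persist along the orbit.\<close>
  have clow: "c u r = 0" if "u \<in> orb" "idx r < i" for u r
  proof -
    from that(1) obtain w where w: "w \<in> wds i" "u = w *v v" by (auto simp: orb_def)
    have ir: "idx (part r) < i" using that by simp
    have "omega u (bv (part r)) = omega (w *v v) (w *v bv (part r))"
      using wds_fix[OF w(1) ir] w(2) by simp
    also have "\<dots> = omega v (bv (part r))" using wds_symplectic[OF w(1)] by (simp add: symplectic_iff_omega)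
    also have "\<dots> = 0" using low that by (simp add: omega_bv)
    finally have "co u r = 0" using t_nz by (cases r) (auto simp: omega_bv)
    thus ?thesis by (simp add: c_def)
  qed
  \<comment> \<open>The amount by which a suitable generator changes a coordinate of plane i, up to
    sign: the coordinate itself inside the plane, multiplied by \<open>tq\<close> in higher
    planes.\<close>
  define val where "val u r = (if idx r = i then c u r else tq i (idx r) * c u r)" for u r
  \<comment> \<open>A Bezout relation between the values \<open>val\<close>: the expansion of
    \<open>omega u z = t i\<close> in coordinates, divided by \<open>t i\<close>. Lower planes drop
    out because the coordinates of u vanish there.\<close>
  have bez: "\<exists>h. (\<Sum>r\<in>{r. i \<le> idx r}. val u r * h r) = 1" if "u \<in> orb" for u
  proof -
    from that obtain w where w: "w \<in> wds i" "u = w *v v" by (auto simp: orb_def)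
    define z where "z = w *v y"
    have zL: "z \<in> Lam" unfolding z_def by (rule wds_Lam[OF w(1) y(1)])
    have "omega u z = of_int (t i)"
      using wds_symplectic[OF w(1)] y(2) by (simp add: w(2) z_def symplectic_iff_omega)
    hence "of_int (t i) = (\<Sum>l\<in>UNIV. of_int (t l) * (of_int (c u (Inl l)) * of_int (c z (Inr l)) - of_int (c u (Inr l)) * (of_int (c z (Inl l)) :: rat)))"
      unfolding omega_co by (simp add: c[OF zL] c[OF orbL[OF that]])
    hence "t i = (\<Sum>l\<in>UNIV. t l * (c u (Inl l) * c z (Inr l) - c u (Inr l) * c z (Inl l)))"
      by (simp only: of_int_mult[symmetric] of_int_diff[symmetric] of_int_sum[symmetric] of_int_eq_iff)
    also have "\<dots> = (\<Sum>l\<in>UNIV. t i * (if i \<le> l then tq i l * (c u (Inl l) * c z (Inr l) - c u (Inr l) * c z (Inl l)) else 0))"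
      by (rule sum.cong) (use clow[OF that] tq in \<open>auto simp: not_le\<close>)
    also have "\<dots> = t i * (\<Sum>l\<in>UNIV. if i \<le> l then tq i l * (c u (Inl l) * c z (Inr l) - c u (Inr l) * c z (Inl l)) else 0)"
      by (rule sum_distrib_left[symmetric])
    finally have "t i * 1 = t i * (\<Sum>l\<in>UNIV. if i \<le> l then tq i l * (c u (Inl l) * c z (Inr l) - c u (Inr l) * c z (Inl l)) else 0)"
      by (simp only: mult_1_right)
    hence "1 = (\<Sum>l\<in>UNIV. if i \<le> l then tq i l * (c u (Inl l) * c z (Inr l) - c u (Inr l) * c z (Inl l)) else 0)"
      using t_nz[of i] by (simp only: mult_cancel_left) simp
    also have "\<dots> = (\<Sum>l\<in>UNIV. (if i \<le> l then val u (Inl l) * c z (Inr l) else 0) + (if i \<le> l then val u (Inr l) * (- c z (Inl l)) else 0))"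
      by (rule sum.cong) (auto simp: val_def tq_def algebra_simps)
    also have "\<dots> = (\<Sum>r\<in>UNIV. if i \<le> idx r then val u r * (- sg r * c z (part r)) else 0)"
      unfolding sum.distrib sum_UNIV_Plus idx.simps sg.simps part.simps by (simp cong: if_cong)
    also have "\<dots> = (\<Sum>r\<in>{r. i \<le> idx r}. val u r * (- sg r * c z (part r)))"
      by (simp add: sum.inter_filter[symmetric])
    finally show ?thesis by (intro exI[of _ "\<lambda>r. - sg r * c z (part r)"]) simp
  qed
  \<comment> \<open>Division with remainder in the range 1 to \<open>\<bar>d\<bar>\<close> instead
    of 0 to \<open>\<bar>d\<bar> - 1\<close>, because the set A below admits only positive
    values.\<close>
  have num: "\<exists>k. 0 < a + k * d \<and> a + k * d \<le> \<bar>d\<bar>" if "d \<noteq> 0" for a d :: int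
  proof -
    have "a - 1 = \<bar>d\<bar> * ((a - 1) div \<bar>d\<bar>) + (a - 1) mod \<bar>d\<bar>" by simp
    moreover have "0 \<le> (a - 1) mod \<bar>d\<bar>" "(a - 1) mod \<bar>d\<bar> < \<bar>d\<bar>" using that by auto
    ultimately have "0 < a - \<bar>d\<bar> * ((a - 1) div \<bar>d\<bar>) \<and> a - \<bar>d\<bar> * ((a - 1) div \<bar>d\<bar>) \<le> \<bar>d\<bar>" by linarith
    moreover have "a - \<bar>d\<bar> * ((a - 1) div \<bar>d\<bar>) = a + (- sgn d * ((a - 1) div \<bar>d\<bar>)) * d"
      by (simp add: abs_sgn mult_ac)
    ultimately show ?thesis by metis
  qed
  define A where "A = {n. 0 < n \<and> (\<exists>u\<in>orb. c u (Inl i) = int n)}"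
  \<comment> \<open>One Euclidean step: a generator reduces the coordinate \<open>Inl i\<close>
    modulo a nonzero value \<open>val u r\<close>, so A has an element bounded by it.\<close>
  have small: "\<exists>n\<in>A. int n \<le> \<bar>val u r\<bar>" if u: "u \<in> orb" and r: "r \<noteq> Inl i" "i \<le> idx r" and nz: "val u r \<noteq> 0" for u r
  proof -
    have sgn: "sg (part r) * k * sg (part r) = k" for k using sg_sq[of "part r"] by (metis mult.assoc mult.commute mult_1)
    obtain k where k: "0 < c u (Inl i) + k * val u r" "c u (Inl i) + k * val u r \<le> \<bar>val u r\<bar>"
      using num[OF nz] by blast
    have "\<exists>u'\<in>orb. c u' (Inl i) = c u (Inl i) + k * val u r"
    proof (cases "idx r = i")
      case True
      hence r': "r = Inr i" using r by (cases r) auto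
      define a where "a = transv (of_int (- k) / (2 * of_int (t i))) (bv (Inl i)) (bv (Inl i))"
      have a: "a \<in> gens i" unfolding a_def by (rule gens.plane) simp
      have "co (a *v u) (Inl i) = of_int (c u (Inl i) + k * val u r)"
        unfolding a_def by (subst co_plane) (auto simp: c[OF orbL[OF u]] r' val_def)
      thus ?thesis using orb_step[OF u a] cI by blast
    next
      case False
      hence ir: "i < idx (part r)" using r by simp
      define a where "a = transv (of_int (sg (part r) * k) / of_int (t i)) (bv (Inl i)) (bv (part r))"
      have a: "a \<in> gens i" unfolding a_def using ir by (intro gens.mixed) auto
      have ne: "Inl i \<noteq> part r" using ir by (cases r) auto
      have "co (a *v u) (Inl i) = co u (Inl i) + of_int (sg (part r) * k * sg (part r) * tq i (idx r)) * co u r"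
        unfolding a_def by (subst co_mixed) (use ne ir in auto)
      also have "\<dots> = of_int (c u (Inl i) + k * val u r)"
        unfolding sgn using False by (simp add: c[OF orbL[OF u]] val_def)
      finally show ?thesis using orb_step[OF u a] cI by blast
    qed
    then obtain u' where "u' \<in> orb" "c u' (Inl i) = c u (Inl i) + k * val u r" by blast
    hence "nat (c u (Inl i) + k * val u r) \<in> A" using k by (auto simp: A_def)
    thus ?thesis using k by (intro bexI) auto
  qed
  have v_orb: "v \<in> orb" unfolding orb_def using wds.one by force
  have inr: "\<exists>u'\<in>orb. c u' (Inl i) = c u (Inl i) \<and> c u' (Inr i) = c u (Inr i) + k * c u (Inl i)" if u: "u \<in> orb" for u k
  proof -
    define a where "a = transv (of_int k / (2 * of_int (t i))) (bv (Inr i)) (bv (Inr i))"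
    have a: "a \<in> gens i" unfolding a_def by (rule gens.plane) simp
    have "co (a *v u) (Inl i) = of_int (c u (Inl i))" "co (a *v u) (Inr i) = of_int (c u (Inr i) + k * c u (Inl i))"
      unfolding a_def by (subst co_plane; auto simp: c[OF orbL[OF u]])+
    thus ?thesis using orb_step[OF u a] cI by blast
  qed
  \<comment> \<open>If all other values vanish, the Bezout relation makes the coordinate
    \<open>Inl i\<close> nonzero. It may be negative, so it is copied to the coordinate
    \<open>Inr i\<close> and then used as a modulus.\<close>
  have "A \<noteq> {}"
  proof (cases "\<exists>r. r \<noteq> Inl i \<and> i \<le> idx r \<and> val v r \<noteq> 0")
    case True
    thus ?thesis using small[OF v_orb] by blast
  next
    case False
    obtain h where h: "(\<Sum>r\<in>{r. i \<le> idx r}. val v r * h r) = 1" using bez[OF v_orb] by blast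
    have "c v (Inl i) \<noteq> 0"
    proof
      assume "c v (Inl i) = 0"
      hence "val v r = 0" if "i \<le> idx r" for r using False that by (cases "r = Inl i") (auto simp: val_def)
      thus False using h by simp
    qed
    moreover have "c v (Inr i) = 0" using False by (force simp: val_def)
    moreover obtain u' where "u' \<in> orb" "c u' (Inr i) = c v (Inr i) + 1 * c v (Inl i)" using inr[OF v_orb] by blast
    ultimately show ?thesis using small[of u' "Inr i"] by (auto simp: val_def)
  qed
  define \<mu> where "\<mu> = (LEAST n. n \<in> A)"
  have \<mu>A: "\<mu> \<in> A" unfolding \<mu>_def using \<open>A \<noteq> {}\<close> by (auto intro: LeastI)
  have \<mu>min: "\<mu> \<le> n" if "n \<in> A" for n unfolding \<mu>_def using that by (rule Least_le)
  have \<mu>pos: "\<mu> > 0" using \<mu>A by (simp add: A_def)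
  \<comment> \<open>Otherwise the coordinate \<open>Inr i\<close> could be reduced to a nonzero
    remainder below \<mu>, and one more Euclidean step would put a smaller number into A.\<close>
  have div1: "int \<mu> dvd c u (Inr i)" if u: "u \<in> orb" "c u (Inl i) = int \<mu>" for u
  proof (rule ccontr)
    assume nd: "\<not> int \<mu> dvd c u (Inr i)"
    obtain u' where u': "u' \<in> orb" "c u' (Inr i) = c u (Inr i) + (- (c u (Inr i) div int \<mu>)) * int \<mu>"
      using inr[OF u(1), of "- (c u (Inr i) div int \<mu>)"] u(2) by auto
    have "c u' (Inr i) = c u (Inr i) mod int \<mu>" unfolding u'(2) by (simp add: minus_div_mult_eq_mod)
    moreover have "c u (Inr i) mod int \<mu> \<noteq> 0" using nd by (simp add: dvd_eq_mod_eq_0)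
    moreover have "0 \<le> c u (Inr i) mod int \<mu>" "c u (Inr i) mod int \<mu> < int \<mu>" using \<mu>pos by auto
    ultimately show False using small[OF u'(1), of "Inr i"] \<mu>min by (fastforce simp: val_def)
  qed
  obtain u where u: "u \<in> orb" "c u (Inl i) = int \<mu>" using \<mu>A by (auto simp: A_def)
  \<comment> \<open>A mixed generator adds \<open>val u r\<close>, up to sign, to the coordinate
    \<open>Inr i\<close> and keeps the coordinate \<open>Inl i\<close> at \<mu>. By
    \<open>div1\<close> both the old and the new coordinate are divisible by \<mu>, hence so is
    their difference.\<close>
  have div2: "int \<mu> dvd val u r" if ir: "i < idx r" for r
  proof -
    define a where "a = transv (of_int 1 / of_int (t i)) (bv (Inr i)) (bv (part r))"
    have a: "a \<in> gens i" unfolding a_def using ir by (intro gens.mixed) auto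
    have ne: "Inl i \<noteq> part r" "Inr i \<noteq> part r" using ir by (cases r; auto)+
    have 1: "co (a *v u) (Inl i) = of_int (c u (Inl i))"
      unfolding a_def by (subst co_mixed) (use ne ir in \<open>auto simp: c[OF orbL[OF u(1)]]\<close>)
    have 2: "co (a *v u) (Inr i) = of_int (c u (Inr i) + sg (part r) * val u r)"
      unfolding a_def by (subst co_mixed) (use ne ir in \<open>auto simp: c[OF orbL[OF u(1)]] val_def\<close>)
    have "int \<mu> dvd c (a *v u) (Inr i)" using div1[OF orb_step[OF u(1) a]] cI[OF 1] u(2) by simp
    hence "int \<mu> dvd c u (Inr i) + sg (part r) * val u r" unfolding cI[OF 2] .
    hence "int \<mu> dvd sg (part r) * val u r" using div1[OF u] dvd_add_right_iff by blast
    thus ?thesis by (cases r) auto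
  qed
  have "int \<mu> dvd val u r" if ir: "i \<le> idx r" for r
  proof -
    consider "r = Inl i" | "r = Inr i" | "i < idx r"
      using ir idx_cases[of r i] by (auto simp: le_less)
    thus ?thesis using div1[OF u] div2 u(2) by cases (auto simp: val_def)
  qed
  hence "int \<mu> dvd (\<Sum>r\<in>{r. i \<le> idx r}. val u r * h r)" for h by (intro dvd_sum) auto
  hence "int \<mu> dvd 1" using bez[OF u(1)] by metis
  hence "int \<mu> = 1" using \<mu>pos by simp
  hence "co u (Inl i) = 1" using u c[OF orbL[OF u(1)], of "Inl i"] by simp
  thus ?thesis using u(1) by (auto simp: orb_def)
qed

text \<open>H is only assumed to be closed under products and left cancellation, the form in which a
  transformation law is easily checked. The induction runs over the number of planes whose basis
  vectors are not yet fixed; D, the set of fixed planes, is always an initial segment.\<close>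

theorem generation:
  assumes one: "mat 1 \<in> H"
    and gen: "\<And>i a. a \<in> gens i \<Longrightarrow> a \<in> H"
    and mult: "\<And>a b. a \<in> H \<Longrightarrow> b \<in> H \<Longrightarrow> a ** b \<in> H"
    and cancel: "\<And>a b. a \<in> H \<Longrightarrow> b \<in> symplectic_group \<Longrightarrow> a ** b \<in> H \<Longrightarrow> b \<in> H"
    and g: "g \<in> symplectic_group" "\<And>x. x \<in> Lam \<Longrightarrow> g *v x \<in> Lam"
  shows "g \<in> H"
proof -
  have wdsH: "w \<in> H" if "w \<in> wds i" for w i
    using that by induction (auto intro: one gen mult)
  have main: "g \<in> H"
    if "g \<in> symplectic_group" "\<And>x. x \<in> Lam \<Longrightarrow> g *v x \<in> Lam"
      "\<And>i j. i \<in> D \<Longrightarrow> j < i \<Longrightarrow> j \<in> D" "\<And>s. idx s \<in> D \<Longrightarrow> g *v bv s = bv s" for D g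
    using that
  proof (induction "card (- D)" arbitrary: D g rule: less_induct)
    case less
    show ?case
    proof (cases "D = UNIV")
      case True
      hence fixed: "g *v bv s = mat 1 *v bv s" for s using less.prems(4) by simp
      have "g $ r $ s = mat 1 $ r $ s" for r s
      proof -
        have "(M *v bv s) $ r = M $ r $ s * wt s" for M :: "rat^('n + 'n)^('n + 'n)"
          by (simp add: bv_def matrix_vector_mult_def axis_def if_distrib sum.If_cases cong: if_cong)
        from this[of g] this[of "mat 1"] have "g $ r $ s * wt s = mat 1 $ r $ s * wt s" by (simp only: fixed)
        thus ?thesis by simp
      qed
      hence "g = mat 1" by (simp add: vec_eq_iff)
      thus ?thesis using one by simp
    next
      case False
      define i where "i = Min (- D)"
      have iD: "i \<notin> D" using Min_in[of "- D"] False by (auto simp: i_def)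
      have D_eq: "j \<in> D \<longleftrightarrow> j < i" for j
      proof
        assume "j \<in> D" thus "j < i" using less.prems(3)[of j i] iD by (metis linorder_less_linear)
      next
        assume "j < i"
        show "j \<in> D"
        proof (rule ccontr)
          assume "j \<notin> D"
          hence "i \<le> j" unfolding i_def by (intro Min_le) auto
          thus False using \<open>j < i\<close> by simp
        qed
      qed
      \<comment> \<open>g fixes the basis vectors of the lower planes and preserves
        \<open>omega\<close>, so images of higher basis vectors remain orthogonal to them.\<close>
      have low: "co (g *v bv s) r = 0" if "idx r < i" "i \<le> idx s" for r s
      proof -
        have ir: "idx (part r) \<in> D" using that by (simp add: D_eq)
        have "omega (g *v bv s) (bv (part r)) = omega (g *v bv s) (g *v bv (part r))"
          using less.prems(4)[OF ir] by simp
        also have "\<dots> = omega (bv s) (bv (part r))" using less.prems(1) by (simp add: symplectic_iff_omega)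
        also have "\<dots> = 0" using that by (auto simp: omega_bv_bv)
        finally show ?thesis by (cases r) (auto simp: omega_bv)
      qed
      have gL: "g *v bv s \<in> Lam" for s by (rule less.prems(2)[OF bv_Lam])
      have "omega (g *v bv (Inl i)) (g *v bv (Inr i)) = of_int (t i)"
        using less.prems(1) by (simp add: symplectic_iff_omega omega_bv_bv)
      \<comment> \<open>The word w1 creates the coordinate 1, w2 uses it as pivot to send the image
        of \<open>bv (Inl i)\<close> back to \<open>bv (Inl i)\<close>, and w3 restores
        \<open>bv (Inr i)\<close> while keeping \<open>bv (Inl i)\<close>.\<close>
      hence "\<exists>w1\<in>wds i. co (w1 *v (g *v bv (Inl i))) (Inl i) = 1"
        by (intro reduce_to_one[OF gL _ gL] low) auto
      then obtain w1 where w1: "w1 \<in> wds i" "co (w1 *v (g *v bv (Inl i))) (Inl i) = 1" by blast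
      have lowW: "co (w *v x) r = 0" if "w \<in> wds i" "\<And>r. idx r < i \<Longrightarrow> co x r = 0" "idx r < i" for w x r
      proof -
        have ir: "idx (part r) < i" using that by simp
        have "omega (w *v x) (bv (part r)) = omega (w *v x) (w *v bv (part r))"
          using wds_fix[OF that(1) ir] by simp
        also have "\<dots> = omega x (bv (part r))" using wds_symplectic[OF that(1)] by (simp add: symplectic_iff_omega)
        also have "\<dots> = 0" using that by (simp add: omega_bv)
        finally show ?thesis by (cases r) (auto simp: omega_bv)
      qed
      have "co (w1 *v (g *v bv (Inl i))) r = 0" if "idx r < i" for r
        by (rule lowW[OF w1(1) _ that], rule low) auto
      hence "\<exists>w\<in>wds i. w *v bv (Inr i) = bv (Inr i) \<and> w *v (w1 *v (g *v bv (Inl i))) = bv (part (Inr i))"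
        using w1(2) by (intro kill wds_Lam[OF w1(1) gL]) auto
      then obtain w2 where w2: "w2 \<in> wds i" "w2 *v (w1 *v (g *v bv (Inl i))) = bv (Inl i)" by auto
      define w where "w = w2 ** w1"
      have w: "w \<in> wds i" unfolding w_def by (rule wds_mult[OF w2(1) w1(1)])
      have we: "w *v (g *v bv (Inl i)) = bv (Inl i)" using w2(2) by (simp add: w_def matrix_vector_mul_assoc[symmetric])
      define x where "x = w *v (g *v bv (Inr i))"
      have xL: "x \<in> Lam" unfolding x_def by (rule wds_Lam[OF w gL])
      \<comment> \<open>The pivot for w3 comes for free: x pairs with \<open>bv (Inl i)\<close> to
        \<open>t i\<close>, which says that its coordinate at \<open>Inr i\<close> is 1.\<close>
      have "omega (bv (Inl i)) x = omega (w *v (g *v bv (Inl i))) (w *v (g *v bv (Inr i)))" by (simp add: we x_def)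
      also have "\<dots> = of_int (t i)"
        using wds_symplectic[OF w] less.prems(1) by (simp add: symplectic_iff_omega omega_bv_bv)
      finally have "co x (Inr i) = 1" using omega_skew[of "bv (Inl i)" x] by (simp add: omega_bv)
      moreover have "co x r = 0" if "idx r < i" for r
        unfolding x_def by (rule lowW[OF w _ that], rule low) auto
      ultimately have "\<exists>w\<in>wds i. w *v bv (Inl i) = bv (Inl i) \<and> w *v x = bv (part (Inl i))"
        by (intro kill xL) auto
      then obtain w3 where w3: "w3 \<in> wds i" "w3 *v bv (Inl i) = bv (Inl i)" "w3 *v x = bv (Inr i)" by auto
      define h where "h = w3 ** w"
      have h: "h \<in> wds i" unfolding h_def by (rule wds_mult[OF w3(1) w])
      have hg: "(h ** g) *v bv s = bv s" if si: "idx s \<le> i" for s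
      proof -
        consider "s = Inl i" | "s = Inr i" | "idx s < i"
          using si idx_cases[of s i] by (auto simp: le_less)
        thus ?thesis
        proof cases
          case 1 thus ?thesis by (simp add: h_def matrix_vector_mul_assoc[symmetric] we w3)
        next
          case 2 thus ?thesis using w3(3) by (simp add: h_def matrix_vector_mul_assoc[symmetric] x_def)
        next
          case 3 thus ?thesis
            using less.prems(4)[of s] wds_fix[OF h 3] by (simp add: D_eq matrix_vector_mul_assoc[symmetric])
        qed
      qed
      have "h ** g \<in> H"
      proof (rule less.hyps[of "{j. j \<le> i}"])
        have "- {j. j \<le> i} \<subset> - D" using D_eq by force
        thus "card (- {j. j \<le> i}) < card (- D)" by (intro psubset_card_mono) auto
        show "h ** g \<in> symplectic_group" by (rule symplectic_mult[OF wds_symplectic[OF h] less.prems(1)])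
        show "(h ** g) *v x \<in> Lam" if "x \<in> Lam" for x
          using wds_Lam[OF h less.prems(2)[OF that]] by (simp add: matrix_vector_mul_assoc)
        show "(h ** g) *v bv s = bv s" if "idx s \<in> {j. j \<le> i}" for s using hg that by simp
      qed auto
      thus ?thesis using cancel[OF wdsH[OF h] less.prems(1)] by blast
    qed
  qed
  show ?thesis by (rule main[of g "{}"]) (use g in auto)
qed

end

section \<open>Theta series as functions on the Siegel upper half space\<close>

context quad_space
begin

definition tform :: "('n \<Rightarrow> 'v) \<Rightarrow> complex^'n^('n::finite) \<Rightarrow> complex" where
  "tform x Z = (\<Sum>a\<in>UNIV. \<Sum>b\<in>UNIV. of_rat (half_polar Q (x a) (x b)) * Z $ b $ a)"

text \<open>The size of a tuple in all estimates below: the exponent grows at most linearly in it,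
  and its imaginary part at least linearly.\<close>

definition Nsum :: "('n::finite \<Rightarrow> 'v) \<Rightarrow> real" where
  "Nsum x = (\<Sum>a\<in>UNIV. of_rat (Q (x a)))"

lemma theta_eq: "theta Q L Z = (\<Sum>\<^sub>\<infinity>x\<in>{x. \<forall>i. x i \<in> L i}. fexp (tform x Z))"
  unfolding theta_def fexp_def tform_def trace_def by (simp add: matrix_matrix_mult_def)

lemma tform_add: "tform x (Z + W) = tform x Z + tform x W"
  by (simp add: tform_def sum.distrib algebra_simps)

lemma tform_cmult: "tform x (map_mat ((*) c) Z) = c * tform x Z"
  by (simp add: tform_def map_mat_def sum_distrib_left mult_ac)

lemma tform_scaleR: "tform x (r *\<^sub>R Z) = r *\<^sub>R tform x Z"
  by (simp add: tform_def scaleR_sum_right)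

lemma half_polar_sym: "half_polar Q x y = half_polar Q y x"
  by (simp add: half_polar_def polar_sym[of x])

lemma half_polar_self: "half_polar Q x x = Q x"
  by (simp add: half_polar_def polar_self)

lemma Nsum_nonneg: "Nsum x \<ge> 0"
  unfolding Nsum_def by (intro sum_nonneg) (simp add: Q_nonneg)

context
  fixes E assumes E: "orth_basis E"
begin

lemma half_polar_coord: "half_polar Q x y = (\<Sum>e\<in>E. Q e * coord e x * coord e y)"
  by (simp add: half_polar_def polar_coord[OF E] sum_divide_distrib mult.assoc)

text \<open>Nonnegativity of Q at x + y and at x - y replaces the Cauchy-Schwarz inequality and
  avoids square roots of rationals.\<close>

lemma half_polar_bound: "\<bar>half_polar Q x y\<bar> \<le> (Q x + Q y) / 2"
proof -
  have "0 \<le> Q (x + y)" "0 \<le> Q (x - y)" by (rule Q_nonneg)+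
  moreover have "Q (x + y) = Q x + Q y + 2 * half_polar Q x y" by (simp add: half_polar_def polar_def field_simps)
  moreover have "Q (x - y) = Q x + Q y - 2 * half_polar Q x y"
  proof -
    have "2 * Q (x - y) = polar Q (x - y) (x - y)" by (rule polar_self[symmetric])
    also have "\<dots> = 2 * Q x + 2 * Q y - 2 * polar Q x y"
      by (simp only: polar_diff_left polar_diff_right) (simp add: polar_self polar_sym[of y x])
    finally show ?thesis by (simp add: half_polar_def)
  qed
  ultimately have "2 * half_polar Q x y \<le> Q x + Q y" "- (2 * half_polar Q x y) \<le> Q x + Q y" by simp_all
  thus ?thesis by (intro abs_leI) simp_all
qed

lemma tform_bound:
  fixes x :: "'n::finite \<Rightarrow> 'v"
  shows "norm (tform x Z) \<le> real CARD('n) * Nsum x * norm Z"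
proof -
  have "norm (tform x Z) \<le> (\<Sum>a\<in>UNIV. \<Sum>b\<in>UNIV. norm (of_rat (half_polar Q (x a) (x b)) * Z $ b $ a))"
    unfolding tform_def by (intro order_trans[OF norm_sum] sum_mono norm_sum)
  also have "\<dots> \<le> (\<Sum>a\<in>UNIV. \<Sum>b\<in>UNIV. (of_rat (Q (x a)) + of_rat (Q (x b))) / 2 * norm Z)"
  proof (intro sum_mono)
    fix a b
    have "norm (of_rat (half_polar Q (x a) (x b)) :: complex) = \<bar>real_of_rat (half_polar Q (x a) (x b))\<bar>"
      by (metis norm_of_real of_real_of_rat real_norm_def)
    also have "\<dots> = of_rat \<bar>half_polar Q (x a) (x b)\<bar>" by simp
    also have "\<dots> \<le> of_rat ((Q (x a) + Q (x b)) / 2)" using half_polar_bound by (simp only: of_rat_less_eq)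
    finally have 1: "norm (of_rat (half_polar Q (x a) (x b)) :: complex) \<le> (of_rat (Q (x a)) + of_rat (Q (x b))) / 2"
      by (simp add: of_rat_add of_rat_divide)
    have 2: "norm (Z $ b $ a) \<le> norm Z"
      using Finite_Cartesian_Product.norm_nth_le[of Z b] Finite_Cartesian_Product.norm_nth_le[of "Z $ b" a] by linarith
    show "norm (of_rat (half_polar Q (x a) (x b)) * Z $ b $ a) \<le> (of_rat (Q (x a)) + of_rat (Q (x b))) / 2 * norm Z"
      unfolding norm_mult by (rule mult_mono[OF 1 2]) (auto simp: Q_nonneg)
  qed
  also have "\<dots> = real CARD('n) * Nsum x * norm Z"
    by (simp add: Nsum_def sum_distrib_right[symmetric] sum_distrib_left[symmetric] sum.distrib sum_divide_distrib[symmetric] field_simps)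
  finally show ?thesis .
qed

text \<open>In an orthogonal basis the imaginary part is the sum over e of \<open>Q e\<close> times
  the form of Im Z at the real vector of e-coordinates of the tuple, so a lower bound for Im Z
  applies to each summand.\<close>

lemma Im_tform_lower:
  fixes x :: "'n::finite \<Rightarrow> 'v"
  assumes Y: "\<And>v :: real^'n. d * (v \<bullet> v) \<le> v \<bullet> (map_mat Im Z *v v)"
  shows "d * Nsum x \<le> Im (tform x Z)"
proof -
  define c where "c e = (\<chi> a. real_of_rat (coord e (x a)))" for e
  have "Im (tform x Z) = (\<Sum>a\<in>UNIV. \<Sum>b\<in>UNIV. of_rat (half_polar Q (x a) (x b)) * Im (Z $ b $ a))"
    unfolding tform_def by (simp flip: of_real_of_rat)
  also have "\<dots> = (\<Sum>a\<in>UNIV. \<Sum>b\<in>UNIV. \<Sum>e\<in>E. of_rat (Q e) * (c e $ b * (Im (Z $ b $ a) * c e $ a)))"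
    by (simp add: half_polar_coord of_rat_sum of_rat_mult sum_distrib_right sum_distrib_left c_def mult_ac)
  also have "\<dots> = (\<Sum>e\<in>E. \<Sum>b\<in>UNIV. \<Sum>a\<in>UNIV. of_rat (Q e) * (c e $ b * (Im (Z $ b $ a) * c e $ a)))"
    by (subst sum.swap, subst sum.swap[of _ E], subst sum.swap[of _ E], rule refl)
  also have "\<dots> = (\<Sum>e\<in>E. of_rat (Q e) * (c e \<bullet> (map_mat Im Z *v c e)))"
    by (simp add: inner_vec_def matrix_vector_mult_def map_mat_def sum_distrib_left)
  also have "\<dots> \<ge> (\<Sum>e\<in>E. of_rat (Q e) * (d * (c e \<bullet> c e)))"
    by (intro sum_mono mult_left_mono Y) (simp add: Q_nonneg)
  also have "(\<Sum>e\<in>E. of_rat (Q e) * (d * (c e \<bullet> c e))) = d * (\<Sum>e\<in>E. \<Sum>a\<in>UNIV. of_rat (Q e * (coord e (x a))\<^sup>2))"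
    by (simp add: inner_vec_def c_def sum_distrib_left of_rat_mult power2_eq_square mult_ac)
  also have "(\<Sum>e\<in>E. \<Sum>a\<in>UNIV. real_of_rat (Q e * (coord e (x a))\<^sup>2)) = Nsum x"
    unfolding Nsum_def by (subst sum.swap, rule sum.cong, simp, subst (2) Q_coord[OF E], simp add: of_rat_sum)
  finally show ?thesis .
qed

text \<open>The exponential factors over the entries of the tuple, so the sum is a finite product of
  one-variable Gaussian sums over the dual of the integral span of E.\<close>

lemma Nsum_gauss_summable:
  assumes s: "s > 0"
  shows "(\<lambda>x::'n::finite \<Rightarrow> 'v. exp (- s * Nsum x)) summable_on {x. \<forall>i. \<forall>e\<in>E. polar Q (x i) e \<in> \<int>}"
proof -
  define M where "M = dual_span E"
  define r where "r = s / (2 * pi)"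
  have r: "r > 0" using s by (simp add: r_def)
  have "countable (E \<rightarrow>\<^sub>E (UNIV :: int set))" using finE[OF E] by (intro countable_PiE) auto
  hence cM: "countable M"
    unfolding M_def by (subst bij_betw_imp_surj_on[OF orth_dual_bij[OF E], symmetric]) (rule countable_image)
  have trm: "norm (fexp (qexp E (\<i> * r) (\<lambda>_. 0) y)) = exp (- s * of_rat (Q y))" for y
  proof -
    have "qexp E (\<i> * r) (\<lambda>_. 0) y = \<i> * of_real (r * of_rat (Q y))"
      by (simp add: qexp_def Q_coord[OF E, of y] of_rat_sum of_rat_mult of_rat_power sum_distrib_left of_real_of_rat mult_ac)
    thus ?thesis by (simp add: norm_fexp r_def)
  qed
  have sM: "(\<lambda>y. norm (complex_of_real (exp (- s * of_rat (Q y))))) summable_on M"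
    using qexp_summable[OF E, of "\<i> * r" "\<lambda>_. 0"] r unfolding trm M_def by simp
  have "(\<lambda>x. norm (\<Prod>i\<in>UNIV. complex_of_real (exp (- s * of_rat (Q (x i)))))) summable_on (PiE (UNIV :: 'n set) (\<lambda>_. M))"
    using abs_summable_on_prod_PiE[of "UNIV :: 'n set" "\<lambda>_. M" "\<lambda>i y. complex_of_real (exp (- s * of_rat (Q y)))"] cM sM
    unfolding abs_summable_equivalent[symmetric] by simp
  moreover have "PiE (UNIV :: 'n set) (\<lambda>_. M) = {x. \<forall>i. \<forall>e\<in>E. polar Q (x i) e \<in> \<int>}"
    by (auto simp: M_def PiE_def)
  moreover have "norm (\<Prod>i\<in>UNIV. complex_of_real (exp (- s * of_rat (Q (x i))))) = exp (- s * Nsum x)" for x :: "'n \<Rightarrow> 'v"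
  proof -
    have "norm (\<Prod>i\<in>UNIV. complex_of_real (exp (- s * of_rat (Q (x i))))) = (\<Prod>i\<in>UNIV. exp (- s * of_rat (Q (x i))))"
      by (simp add: prod_norm[symmetric])
    also have "\<dots> = exp (- s * Nsum x)" by (simp add: Nsum_def sum_distrib_left exp_sum)
    finally show ?thesis .
  qed
  ultimately show ?thesis by simp
qed

text \<open>The form attains a positive minimum on the compact unit sphere; homogeneity extends the
  bound to all vectors.\<close>

lemma siegel_lower_bound:
  assumes Z: "(Z :: complex^'n^('n::finite)) \<in> siegel_upper_half"
  shows "\<exists>d>0. \<forall>v :: real^'n. d * (v \<bullet> v) \<le> v \<bullet> (map_mat Im Z *v v)"
proof -
  define q where "q v = v \<bullet> (map_mat Im Z *v v)" for v :: "real^'n"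
  have cont: "continuous_on A q" for A
    unfolding q_def by (intro continuous_intros linear_continuous_on matrix_vector_mul_bounded_linear)
  have "sphere (0 :: real^'n) 1 \<noteq> {}" by simp
  then obtain w where w: "w \<in> sphere 0 1" "\<And>v. v \<in> sphere 0 1 \<Longrightarrow> q w \<le> q v"
    using continuous_attains_inf[OF compact_sphere _ cont] by blast
  have "w \<noteq> 0" using w(1) by auto
  hence "q w > 0" using Z by (simp add: siegel_upper_half_def q_def)
  moreover have "q w * (v \<bullet> v) \<le> q v" for v
  proof (cases "v = 0")
    case False
    have "q w \<le> q ((1 / norm v) *\<^sub>R v)" using False by (intro w(2)) simp
    also have "q ((1 / norm v) *\<^sub>R v) = q v / (v \<bullet> v)"
      by (simp add: q_def matrix_vector_mult_scaleR dot_square_norm power2_eq_square)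
    finally show ?thesis using False by (simp add: field_simps)
  qed (simp add: q_def)
  ultimately show ?thesis unfolding q_def by blast
qed

lemma norm_fexp_tform_le:
  assumes "\<And>v :: real^'n. d * (v \<bullet> v) \<le> v \<bullet> (map_mat Im Z *v v)"
  shows "norm (fexp (tform (x :: 'n::finite \<Rightarrow> 'v) Z)) \<le> exp (- (2 * pi * d) * Nsum x)"
  using Im_tform_lower[OF assms, of x] by (simp add: norm_fexp mult_ac)

context
  fixes X :: "('n::finite \<Rightarrow> 'v) set"
  assumes X: "X \<subseteq> {x. \<forall>i. \<forall>e\<in>E. polar Q (x i) e \<in> \<int>}"
begin

lemma theta_abs_summable:
  assumes Z: "Z \<in> siegel_upper_half"
  shows "(\<lambda>x. norm (fexp (tform x Z))) summable_on X"
proof -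
  obtain d where d: "d > 0" "\<And>v :: real^'n. d * (v \<bullet> v) \<le> v \<bullet> (map_mat Im Z *v v)"
    using siegel_lower_bound[OF Z] by blast
  have "(\<lambda>x. exp (- (2 * pi * d) * Nsum x)) summable_on X"
    by (rule summable_on_subset_banach[OF Nsum_gauss_summable X]) (use d in simp)
  thus ?thesis
    by (rule Infinite_Sum.abs_summable_on_comparison_test') (rule norm_fexp_tform_le[OF d(2)])
qed

text \<open>The second order Taylor remainder of every term has a summable bound proportional to the
  square of the increment. The increment need not be symmetric, so differentiability holds in the
  full matrix space; restriction to the half space is left to the end.\<close>

lemma theta_has_derivative:
  assumes Z: "Z \<in> siegel_upper_half"
  defines "F \<equiv> \<lambda>H. \<Sum>\<^sub>\<infinity>x\<in>X. 2 * pi * \<i> * tform x H * fexp (tform x Z)"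
  shows "((\<lambda>Z. \<Sum>\<^sub>\<infinity>x\<in>X. fexp (tform x Z)) has_derivative F) (at Z)"
    and "F (map_mat ((*) c) H) = c * F H"
proof -
  obtain d where d: "d > 0" "\<And>v :: real^'n. d * (v \<bullet> v) \<le> v \<bullet> (map_mat Im Z *v v)"
    using siegel_lower_bound[OF Z] by blast
  define C where "C = 2 * pi * real CARD('n)"
  have C: "C > 0" by (simp add: C_def)
  \<comment> \<open>The terms decay at rate \<open>2 * pi * d\<close> in \<open>Nsum x\<close>. Half
    of this pays for the exponential growth in the Taylor remainder, a quarter for the factors
    \<open>Nsum x\<close> and its square, and G keeps the last quarter.\<close>
  define G where "G = (\<lambda>x :: 'n \<Rightarrow> 'v. exp (- (pi * d / 2) * Nsum x))"
  define S where "S = infsum G X"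
  have GX: "G summable_on X"
    unfolding G_def by (rule summable_on_subset_banach[OF Nsum_gauss_summable X]) (use d in simp)
  have base: "norm (fexp (tform x Z)) \<le> exp (- (2 * pi * d) * Nsum x)" for x
    by (rule norm_fexp_tform_le[OF d(2)])
  have h: "norm (2 * pi * \<i> * tform x H) \<le> C * Nsum x * norm H" for x :: "'n \<Rightarrow> 'v" and H
    using tform_bound[of x H] by (simp add: norm_mult C_def mult_ac)
  have yexp: "y \<le> exp y" "y\<^sup>2 \<le> 2 * exp y" if "y \<ge> 0" for y :: real
  proof -
    show "y \<le> exp y" using exp_ge_add_one_self[of y] by linarith
    show "y\<^sup>2 \<le> 2 * exp y" using exp_lower_Taylor_quadratic[OF that] that by linarith
  qed
  define c1 where "c1 = 2 / (pi * d)"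
  have c1: "c1 > 0" using d by (simp add: c1_def)
  have N1: "Nsum x * exp (- (2 * pi * d) * Nsum x) \<le> c1 * G x" for x :: "'n \<Rightarrow> 'v"
  proof -
    define y where "y = pi * d / 2 * Nsum x"
    have y: "y \<ge> 0" unfolding y_def using d by (intro mult_nonneg_nonneg Nsum_nonneg) auto
    have "y * exp (- 4 * y) \<le> exp y * exp (- 2 * y)"
      using y yexp(1)[OF y] by (intro mult_mono) auto
    also have "\<dots> = G x" by (simp add: G_def y_def flip: exp_add)
    finally have "c1 * (y * exp (- 4 * y)) \<le> c1 * G x" using c1 by simp
    moreover have c: "c1 * y = Nsum x" using d by (simp add: c1_def y_def)
    have e: "- 4 * y = - (2 * pi * d) * Nsum x" by (simp add: y_def)
    have "c1 * (y * exp (- 4 * y)) = Nsum x * exp (- (2 * pi * d) * Nsum x)"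
      by (simp only: mult.assoc[symmetric] c e)
    ultimately show ?thesis by simp
  qed
  have N2: "(Nsum x)\<^sup>2 * exp (- (pi * d) * Nsum x) \<le> 2 * c1\<^sup>2 * G x" for x :: "'n \<Rightarrow> 'v"
  proof -
    define y where "y = pi * d / 2 * Nsum x"
    have y: "y \<ge> 0" unfolding y_def using d by (intro mult_nonneg_nonneg Nsum_nonneg) auto
    have "y\<^sup>2 * exp (- 2 * y) \<le> (2 * exp y) * exp (- 2 * y)"
      using yexp(2)[OF y] by (intro mult_right_mono) auto
    also have "\<dots> = 2 * G x" by (simp add: G_def y_def flip: exp_add)
    finally have "c1\<^sup>2 * (y\<^sup>2 * exp (- 2 * y)) \<le> c1\<^sup>2 * (2 * G x)" by (intro mult_left_mono) auto
    moreover have "c1 * y = Nsum x" using d by (simp add: c1_def y_def)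
    then have c: "c1\<^sup>2 * y\<^sup>2 = (Nsum x)\<^sup>2" by (simp only: power_mult_distrib[symmetric])
    have e: "- 2 * y = - (pi * d) * Nsum x" by (simp add: y_def)
    have "c1\<^sup>2 * (y\<^sup>2 * exp (- 2 * y)) = (Nsum x)\<^sup>2 * exp (- (pi * d) * Nsum x)"
      by (simp only: mult.assoc[symmetric] c e)
    ultimately show ?thesis by simp
  qed
  have dbound: "norm (2 * pi * \<i> * tform x H * fexp (tform x Z)) \<le> C * c1 * norm H * G x" for x H
  proof -
    have "norm (2 * pi * \<i> * tform x H * fexp (tform x Z)) \<le> (C * Nsum x * norm H) * exp (- (2 * pi * d) * Nsum x)"
      unfolding norm_mult[of "2 * pi * \<i> * tform x H"] using C
      by (intro mult_mono h base mult_nonneg_nonneg Nsum_nonneg) auto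
    also have "\<dots> = C * norm H * (Nsum x * exp (- (2 * pi * d) * Nsum x))" by (simp add: mult_ac)
    also have "\<dots> \<le> C * norm H * (c1 * G x)" using C by (intro mult_left_mono N1) auto
    finally show ?thesis by (simp add: mult_ac)
  qed
  have dsum: "(\<lambda>x. 2 * pi * \<i> * tform x H * fexp (tform x Z)) summable_on X" for H
    by (rule abs_summable_summable, rule Infinite_Sum.abs_summable_on_comparison_test'[OF summable_on_cmult_right[OF GX] dbound])
  have Fbound: "norm (F H) \<le> C * c1 * norm H * S" for H
  proof -
    have "norm (F H) \<le> (\<Sum>\<^sub>\<infinity>x\<in>X. C * c1 * norm H * G x)"
      unfolding F_def
      by (rule norm_infsum_le[OF has_sum_infsum[OF dsum] has_sum_infsum[OF summable_on_cmult_right[OF GX]] dbound])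
    also have "\<dots> = C * c1 * norm H * S" unfolding S_def by (rule infsum_cmult_right')
    finally show ?thesis .
  qed
  have bl: "bounded_linear F"
  proof (rule bounded_linear_intro[where K = "C * c1 * S"])
    show "F (H + H') = F H + F H'" for H H'
      unfolding F_def by (subst infsum_add[symmetric, OF dsum dsum]) (simp add: tform_add algebra_simps)
    show "F (r *\<^sub>R H) = r *\<^sub>R F H" for r H
      unfolding F_def tform_scaleR by (subst infsum_scaleR_right[symmetric]) (simp add: scaleR_conv_of_real mult_ac)
    show "norm (F H) \<le> norm H * (C * c1 * S)" for H using Fbound[of H] by (simp add: mult_ac)
  qed
  show "F (map_mat ((*) c) H) = c * F H"
    unfolding F_def tform_cmult by (subst infsum_cmult_right'[symmetric]) (simp add: mult_ac)
  define K where "K = 2 * (C * c1)\<^sup>2 * S"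
  \<comment> \<open>The smallness of H is chosen to keep the perturbation of the exponent below
    \<open>pi * d * Nsum x\<close>, half of the available decay.\<close>
  have quad: "norm ((\<Sum>\<^sub>\<infinity>x\<in>X. fexp (tform x (Z + H))) - (\<Sum>\<^sub>\<infinity>x\<in>X. fexp (tform x Z)) - F H) \<le> K * (norm H)\<^sup>2"
    if H: "C * norm H \<le> pi * d" for H
  proof -
    have rem: "norm (fexp (tform x (Z + H)) - fexp (tform x Z) - 2 * pi * \<i> * tform x H * fexp (tform x Z))
        \<le> 2 * (C * c1)\<^sup>2 * (norm H)\<^sup>2 * G x" for x
    proof -
      define w where "w = 2 * pi * \<i> * tform x H"
      have "fexp (tform x (Z + H)) = fexp (tform x Z) * exp w"
        unfolding tform_add fexp_add by (simp add: w_def fexp_def)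
      hence "fexp (tform x (Z + H)) - fexp (tform x Z) - w * fexp (tform x Z) = fexp (tform x Z) * (exp w - (\<Sum>k\<le>1. w ^ k / fact k))"
        by (simp add: algebra_simps)
      hence "norm (fexp (tform x (Z + H)) - fexp (tform x Z) - w * fexp (tform x Z)) \<le>
          exp (- (2 * pi * d) * Nsum x) * (exp \<bar>Re w\<bar> * norm w ^ Suc 1 / fact 1)"
        unfolding norm_mult by (simp only: norm_mult) (intro mult_mono base Taylor_exp, auto)
      also have "\<dots> \<le> exp (- (2 * pi * d) * Nsum x) * (exp (pi * d * Nsum x) * (C * Nsum x * norm H)\<^sup>2)"
      proof (intro mult_left_mono)
        have "norm w \<le> C * Nsum x * norm H" unfolding w_def by (rule h)
        moreover have "C * Nsum x * norm H \<le> pi * d * Nsum x"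
          using mult_right_mono[OF H Nsum_nonneg[of x]] by (simp add: mult_ac)
        ultimately have "\<bar>Re w\<bar> \<le> pi * d * Nsum x" using abs_Re_le_cmod[of w] by linarith
        thus "exp \<bar>Re w\<bar> * norm w ^ Suc 1 / fact 1 \<le> exp (pi * d * Nsum x) * (C * Nsum x * norm H)\<^sup>2"
          using \<open>norm w \<le> C * Nsum x * norm H\<close>
          by (auto simp: numeral_2_eq_2[symmetric] intro!: mult_mono power_mono)
      qed simp
      also have "\<dots> = (C * norm H)\<^sup>2 * ((Nsum x)\<^sup>2 * exp (- (pi * d) * Nsum x))"
        by (simp add: power_mult_distrib mult.assoc[symmetric] exp_add[symmetric])
      also have "\<dots> \<le> (C * norm H)\<^sup>2 * (2 * c1\<^sup>2 * G x)"
        by (intro mult_left_mono N2) auto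
      finally show ?thesis unfolding w_def by (simp add: power_mult_distrib mult_ac)
    qed
    have sumH: "(\<lambda>x. fexp (tform x (Z + H))) summable_on X"
    proof (rule abs_summable_summable, rule Infinite_Sum.abs_summable_on_comparison_test'[OF GX])
      fix x
      have "Im (tform x (Z + H)) \<ge> d * Nsum x - d / 2 * Nsum x"
      proof -
        have "\<bar>Im (tform x H)\<bar> \<le> norm (tform x H)" by (rule abs_Im_le_cmod)
        also have "\<dots> \<le> real CARD('n) * norm H * Nsum x" using tform_bound[of x H] by (simp add: mult_ac)
        also have "\<dots> \<le> d / 2 * Nsum x"
          using H by (intro mult_right_mono Nsum_nonneg) (simp add: C_def field_simps)
        finally show ?thesis using Im_tform_lower[OF d(2), of x] by (simp add: tform_add)
      qed
      hence "2 * pi * (d / 2 * Nsum x) \<le> 2 * pi * Im (tform x (Z + H))" by simp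
      moreover have "pi * d / 2 * Nsum x \<le> 2 * pi * (d / 2 * Nsum x)"
        using d Nsum_nonneg[of x] by (simp add: field_simps mult_left_le)
      ultimately show "norm (fexp (tform x (Z + H))) \<le> G x" by (simp add: norm_fexp G_def)
    qed
    have sumZ: "(\<lambda>x. fexp (tform x Z)) summable_on X"
      by (rule abs_summable_summable[OF theta_abs_summable[OF Z]])
    have hs: "((\<lambda>x. fexp (tform x (Z + H)) - fexp (tform x Z) - 2 * pi * \<i> * tform x H * fexp (tform x Z)) has_sum
       ((\<Sum>\<^sub>\<infinity>x\<in>X. fexp (tform x (Z + H))) - (\<Sum>\<^sub>\<infinity>x\<in>X. fexp (tform x Z)) - F H)) X"
      unfolding F_def diff_conv_add_uminus
      by (intro has_sum_add has_sum_uminusI has_sum_infsum sumH sumZ dsum)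
    have "norm ((\<Sum>\<^sub>\<infinity>x\<in>X. fexp (tform x (Z + H))) - (\<Sum>\<^sub>\<infinity>x\<in>X. fexp (tform x Z)) - F H) \<le>
       (\<Sum>\<^sub>\<infinity>x\<in>X. 2 * (C * c1)\<^sup>2 * (norm H)\<^sup>2 * G x)"
      by (rule norm_infsum_le[OF hs has_sum_infsum[OF summable_on_cmult_right[OF GX]] rem])
    also have "\<dots> = 2 * (C * c1)\<^sup>2 * (norm H)\<^sup>2 * S" unfolding S_def by (rule infsum_cmult_right')
    finally show ?thesis by (simp add: K_def mult_ac)
  qed
  show "((\<lambda>Z. \<Sum>\<^sub>\<infinity>x\<in>X. fexp (tform x Z)) has_derivative F) (at Z)"
    unfolding has_derivative_iff_norm
  proof (intro conjI bl)
    let ?f = "\<lambda>Z. \<Sum>\<^sub>\<infinity>x\<in>X. fexp (tform x Z)"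
    have ev: "eventually (\<lambda>W. C * norm (W - Z) < pi * d) (at Z)"
    proof (rule order_tendstoD)
      have "((\<lambda>W. C * norm (W - Z)) \<longlongrightarrow> C * norm (Z - Z)) (at Z)" by (intro tendsto_intros)
      thus "((\<lambda>W. C * norm (W - Z)) \<longlongrightarrow> 0) (at Z)" by simp
    qed (use d in simp)
    show "((\<lambda>W. norm (?f W - ?f Z - F (W - Z)) / norm (W - Z)) \<longlongrightarrow> 0) (at Z)"
    proof (rule Lim_null_comparison)
      show "\<forall>\<^sub>F W in at Z. norm (norm (?f W - ?f Z - F (W - Z)) / norm (W - Z)) \<le> K * norm (W - Z)"
        using ev
      proof eventually_elim
        case (elim W)
        hence "norm (?f (Z + (W - Z)) - ?f Z - F (W - Z)) \<le> K * (norm (W - Z))\<^sup>2" by (intro quad) auto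
        thus ?case by (cases "W = Z") (simp_all add: field_simps power2_eq_square)
      qed
      have "((\<lambda>W. K * norm (W - Z)) \<longlongrightarrow> K * norm (Z - Z)) (at Z)" by (intro tendsto_intros)
      thus "((\<lambda>W. K * norm (W - Z)) \<longlongrightarrow> 0) (at Z)" by simp
    qed
  qed
qed

end

end

end

section \<open>Invariance under the generators\<close>

context quad_space
begin

section \<open>Lattices, and completing the square in one lattice variable\<close>

lemma lattice_zero: "lattice_of_rank smul m L \<Longrightarrow> 0 \<in> L"
  unfolding lattice_of_rank_def by (force intro: exI[of _ "\<lambda>_. 0 :: int"])

lemma lattice_add:
  assumes "lattice_of_rank smul m L" "x \<in> L" "y \<in> L"
  shows "x + y \<in> L"
proof -
  obtain S where L: "L = {\<Sum>v\<in>S. smul (of_int (c v)) v | c :: 'v \<Rightarrow> int. True}"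
    using assms(1) unfolding lattice_of_rank_def by blast
  obtain c d :: "'v \<Rightarrow> int" where "x = (\<Sum>v\<in>S. smul (of_int (c v)) v)" "y = (\<Sum>v\<in>S. smul (of_int (d v)) v)"
    using assms(2,3) unfolding L by blast
  hence "x + y = (\<Sum>v\<in>S. smul (of_int (c v + d v)) v)"
    by (simp add: scale_left_distrib sum.distrib)
  thus ?thesis unfolding L by (intro CollectI exI[of _ "\<lambda>v. c v + d v"]) simp
qed

lemma lattice_diff:
  assumes "lattice_of_rank smul m L" "x \<in> L" "y \<in> L"
  shows "x - y \<in> L"
proof -
  obtain S where L: "L = {\<Sum>v\<in>S. smul (of_int (c v)) v | c :: 'v \<Rightarrow> int. True}"
    using assms(1) unfolding lattice_of_rank_def by blast
  obtain c d :: "'v \<Rightarrow> int" where "x = (\<Sum>v\<in>S. smul (of_int (c v)) v)" "y = (\<Sum>v\<in>S. smul (of_int (d v)) v)"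
    using assms(2,3) unfolding L by blast
  hence "x - y = (\<Sum>v\<in>S. smul (of_int (c v - d v)) v)"
    by (simp add: scale_left_diff_distrib sum_subtractf)
  thus ?thesis unfolding L by (intro CollectI exI[of _ "\<lambda>v. c v - d v"]) simp
qed

text \<open>The product of the denominators of the coordinates clears all of them.\<close>

lemma lattice_multiple:
  assumes "lattice_of_rank smul m L"
  shows "\<exists>N::int>0. smul (of_int N) x \<in> L"
proof -
  obtain S where S: "finite S" "span S = UNIV" "L = {\<Sum>v\<in>S. smul (of_int (c v)) v | c :: 'v \<Rightarrow> int. True}"
    using assms unfolding lattice_of_rank_def by blast
  have "x \<in> span S" using S by simp
  then obtain u where u: "x = (\<Sum>v\<in>S. smul (u v) v)" unfolding span_finite[OF S(1)] by auto
  define den where "den v = snd (quotient_of (u v))" for v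
  define N where "N = (\<Prod>v\<in>S. den v)"
  have den_pos: "den v > 0" for v unfolding den_def by (rule quotient_of_denom_pos')
  have "\<exists>c. of_int N * u v = of_int c" if "v \<in> S" for v
  proof -
    have "u v = of_int (fst (quotient_of (u v))) / of_int (den v)"
      unfolding den_def by (rule quotient_of_div) simp
    hence "u v * of_int (den v) = of_int (fst (quotient_of (u v)))"
      using den_pos[of v] by (subst (asm) nonzero_eq_divide_eq) auto
    hence "of_int (den v) * u v = of_int (fst (quotient_of (u v)))" by (simp only: mult.commute)
    moreover have "N = (\<Prod>w\<in>S - {v}. den w) * den v"
      unfolding N_def using S(1) that by (simp add: prod.remove mult.commute)
    ultimately have "of_int N * u v = of_int ((\<Prod>w\<in>S - {v}. den w) * fst (quotient_of (u v)))"
      by (simp only: of_int_mult mult.assoc)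
    thus ?thesis by blast
  qed
  then obtain c where c: "\<And>v. v \<in> S \<Longrightarrow> of_int N * u v = of_int (c v)" by metis
  have "smul (of_int N) x = (\<Sum>v\<in>S. smul (of_int (c v)) v)"
    unfolding u scale_sum_right scale_scale by (rule sum.cong) (auto simp: c)
  hence "smul (of_int N) x \<in> L" unfolding S(3) by blast
  moreover have "N > 0" unfolding N_def using den_pos by (intro prod_pos) auto
  ultimately show ?thesis by blast
qed

text \<open>Orthogonalization takes place over the rationals and leaves the lattice; integral
  multiples of the resulting vectors return to it and stay orthogonal.\<close>

lemma orth_basis_in_lattice:
  assumes L: "lattice_of_rank smul m L"
  shows "\<exists>E. orth_basis E \<and> E \<subseteq> L"
proof -
  obtain S where S: "finite S" "span S = UNIV"
    using L unfolding lattice_of_rank_def by blast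
  obtain E where E: "orth_basis E" using gram_schmidt[OF S(1)] S(2) unfolding orth_basis_def by metis
  have "\<exists>N. \<forall>e. 0 < (N e :: int) \<and> smul (of_int (N e)) e \<in> L"
    using lattice_multiple[OF L] by metis
  then obtain N :: "'v \<Rightarrow> int" where N: "\<And>e. 0 < N e" "\<And>e. smul (of_int (N e)) e \<in> L" by blast
  have nz: "(of_int (N e) :: rat) \<noteq> 0" for e using N(1)[of e] by simp
  define F where "F = (\<lambda>e. smul (of_int (N e)) e) ` E"
  have "E \<subseteq> span F"
  proof
    fix e assume "e \<in> E"
    hence "smul (inverse (of_int (N e))) (smul (of_int (N e)) e) \<in> span F"
      by (intro span_scale span_base) (auto simp: F_def)
    thus "e \<in> span F" using nz by simp
  qed
  hence "span E \<subseteq> span F" by (intro span_minimal subspace_span)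
  hence "span F = UNIV" using E by (auto simp: orth_basis_def)
  moreover have "polar Q f f' = 0" if "f \<in> F" "f' \<in> F" "f \<noteq> f'" for f f'
  proof -
    obtain e e' where e: "e \<in> E" "e' \<in> E" "f = smul (of_int (N e)) e" "f' = smul (of_int (N e')) e'"
      using \<open>f \<in> F\<close> \<open>f' \<in> F\<close> by (auto simp: F_def)
    hence "polar Q e e' = 0" using \<open>f \<noteq> f'\<close> E by (auto simp: orth_basis_def)
    thus ?thesis by (simp add: e polar_scale_left polar_scale_right)
  qed
  moreover have "0 \<notin> F" using E nz by (auto simp: F_def orth_basis_def)
  moreover have "finite F" using E by (auto simp: F_def orth_basis_def)
  ultimately have "orth_basis F" by (auto simp: orth_basis_def)
  moreover have "F \<subseteq> L" using N(2) by (auto simp: F_def)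
  ultimately show ?thesis by blast
qed

lemma half_polar_add_left: "half_polar Q (x + y) z = half_polar Q x z + half_polar Q y z"
  by (simp add: half_polar_def polar_add_left add_divide_distrib)

lemma half_polar_add_right: "half_polar Q z (x + y) = half_polar Q z x + half_polar Q z y"
  by (simp add: half_polar_def polar_add_right add_divide_distrib)

text \<open>The exponent as a quadratic polynomial in the l-th entry u of the tuple. The two mixed
  terms agree by symmetry of Z, which turns the half polar form into the polar form in the linear
  part.\<close>

lemma tform_split:
  assumes y: "y l = 0" and Z: "transpose Z = Z"
  shows "tform (y(l := u)) Z = of_rat (Q u) * Z $ l $ l + (\<Sum>a\<in>UNIV. of_rat (polar Q u (y a)) * Z $ l $ a) + tform y Z"
proof -
  define d where "d a = (if a = l then u else 0)" for a
  have upd: "(y(l := u)) a = d a + y a" for a using y by (simp add: d_def)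
  have sym: "Z $ a $ b = Z $ b $ a" for a b using Z by (metis transpose_def vec_lambda_beta)
  have hp0: "half_polar Q 0 z = 0" "half_polar Q z 0 = 0" for z by (simp_all add: half_polar_def)
  have "tform (y(l := u)) Z =
      (\<Sum>a\<in>UNIV. \<Sum>b\<in>UNIV. of_rat (half_polar Q (d a) (d b)) * Z $ b $ a) +
      (\<Sum>a\<in>UNIV. \<Sum>b\<in>UNIV. of_rat (half_polar Q (d a) (y b)) * Z $ b $ a) +
      (\<Sum>a\<in>UNIV. \<Sum>b\<in>UNIV. of_rat (half_polar Q (y a) (d b)) * Z $ b $ a) + tform y Z"
    unfolding tform_def upd half_polar_add_left half_polar_add_right of_rat_add distrib_right sum.distrib
    by (simp add: add_ac)
  also have "(\<Sum>a\<in>UNIV. \<Sum>b\<in>UNIV. of_rat (half_polar Q (d a) (d b)) * Z $ b $ a) = of_rat (Q u) * Z $ l $ l"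
  proof -
    have "of_rat (half_polar Q (d a) (d b)) * Z $ b $ a = (if b = l then (if a = l then of_rat (Q u) * Z $ l $ l else 0) else 0)" for a b
      by (simp add: d_def hp0 half_polar_self)
    thus ?thesis by simp
  qed
  also have "(\<Sum>a\<in>UNIV. \<Sum>b\<in>UNIV. of_rat (half_polar Q (y a) (d b)) * Z $ b $ a) =
      (\<Sum>a\<in>UNIV. of_rat (half_polar Q u (y a)) * Z $ l $ a)"
  proof -
    have "of_rat (half_polar Q (y a) (d b)) * Z $ b $ a = (if b = l then of_rat (half_polar Q u (y a)) * Z $ l $ a else 0)" for a b
      by (simp add: d_def hp0 half_polar_sym[of "y a"])
    thus ?thesis by simp
  qed
  also have "(\<Sum>a\<in>UNIV. \<Sum>b\<in>UNIV. of_rat (half_polar Q (d a) (y b)) * Z $ b $ a) =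
      (\<Sum>a\<in>UNIV. of_rat (half_polar Q u (y a)) * Z $ l $ a)"
  proof (subst sum.swap)
    have "of_rat (half_polar Q (d b) (y a)) * Z $ a $ b = (if b = l then of_rat (half_polar Q u (y a)) * Z $ l $ a else 0)" for a b
      by (simp add: d_def hp0 sym[of a l])
    thus "(\<Sum>a\<in>UNIV. \<Sum>b\<in>UNIV. of_rat (half_polar Q (d b) (y a)) * Z $ a $ b) =
      (\<Sum>a\<in>UNIV. of_rat (half_polar Q u (y a)) * Z $ l $ a)" by simp
  qed
  also have "of_rat (Q u) * Z $ l $ l + (\<Sum>a\<in>UNIV. of_rat (half_polar Q u (y a)) * Z $ l $ a) +
      (\<Sum>a\<in>UNIV. of_rat (half_polar Q u (y a)) * Z $ l $ a) + tform y Z =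
    of_rat (Q u) * Z $ l $ l + (\<Sum>a\<in>UNIV. (of_rat (half_polar Q u (y a)) + of_rat (half_polar Q u (y a))) * Z $ l $ a) + tform y Z"
    by (simp only: distrib_right sum.distrib add.assoc)
  also have "(\<lambda>a. (of_rat (half_polar Q u (y a)) + of_rat (half_polar Q u (y a)) :: complex) * Z $ l $ a) =
      (\<lambda>a. of_rat (polar Q u (y a)) * Z $ l $ a)"
    unfolding of_rat_add[symmetric] by (simp add: half_polar_def)
  finally show ?thesis .
qed

text \<open>It recognizes the part of \<open>tform_split\<close> that depends on u as the exponent
  in Poisson summation: W is the complex combination of the other entries of the tuple, with row l
  of Z as coefficients.\<close>

lemma qexp_eq:
  assumes E: "orth_basis E"
  shows "qexp E z (\<lambda>e. \<Sum>a\<in>(UNIV::'n::finite set). c a * of_rat (coord e (y a))) u =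
    of_rat (Q u) * z + (\<Sum>a\<in>UNIV. of_rat (polar Q u (y a)) * c a)"
proof -
  have "(\<Sum>a\<in>(UNIV::'n set). of_rat (polar Q u (y a)) * c a) =
      (\<Sum>a\<in>UNIV. \<Sum>e\<in>E. of_rat (Q e) * (2 * of_rat (coord e u) * (c a * of_rat (coord e (y a)))))"
    by (simp add: polar_coord[OF E] of_rat_sum of_rat_mult sum_distrib_right sum_distrib_left mult_ac)
  also have "\<dots> = (\<Sum>e\<in>E. of_rat (Q e) * (2 * of_rat (coord e u) * (\<Sum>a\<in>UNIV. c a * of_rat (coord e (y a)))))"
    by (subst sum.swap) (simp add: sum_distrib_left)
  finally have 1: "(\<Sum>a\<in>(UNIV::'n set). of_rat (polar Q u (y a)) * c a) = \<dots>" .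
  have 2: "of_rat (Q u) * z = (\<Sum>e\<in>E. of_rat (Q e) * (z * (of_rat (coord e u))\<^sup>2))"
    by (subst Q_coord[OF E]) (simp add: of_rat_sum of_rat_mult of_rat_power sum_distrib_left mult_ac)
  show ?thesis unfolding qexp_def 1 2 by (simp add: sum.distrib[symmetric] distrib_left)
qed

text \<open>Expansion of the square on the dual side. Its three terms are those that will change the
  entry (l, l), the rest of row and column l, and the remaining entries of Z.\<close>

lemma qdual_eq:
  assumes E: "orth_basis E"
  shows "qdual E z (\<lambda>e. \<Sum>a\<in>(UNIV::'n::finite set). c a * of_rat (coord e (y a))) v =
    - of_rat (Q v) / z + (\<Sum>a\<in>UNIV. of_rat (polar Q v (y a)) * c a) / z
    - (\<Sum>a\<in>UNIV. \<Sum>b\<in>UNIV. of_rat (half_polar Q (y a) (y b)) * (c b * c a)) / z"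
proof -
  define W where "W e = (\<Sum>a\<in>(UNIV::'n set). c a * of_rat (coord e (y a)))" for e
  have 1: "(\<Sum>a\<in>(UNIV::'n set). of_rat (polar Q v (y a)) * c a) = (\<Sum>e\<in>E. of_rat (Q e) * (2 * of_rat (coord e v) * W e))"
  proof -
    have "qexp E 0 W v = (\<Sum>a\<in>(UNIV::'n set). of_rat (polar Q v (y a)) * c a)"
      unfolding W_def qexp_eq[OF E] by simp
    thus ?thesis by (simp add: qexp_def)
  qed
  have 2: "of_rat (Q v) = (\<Sum>e\<in>E. of_rat (Q e) * (of_rat (coord e v) :: complex)\<^sup>2)"
    by (subst Q_coord[OF E]) (simp add: of_rat_sum of_rat_mult of_rat_power)
  have "(\<Sum>a\<in>(UNIV::'n set). \<Sum>b\<in>(UNIV::'n set). of_rat (half_polar Q (y a) (y b)) * (c b * c a)) =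
     (\<Sum>a\<in>UNIV. \<Sum>b\<in>UNIV. \<Sum>e\<in>E. of_rat (Q e) * ((c a * of_rat (coord e (y a))) * (c b * of_rat (coord e (y b)))))"
    by (simp add: half_polar_coord[OF E] of_rat_sum of_rat_mult sum_distrib_right sum_distrib_left mult_ac)
  also have "\<dots> = (\<Sum>e\<in>E. \<Sum>a\<in>UNIV. \<Sum>b\<in>UNIV. of_rat (Q e) * ((c a * of_rat (coord e (y a))) * (c b * of_rat (coord e (y b)))))"
    by (subst sum.swap[of _ E], subst sum.swap[of _ E], rule refl)
  also have "\<dots> = (\<Sum>e\<in>E. of_rat (Q e) * (W e)\<^sup>2)"
    unfolding W_def power2_eq_square sum_product by (simp only: sum_distrib_left)
  finally have 3: "(\<Sum>a\<in>(UNIV::'n set). \<Sum>b\<in>(UNIV::'n set). of_rat (half_polar Q (y a) (y b)) * (c b * c a)) = \<dots>" .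
  have "(\<Sum>e\<in>E. of_rat (Q e) * (of_rat (coord e v) - W e)\<^sup>2) =
    of_rat (Q v) - (\<Sum>a\<in>(UNIV::'n set). of_rat (polar Q v (y a)) * c a) + (\<Sum>e\<in>E. of_rat (Q e) * (W e)\<^sup>2)"
    unfolding 1 2 sum_subtractf[symmetric] sum.distrib[symmetric]
    by (rule sum.cong) (auto simp: power2_eq_square algebra_simps)
  thus ?thesis unfolding 3 qdual_def W_def[symmetric] by (simp add: diff_divide_distrib add_divide_distrib)
qed

end

section \<open>Partial inversions of the hyperbolic planes\<close>

context divisor_chain
begin

text \<open>A quarter turn of plane l and the identity on the other planes. With the factor
  \<open>t l\<close> it sends \<open>bv (Inl l)\<close> to \<open>bv (Inr l)\<close> and
  \<open>bv (Inr l)\<close> to \<open>- bv (Inl l)\<close>.\<close>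

definition pinv :: "'n \<Rightarrow> rat^('n + 'n)^('n + 'n)" where
  "pinv l = block_mat (\<chi> a b. if a = b \<and> a \<noteq> l then 1 else 0) (\<chi> a b. if a = l \<and> b = l then - 1 / of_int (t l) else 0)
     (\<chi> a b. if a = l \<and> b = l then of_int (t l) else 0) (\<chi> a b. if a = b \<and> a \<noteq> l then 1 else 0)"

lemma pinv_Inl: "(pinv l *v x) $ Inl a = (if a = l then - x $ Inr l / of_int (t l) else x $ Inl a)"
proof -
  have "(if a = b \<and> a \<noteq> l then 1 else 0) * x $ Inl b = (if b = a then (if a \<noteq> l then x $ Inl a else 0) else 0)" for b
    by auto
  moreover have "(if a = l \<and> b = l then - 1 / of_int (t l) else 0) * x $ Inr b =
    (if b = l then (if a = l then - x $ Inr l / of_int (t l) else 0) else 0)" for b by auto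
  ultimately show ?thesis
    by (simp add: pinv_def block_mat_def matrix_vector_mult_def sum_UNIV_Plus)
qed

lemma pinv_Inr: "(pinv l *v x) $ Inr a = (if a = l then of_int (t l) * x $ Inl l else x $ Inr a)"
proof -
  have "(if a = b \<and> a \<noteq> l then 1 else 0) * x $ Inr b = (if b = a then (if a \<noteq> l then x $ Inr a else 0) else 0)" for b
    by auto
  moreover have "(if a = l \<and> b = l then of_int (t l) else 0) * x $ Inl b =
    (if b = l then (if a = l then of_int (t l) * x $ Inl l else 0) else 0)" for b by auto
  ultimately show ?thesis
    by (simp add: pinv_def block_mat_def matrix_vector_mult_def sum_UNIV_Plus)
qed

lemma pinv_symplectic: "pinv l \<in> symplectic_group"
  unfolding symplectic_iff_omega omega_def
  by (intro allI sum.cong) (auto simp: pinv_Inl pinv_Inr)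

text \<open>The fourth power is the identity, so the cube is the inverse.\<close>

lemma pinv_inverse: "\<exists>h\<in>symplectic_group. pinv l ** h = mat 1"
proof (intro bexI)
  let ?J = "pinv l"
  show "?J ** (?J ** ?J ** ?J) = mat 1"
  proof (subst matrix_eq, rule allI)
    fix x :: "rat^('n + 'n)"
    have "(?J *v (?J *v (?J *v (?J *v x)))) $ r = x $ r" for r
      by (cases r) (auto simp: pinv_Inl pinv_Inr)
    thus "?J ** (?J ** ?J ** ?J) *v x = mat 1 *v x"
      by (simp add: matrix_vector_mul_assoc[symmetric] vec_eq_iff)
  qed
  show "?J ** ?J ** ?J \<in> symplectic_group" by (intro symplectic_mult pinv_symplectic)
qed

lemma pinv_bv: "pinv l *v bv s = (if s = Inl l then bv (Inr l) else if s = Inr l then - bv (Inl l) else bv s)"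
proof -
  have "(pinv l *v bv s) $ r = (if s = Inl l then bv (Inr l) else if s = Inr l then - bv (Inl l) else bv s) $ r" for r
    by (cases r; cases s) (auto simp: pinv_Inl pinv_Inr bv_def axis_def)
  thus ?thesis by (simp add: vec_eq_iff)
qed

end

lemma transv_conj:
  assumes "g \<in> symplectic_group"
  shows "g ** transv c p q = transv c (g *v p) (g *v q) ** g"
  using assms
  by (subst matrix_eq)
     (simp add: matrix_vector_mul_assoc[symmetric] transv_apply matrix_vector_right_distrib vector_scalar_commute symplectic_iff_omega)

lemma semi_invariant_conj:
  assumes g: "g \<in> symplectic_group" "h \<in> symplectic_group" "g ** h = mat 1" "semi_invariant k f g c" "c \<noteq> 0"
    and pq: "omega p q = 0" "semi_invariant k f (transv d p q) 1"
  shows "semi_invariant k f (transv d (g *v p) (g *v q)) 1"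
proof -
  have T: "transv d p q \<in> symplectic_group" by (rule transv_symplectic[OF pq(1)])
  have "semi_invariant k f h (1 / c)"
    by (rule semi_invariant_cancel[OF g(1,2,4,5)]) (simp add: g(3) semi_invariant_1)
  hence "semi_invariant k f (g ** transv d p q ** h) (c * 1 * (1 / c))"
    by (intro semi_invariant_mult symplectic_mult g T pq)
  moreover have "g ** transv d p q ** h = transv d (g *v p) (g *v q)"
    unfolding transv_conj[OF g(1)] by (simp add: matrix_mul_assoc[symmetric] g(3))
  ultimately show ?thesis using g(5) by simp
qed

locale modular_lattices =
  quad_space smul Q + divisor_chain t
  for smul :: "rat \<Rightarrow> 'v::ab_group_add \<Rightarrow> 'v" and Q :: "'v \<Rightarrow> rat" and t :: "'n::{finite,linorder} \<Rightarrow> int" +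
  fixes m :: nat and L :: "'n \<Rightarrow> 'v set"
  assumes lat: "\<And>j. lattice_of_rank smul m (L j)"
    and mono: "\<And>i j. i \<le> j \<Longrightarrow> L j \<subseteq> L i"
    and even: "\<And>j. even_lattice Q (L j)"
    and modl: "\<And>j. modular_lattice smul Q (t j) (L j)"
    and scaled: "\<And>j. even (t j) \<Longrightarrow> even_lattice (\<lambda>x. Q x / of_int (t j)) (L j)"
    and t_one: "t (Min UNIV) = 1"
begin

section \<open>Divisibility on modular lattices and the translations\<close>

lemma dual_eq: "dual_lattice Q (L j) = smul (inverse (of_int (t j))) ` L j"
  using modl by (simp add: modular_lattice_def)

lemma polar_int: "x \<in> L j \<Longrightarrow> y \<in> L j \<Longrightarrow> polar Q x y \<in> \<int>"
  using even[of j] lattice_add[OF lat[of j], of x y] unfolding polar_def even_lattice_def by (intro Ints_diff) auto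

lemma polar_divisible:
  assumes "x \<in> L j" "y \<in> L j"
  shows "polar Q x y / of_int (t j) \<in> \<int>"
proof -
  have "smul (inverse (of_int (t j))) x \<in> dual_lattice Q (L j)" using assms dual_eq by blast
  thus ?thesis using assms(2) by (auto simp: dual_lattice_def polar_scale_left field_simps)
qed

text \<open>For odd \<open>t j\<close> the polar form of x with itself, \<open>2 * Q x\<close>, is
  divisible by \<open>t j\<close>, and the 2 cancels. For even \<open>t j\<close> this is the
  content of \<open>scaled\<close>.\<close>

lemma Q_divisible:
  assumes "x \<in> L j"
  shows "Q x / of_int (t j) \<in> \<int>"
proof (cases "even (t j)")
  case True
  thus ?thesis using scaled[OF True] assms by (auto simp: even_lattice_def)
next
  case False
  obtain q where q: "Q x = of_int q" using even[of j] assms by (auto simp: even_lattice_def elim: Ints_cases)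
  obtain p where "polar Q x x / of_int (t j) = of_int p" using polar_divisible[OF assms assms] by (auto elim: Ints_cases)
  hence "2 * (of_int q :: rat) = of_int p * of_int (t j)" using t_nz[of j] by (simp add: polar_self q field_simps)
  hence "2 * q = p * t j" by (metis of_int_eq_iff of_int_mult of_int_numeral)
  hence "t j dvd 2 * q" by simp
  hence "t j dvd q" using False by (metis coprime_dvd_mult_right_iff coprime_right_2_iff_odd)
  thus ?thesis using t_nz[of j] by (auto simp: q dvd_def)
qed

text \<open>A basis inside the smallest lattice, the last one of the chain, lies in all of
  them.\<close>

lemma basis_exists: "\<exists>E. orth_basis E \<and> (\<forall>j. E \<subseteq> L j)"
  using orth_basis_in_lattice[OF lat[of "Max UNIV"]] mono[of _ "Max UNIV"] by (meson Max_ge UNIV_I finite order_trans)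

definition tuples :: "('n \<Rightarrow> 'v) set" where
  "tuples = {x. \<forall>i. x i \<in> L i}"

lemma theta_tuples: "theta Q L Z = (\<Sum>\<^sub>\<infinity>x\<in>tuples. fexp (tform x Z))"
  unfolding theta_eq tuples_def ..

lemma tuples_subset: "\<forall>j. E \<subseteq> L j \<Longrightarrow> tuples \<subseteq> {x. \<forall>i. \<forall>e\<in>E. polar Q (x i) e \<in> \<int>}"
  by (auto simp: tuples_def intro!: polar_int)

lemma semi_invariant_transl:
  assumes g: "blk11 g = mat 1" "blk21 g = 0" "blk22 g = mat 1"
    and int: "\<And>x. x \<in> tuples \<Longrightarrow> (\<Sum>a\<in>UNIV. \<Sum>b\<in>UNIV. half_polar Q (x a) (x b) * blk12 g $ b $ a) \<in> \<int>"
  shows "semi_invariant k (theta Q L) g 1"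
  unfolding semi_invariant_def
proof
  fix Z :: "complex^('n::{finite,linorder})^('n::{finite,linorder})"
  have d: "den g Z = mat 1"
    by (simp add: den_def cblk_def g map_mat_of_rat_0 map_mat_of_rat_1)
  have "num g Z = Z + cblk blk12 g" by (simp add: num_def cblk_def g map_mat_of_rat_1)
  hence mo: "moeb g Z = Z + cblk blk12 g"
    using matrix_inv_unique[of "mat 1 :: complex^('n::{finite,linorder})^('n::{finite,linorder})" "mat 1"] by (simp add: moeb_def d)
  have "fexp (tform x (Z + cblk blk12 g)) = fexp (tform x Z)" if "x \<in> tuples" for x
  proof -
    have "tform x (cblk blk12 g) = of_rat (\<Sum>a\<in>UNIV. \<Sum>b\<in>UNIV. half_polar Q (x a) (x b) * blk12 g $ b $ a)"
      by (simp add: tform_def cblk_def map_mat_def of_rat_sum of_rat_mult)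
    hence "fexp (tform x (cblk blk12 g)) = 1" using int[OF that] by (intro fexp_Ints) (auto intro: of_rat_Ints)
    thus ?thesis by (simp add: tform_add fexp_add)
  qed
  hence "theta Q L (moeb g Z) = theta Q L Z" unfolding mo theta_tuples by (intro infsum_cong)
  thus "det (den g Z) powi (- k) * theta Q L (moeb g Z) = 1 * theta Q L Z" by (simp add: d det_I)
qed

text \<open>For two vectors of the Lagrangian half spanned by the \<open>bv (Inl j)\<close> the map
  is a translation of Z by \<open>- c\<close> times the symmetrized matrix unit at (i, l), which for
  i = l has the entry 2.\<close>

lemma transv_blocks:
  "transv c (bv (Inl i)) (bv (Inl l)) =
    block_mat (mat 1) (\<chi> a b. - c * (if b = i \<and> a = l then 1 else 0) - c * (if b = l \<and> a = i then 1 else 0)) 0 (mat 1)"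
proof -
  have ent: "M $ r $ s = (M *v axis s 1) $ r" for M :: "rat^('n + 'n)^('n + 'n)" and r s
    by (simp add: matrix_vector_mult_def axis_def if_distrib sum.If_cases cong: if_cong)
  have bvc: "bv (Inl j) $ r = (if r = Inl j then 1 else 0)" for j r
    by (simp add: bv_def axis_def)
  have om: "omega (axis s 1) (bv (Inl j)) = (if s = Inr j then - 1 else 0)" for s j
    by (cases s) (simp_all add: omega_axis_left_Inl omega_axis_left_Inr bvc)
  have "transv c (bv (Inl i)) (bv (Inl l)) $ r $ s = (if r = s then 1 else 0) +
      c * (if s = Inr i then - 1 else 0) * (if r = Inl l then 1 else 0) +
      c * (if s = Inr l then - 1 else 0) * (if r = Inl i then 1 else 0)" for r s
    by (subst ent) (simp add: transv_apply om bvc, simp add: axis_def)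
  thus ?thesis
    by (simp add: vec_eq_iff block_mat_def mat_def split: sum.split)
qed

lemma semi_invariant_transv:
  assumes int: "\<And>x. x \<in> tuples \<Longrightarrow> c * polar Q (x i) (x l) \<in> \<int>"
  shows "semi_invariant k (theta Q L) (transv c (bv (Inl i)) (bv (Inl l))) 1"
proof (rule semi_invariant_transl)
  fix x assume x: "x \<in> tuples"
  have "(\<Sum>a\<in>UNIV. \<Sum>b\<in>UNIV. half_polar Q (x a) (x b) * blk12 (transv c (bv (Inl i)) (bv (Inl l))) $ b $ a) =
    (\<Sum>a\<in>UNIV. \<Sum>b\<in>UNIV. (if b = l then (if a = i then - c * half_polar Q (x i) (x l) else 0) else 0) +
       (if b = i then (if a = l then - c * half_polar Q (x l) (x i) else 0) else 0))"
  proof (intro sum.cong refl)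
    fix a b
    have B: "blk12 (transv c (bv (Inl i)) (bv (Inl l))) $ b $ a =
        - c * (if a = i \<and> b = l then 1 else 0) - c * (if a = l \<and> b = i then 1 else 0)"
      by (simp add: transv_blocks)
    show "half_polar Q (x a) (x b) * blk12 (transv c (bv (Inl i)) (bv (Inl l))) $ b $ a =
      (if b = l then (if a = i then - c * half_polar Q (x i) (x l) else 0) else 0) +
       (if b = i then (if a = l then - c * half_polar Q (x l) (x i) else 0) else 0)"
      unfolding B by (cases "a = i"; cases "b = l"; cases "a = l"; cases "b = i") (simp_all add: algebra_simps)
  qed
  also have "\<dots> = - (c * polar Q (x i) (x l))"
    by (simp add: sum.distrib half_polar_def polar_sym[of "x l"])
  finally show "(\<Sum>a\<in>UNIV. \<Sum>b\<in>UNIV. half_polar Q (x a) (x b) * blk12 (transv c (bv (Inl i)) (bv (Inl l))) $ b $ a) \<in> \<int>"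
    using int[OF x] by simp
qed (simp_all add: transv_blocks)

text \<open>The four sign-free combinations of \<open>Inl\<close>, \<open>Inr\<close> in planes i
  and l arise from the translation by conjugation with \<open>pinv i\<close>, \<open>pinv l\<close>,
  or both. For the translation itself the inclusion of \<open>L l\<close> in \<open>L i\<close>
  matters: both entries then lie in \<open>L i\<close>, where \<open>t i\<close> divides the polar
  form.\<close>

lemma semi_invariant_gens:
  assumes pinv: "\<And>l. \<exists>c. c \<noteq> 0 \<and> semi_invariant k (theta Q L) (pinv l) c"
    and a: "a \<in> gens i"
  shows "semi_invariant k (theta Q L) a 1"
proof -
  have conj: "semi_invariant k (theta Q L) (transv d (pinv l *v p) (pinv l *v q)) 1"
    if "semi_invariant k (theta Q L) (transv d p q) 1" "omega p q = 0" for d p q l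
    using pinv_inverse[of l] pinv[of l] pinv_symplectic[of l] that semi_invariant_conj by metis
  show ?thesis using a
  proof cases
    case (mixed s s' n)
    define l where "l = idx s'"
    have il: "i < l" "l \<noteq> i" using mixed by (auto simp: l_def)
    have base: "semi_invariant k (theta Q L) (transv (of_int n / of_int (t i)) (bv (Inl i)) (bv (Inl l))) 1"
    proof (rule semi_invariant_transv)
      fix x assume "x \<in> tuples"
      hence "x i \<in> L i" "x l \<in> L l" by (auto simp: tuples_def)
      hence "x i \<in> L i" "x l \<in> L i" using mono[OF less_imp_le[OF il(1)]] by auto
      hence "of_int n * (polar Q (x i) (x l) / of_int (t i)) \<in> \<int>" by (intro Ints_mult polar_divisible) auto
      thus "of_int n / of_int (t i) * polar Q (x i) (x l) \<in> \<int>" by simp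
    qed
    have fi: "semi_invariant k (theta Q L) (transv (of_int n / of_int (t i)) (bv (Inr i)) (bv (Inl l))) 1"
      using conj[OF base, of i] il by (simp add: pinv_bv omega_bv_bv)
    have "s = Inl i \<or> s = Inr i" "s' = Inl l \<or> s' = Inr l" using mixed idx_cases by (auto simp: l_def)
    thus ?thesis
      using base fi conj[OF base, of l] conj[OF fi, of l] il unfolding mixed(1)
      by (auto simp: pinv_bv omega_bv_bv)
  next
    case (plane s n)
    have base: "semi_invariant k (theta Q L) (transv (of_int n / (2 * of_int (t i))) (bv (Inl i)) (bv (Inl i))) 1"
    proof (rule semi_invariant_transv)
      fix x assume "x \<in> tuples"
      hence "of_int n * (Q (x i) / of_int (t i)) \<in> \<int>" by (intro Ints_mult Q_divisible) (auto simp: tuples_def)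
      thus "of_int n / (2 * of_int (t i)) * polar Q (x i) (x i) \<in> \<int>" by (simp add: polar_self)
    qed
    have "s = Inl i \<or> s = Inr i" using plane idx_cases by auto
    thus ?thesis using base conj[OF base, of i] unfolding plane(1) by (auto simp: pinv_bv omega_bv_bv)
  qed
qed

end

section \<open>The action of a partial inversion in closed form\<close>

context divisor_chain
begin

text \<open>The image of Z under \<open>pinv l\<close>, as \<open>moeb_pinv\<close> confirms. Away
  from row and column l it is the Schur complement of the entry \<open>Z $ l $ l\<close>.\<close>

definition invZ :: "'n \<Rightarrow> complex^('n::{finite,linorder})^('n::{finite,linorder}) \<Rightarrow> complex^('n::{finite,linorder})^('n::{finite,linorder})" where
  "invZ l Z = (\<chi> a b. if a = l \<and> b = l then - 1 / ((of_int (t l))\<^sup>2 * Z $ l $ l)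
     else if a = l then Z $ l $ b / (of_int (t l) * Z $ l $ l)
     else if b = l then Z $ a $ l / (of_int (t l) * Z $ l $ l)
     else Z $ a $ b - Z $ a $ l * Z $ l $ b / Z $ l $ l)"

lemma den_pinv: "den (pinv l) Z $ a $ b = (if a = l then of_int (t l) * Z $ l $ b else if a = b then 1 else 0)"
proof -
  have "of_rat (if a = l \<and> k = l then of_int (t l) else 0) * Z $ k $ b =
      (if k = l then (if a = l then of_int (t l) * Z $ l $ b else 0) else (0::complex))" for k
    by auto
  thus ?thesis
    by (simp add: den_def cblk_def pinv_def map_mat_def matrix_matrix_mult_def)
qed

lemma num_pinv: "num (pinv l) Z $ a $ b = (if a = l then (if b = l then - 1 / of_int (t l) else 0) else Z $ a $ b)"
proof -
  have "of_rat (if a = k \<and> a \<noteq> l then 1 else 0) * Z $ k $ b =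
      (if k = a then (if a \<noteq> l then Z $ a $ b else 0) else (0::complex))" for k
    by auto
  thus ?thesis
    by (simp add: num_def cblk_def pinv_def map_mat_def matrix_matrix_mult_def of_rat_divide of_rat_minus)
qed

text \<open>The denominator is the identity matrix with row l replaced, so Cramer's rule gives the
  determinant.\<close>

lemma det_den_pinv: "det (den (pinv l) Z) = of_int (t l) * Z $ l $ l"
proof -
  define x where "x = (\<chi> b. of_int (t l) * Z $ l $ b)"
  have "(\<Sum>i\<in>UNIV. x $ i *s row i (mat 1)) = x"
    by (simp add: vec_eq_iff row_def mat_def if_distrib sum.If_cases cong: if_cong)
  hence "den (pinv l) Z = (\<chi> i. if i = l then (\<Sum>i\<in>UNIV. x $ i *s row i (mat 1)) else row i (mat 1))"
    by (simp add: vec_eq_iff den_pinv) (simp add: x_def row_def mat_def)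
  thus ?thesis using cramer_lemma_transpose[of l x "mat 1"] by (simp add: x_def)
qed

lemma siegel_diag:
  assumes "(Z :: complex^('n::{finite,linorder})^('n::{finite,linorder})) \<in> siegel_upper_half"
  shows "Im (Z $ l $ l) > 0"
proof -
  have "axis l (1::real) \<noteq> 0" by (simp add: axis_eq_0_iff)
  hence "0 < axis l 1 \<bullet> (map_mat Im Z *v axis l 1)" using assms by (simp add: siegel_upper_half_def)
  thus ?thesis by (simp add: inner_axis' matrix_vector_mul_component map_mat_def inner_axis)
qed

lemma moeb_pinv:
  assumes Z: "(Z :: complex^('n::{finite,linorder})^('n::{finite,linorder})) \<in> siegel_upper_half"
  shows "moeb (pinv l) Z = invZ l Z"
proof -
  have nz: "Z $ l $ l \<noteq> 0" using siegel_diag[OF Z, of l] by auto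
  have "(invZ l Z ** den (pinv l) Z) $ a $ b = num (pinv l) Z $ a $ b" for a b
  proof -
    have "(invZ l Z ** den (pinv l) Z) $ a $ b =
       (\<Sum>k\<in>UNIV. (if k = b then (if b = l then 0 else invZ l Z $ a $ b) else 0) +
          (if k = l then invZ l Z $ a $ l * (of_int (t l) * Z $ l $ b) else 0))"
      unfolding matrix_matrix_mult_def vec_lambda_beta
      by (intro sum.cong) (auto simp: den_pinv)
    also have "\<dots> = (if b = l then 0 else invZ l Z $ a $ b) + invZ l Z $ a $ l * (of_int (t l) * Z $ l $ b)"
      by (simp add: sum.distrib)
    also have "\<dots> = num (pinv l) Z $ a $ b"
      using nz by (simp add: num_pinv invZ_def power2_eq_square)
    finally show ?thesis .
  qed
  hence "invZ l Z ** den (pinv l) Z = num (pinv l) Z" by (simp add: vec_eq_iff)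
  hence "moeb (pinv l) Z = invZ l Z ** (den (pinv l) Z ** matrix_inv (den (pinv l) Z))"
    unfolding moeb_def by (simp add: matrix_mul_assoc)
  thus ?thesis
    using matrix_inv_right[OF den_invertible[OF pinv_symplectic Z], of l] by simp
qed

end

section \<open>Poisson summation in one variable of the theta series\<close>

context modular_lattices
begin

text \<open>Modularity turns the sum over the dual lattice back into a sum over the lattice itself,
  at the price of the factor \<open>1 / t l\<close> in the argument.\<close>

lemma poisson_L:
  assumes E: "orth_basis E" "\<forall>j. E \<subseteq> L j"
  shows "\<exists>K>0. \<forall>\<tau> W. Im \<tau> > 0 \<longrightarrow>
    (\<Sum>\<^sub>\<infinity>x\<in>L l. fexp (qexp E \<tau> W x)) =
    of_real K / csqrt (- \<i> * \<tau>) ^ m *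
      (\<Sum>\<^sub>\<infinity>u\<in>L l. fexp (qdual E \<tau> W (smul (inverse (of_int (t l))) u)))"
proof -
  have "inj_on (smul (inverse (of_int (t l)))) (L l)"
    using t_nz[of l] by (intro inj_onI) (simp add: scale_left_imp_eq)
  hence "(\<Sum>\<^sub>\<infinity>y\<in>dual_lattice Q (L l). f y) = (\<Sum>\<^sub>\<infinity>u\<in>L l. f (smul (inverse (of_int (t l))) u))" for f :: "'v \<Rightarrow> complex"
    unfolding dual_eq by (subst infsum_reindex) (auto simp: o_def)
  moreover have "\<exists>K>0. \<forall>\<tau> W. Im \<tau> > 0 \<longrightarrow> (\<Sum>\<^sub>\<infinity>x\<in>L l. fexp (qexp E \<tau> W x)) =
    of_real K / csqrt (- \<i> * \<tau>) ^ card E * (\<Sum>\<^sub>\<infinity>y\<in>dual_lattice Q (L l). fexp (qdual E \<tau> W y))"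
    using E lat[of l]
    by (intro lattice_poisson lattice_zero[OF lat[of l]] lattice_add[OF lat[of l]] lattice_diff[OF lat[of l]])
       (auto intro: polar_int)
  ultimately show ?thesis unfolding card_orth_basis[OF E(1) lat[of l]] by simp
qed

text \<open>The theta series f of the unimodular lattice satisfies
  \<open>f (- 1 / \<tau> + 1) = s \<tau> ^ m * f \<tau>\<close>. Reaching one point of the half
  plane from \<i> by two different chains of translations and inversions compares two values of the
  automorphy factor.\<close>

lemma rank_even: "even m"
proof -
  obtain E where E: "orth_basis E" "\<forall>j. E \<subseteq> L j" using basis_exists by blast
  define M where "M = L (Min UNIV)"
  define f where "f \<tau> = (\<Sum>\<^sub>\<infinity>x\<in>M. fexp (of_rat (Q x) * \<tau>))" for \<tau>
  define s where "s \<tau> = csqrt (- \<i> * \<tau>)" for \<tau> :: complex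
  have qe: "qexp E \<tau> (\<lambda>_. 0) x = of_rat (Q x) * \<tau>" for \<tau> x
    using qexp_eq[OF E(1), of \<tau> "\<lambda>_::'n. 0" "\<lambda>_. 0" x] by simp
  have qd: "qdual E \<tau> (\<lambda>_. 0) x = of_rat (Q x) * (- 1 / \<tau>)" for \<tau> x
    using qdual_eq[OF E(1), of \<tau> "\<lambda>_::'n. 0" "\<lambda>_. 0" x] by simp
  obtain K where K: "K > 0" "\<And>\<tau>. Im \<tau> > 0 \<Longrightarrow> f \<tau> = of_real K / s \<tau> ^ m * f (- 1 / \<tau>)"
  proof -
    obtain K where K: "K > 0" "\<And>\<tau> W. Im \<tau> > 0 \<Longrightarrow>
      (\<Sum>\<^sub>\<infinity>x\<in>M. fexp (qexp E \<tau> W x)) = of_real K / csqrt (- \<i> * \<tau>) ^ m *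
        (\<Sum>\<^sub>\<infinity>u\<in>M. fexp (qdual E \<tau> W (smul (inverse (of_int (t (Min UNIV)))) u)))"
      using poisson_L[OF E, of "Min UNIV"] unfolding M_def by blast
    show ?thesis
    proof (rule that[OF K(1)])
      show "f \<tau> = of_real K / s \<tau> ^ m * f (- 1 / \<tau>)" if "Im \<tau> > 0" for \<tau>
        using K(2)[OF that, of "\<lambda>_. 0"] unfolding qe qd t_one f_def s_def by simp
    qed
  qed
  have per: "f (\<tau> + 1) = f \<tau>" for \<tau>
    unfolding f_def
  proof (rule infsum_cong)
    fix x assume "x \<in> M"
    hence "Q x \<in> \<int>" using even[of "Min UNIV"] by (auto simp: M_def even_lattice_def)
    hence "fexp (of_rat (Q x)) = 1" by (intro fexp_Ints of_rat_Ints)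
    thus "fexp (of_rat (Q x) * (\<tau> + 1)) = fexp (of_rat (Q x) * \<tau>)" by (simp add: distrib_left fexp_add)
  qed
  have sq: "s \<tau> ^ 2 = - \<i> * \<tau>" for \<tau> by (simp add: s_def)
  have si: "s \<i> = 1" by (simp add: s_def)
  have nz: "f \<i> \<noteq> 0"
  proof -
    have "M \<subseteq> dual_span E" using E polar_int[of _ "Min UNIV"] by (force simp: M_def)
    hence sm: "(\<lambda>x. norm (fexp (of_rat (Q x) * \<i>))) summable_on M"
      using qexp_summable[OF E(1), of \<i> "\<lambda>_. 0"] summable_on_subset_banach unfolding qe by fastforce
    have pos: "fexp (of_rat (Q x) * \<i>) = of_real (norm (fexp (of_rat (Q x) * \<i>)))" for x
    proof -
      have "fexp (of_real r * \<i>) = of_real (norm (fexp (of_real r * \<i>)))" for r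
      proof -
        have "fexp (of_real r * \<i>) = exp (of_real (- 2 * pi * r))" by (simp add: fexp_def mult_ac)
        thus ?thesis by (simp add: norm_fexp exp_of_real[symmetric])
      qed
      thus ?thesis by (simp only: of_real_of_rat[symmetric])
    qed
    have "f \<i> = of_real (\<Sum>\<^sub>\<infinity>x\<in>M. norm (fexp (of_rat (Q x) * \<i>)))"
      unfolding f_def by (subst pos, rule infsumI, rule has_sum_of_real, rule has_sum_infsum[OF sm])
    moreover have "(\<Sum>x\<in>{0}. norm (fexp (of_rat (Q x) * \<i>))) \<le> (\<Sum>\<^sub>\<infinity>x\<in>M. norm (fexp (of_rat (Q x) * \<i>)))"
      using lattice_zero[OF lat] by (intro finite_sum_le_infsum sm) (auto simp: M_def)
    ultimately show ?thesis by auto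
  qed
  \<comment> \<open>The inversion fixes \<i>, where the root s is 1 and f is nonzero: all terms are
    positive there, and the zero vector contributes 1.\<close>
  have K1: "K = 1"
  proof -
    have "f \<i> = of_real K * f \<i>" using K(2)[of \<i>] by (simp add: si)
    thus ?thesis using nz by simp
  qed
  have step: "f (- 1 / \<tau> + 1) = s \<tau> ^ m * f \<tau>" if "Im \<tau> > 0" for \<tau>
  proof -
    have "s \<tau> \<noteq> 0" using that by (auto simp: s_def)
    thus ?thesis unfolding per using K(2)[OF that] by (simp add: K1)
  qed
  have a: "f (1 + \<i>) = f \<i>" using per[of \<i>] by (simp add: add.commute)
  have b: "f (- 1 + \<i>) = f \<i>" using per[of "- 1 + \<i>"] by simp
  \<comment> \<open>The two chains: from 1 + \<i> by inversion and a unit translation, and from -1 +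
    \<i> by inversion alone. Both starting points are integral translates of \<i>.\<close>
  have P: "- 1 / (1 + \<i>) + 1 = (1 + \<i>) / 2" and R: "- 1 / (- 1 + \<i>) = (1 + \<i>) / 2"
    by (simp_all add: complex_eq_iff Re_divide Im_divide power2_eq_square)
  have "f ((1 + \<i>) / 2) = s (1 + \<i>) ^ m * f \<i>"
    using step[of "1 + \<i>"] unfolding P a by simp
  moreover have "f ((1 + \<i>) / 2) = s (- 1 + \<i>) ^ m * f \<i>"
    using step[of "- 1 + \<i>"] unfolding R per b by simp
  ultimately have "s (1 + \<i>) ^ m * f \<i> = s (- 1 + \<i>) ^ m * f \<i>" by (rule trans[OF sym])
  hence "s (1 + \<i>) ^ m = s (- 1 + \<i>) ^ m" using nz by simp
  \<comment> \<open>Squaring removes the two square roots, so no branch has to be evaluated.\<close>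
  hence "(s (1 + \<i>) ^ 2) ^ m = (s (- 1 + \<i>) ^ 2) ^ m" by (metis power_mult mult.commute)
  hence e: "(1 - \<i>) ^ m = (1 + \<i>) ^ m" unfolding sq by (simp add: algebra_simps)
  have "1 + \<i> = \<i> * (1 - \<i>)" by (simp add: algebra_simps)
  hence "(1 - \<i>) ^ m = \<i> ^ m * (1 - \<i>) ^ m" using e by (simp add: power_mult_distrib)
  moreover have "1 - \<i> \<noteq> 0" by (simp add: complex_eq_iff)
  ultimately have im: "\<i> ^ m = 1" by simp
  show "even m"
  proof (rule ccontr)
    assume "odd m"
    then obtain n where "m = 2 * n + 1" by (auto elim: oddE)
    hence "\<i> ^ m = (- 1) ^ n * \<i>" by (simp add: power_mult)
    hence "Re (\<i> ^ m) = 0" by (cases "even n") auto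
    thus False using im by simp
  qed
qed

text \<open>With the other entries of the tuple fixed, the sum over the l-th entry is a Gaussian sum
  with parameter \<open>Z $ l $ l\<close>. The dual exponent, with argument \<open>u / t l\<close>,
  together with the part of the exponent free of u, reassembles into the exponent at the inverted
  matrix.\<close>

lemma theta_pinv:
  "\<exists>K>0. \<forall>Z\<in>siegel_upper_half. theta Q L Z = of_real K / csqrt (- \<i> * Z $ l $ l) ^ m * theta Q L (moeb (pinv l) Z)"
proof -
  obtain E where E: "orth_basis E" "\<forall>j. E \<subseteq> L j" using basis_exists by blast
  obtain K where K: "K > 0" "\<And>\<tau> W. Im \<tau> > 0 \<Longrightarrow>
    (\<Sum>\<^sub>\<infinity>x\<in>L l. fexp (qexp E \<tau> W x)) = of_real K / csqrt (- \<i> * \<tau>) ^ m *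
      (\<Sum>\<^sub>\<infinity>u\<in>L l. fexp (qdual E \<tau> W (smul (inverse (of_int (t l))) u)))"
    using poisson_L[OF E, of l] by blast
  \<comment> \<open>Tuples with the l-th slot emptied; the value 0 there makes the slot contribute
    nothing to \<open>tform y\<close>.\<close>
  define Y where "Y = {y. y l = 0 \<and> (\<forall>i. i \<noteq> l \<longrightarrow> y i \<in> L i)}"
  have bij: "bij_betw (\<lambda>(y, u). y(l := u)) (Y \<times> L l) tuples"
    by (rule bij_betw_byWitness[where f' = "\<lambda>x. (x(l := 0), x l)"]) (auto simp: Y_def tuples_def)
  have split: "theta Q L Z = (\<Sum>\<^sub>\<infinity>y\<in>Y. \<Sum>\<^sub>\<infinity>u\<in>L l. fexp (tform (y(l := u)) Z))"
    if "Z \<in> siegel_upper_half" for Z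
  proof -
    have sum: "(\<lambda>x. fexp (tform x Z)) summable_on tuples"
      by (rule abs_summable_summable[OF theta_abs_summable[OF E(1) tuples_subset[OF E(2)] that]])
    have "theta Q L Z = (\<Sum>\<^sub>\<infinity>(y, u)\<in>Y \<times> L l. fexp (tform (y(l := u)) Z))"
      unfolding theta_tuples by (subst infsum_reindex_bij_betw[OF bij, symmetric]) (simp add: case_prod_unfold)
    also have "\<dots> = (\<Sum>\<^sub>\<infinity>y\<in>Y. \<Sum>\<^sub>\<infinity>u\<in>L l. fexp (tform (y(l := u)) Z))"
    proof (rule infsum_Sigma'_banach[symmetric])
      show "(\<lambda>(y, u). fexp (tform (y(l := u)) Z)) summable_on Y \<times> L l"
        using sum by (subst (asm) summable_on_reindex_bij_betw[OF bij, symmetric]) (simp add: case_prod_unfold)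
    qed
    finally show ?thesis .
  qed
  have "theta Q L Z = of_real K / csqrt (- \<i> * Z $ l $ l) ^ m * theta Q L (moeb (pinv l) Z)"
    if Z: "Z \<in> siegel_upper_half" for Z
  proof -
    define z where "z = Z $ l $ l"
    have z: "Im z > 0" unfolding z_def by (rule siegel_diag[OF Z])
    hence znz: "z \<noteq> 0" by auto
    define Z' where "Z' = invZ l Z"
    have Z'm: "moeb (pinv l) Z = Z'" unfolding Z'_def by (rule moeb_pinv[OF Z])
    have Z'H: "Z' \<in> siegel_upper_half" using moeb_in_siegel[OF pinv_symplectic Z, of l] by (simp add: Z'm)
    have symZ: "transpose Z = Z" "transpose Z' = Z'" using Z Z'H by (auto simp: siegel_upper_half_def)
    have Zs: "Z $ a $ b = Z $ b $ a" for a b using symZ(1) by (metis transpose_def vec_lambda_beta)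
    have inner: "(\<Sum>\<^sub>\<infinity>u\<in>L l. fexp (tform (y(l := u)) Z)) =
       of_real K / csqrt (- \<i> * z) ^ m * (\<Sum>\<^sub>\<infinity>u\<in>L l. fexp (tform (y(l := u)) Z'))" if "y \<in> Y" for y
    proof -
      have y: "y l = 0" using that by (simp add: Y_def)
      define W where "W = (\<lambda>e. \<Sum>a\<in>UNIV. Z $ l $ a * of_rat (coord e (y a)))"
      have 1: "tform (y(l := u)) Z = tform y Z + qexp E z W u" for u
        unfolding tform_split[where y = y, OF y symZ(1)] W_def qexp_eq[OF E(1)] z_def by simp
      have 2: "tform y Z + qdual E z W (smul (inverse (of_int (t l))) u) = tform (y(l := u)) Z'" for u
      proof -
        define r where "r = (of_int (t l) :: complex)"
        have r: "r \<noteq> 0" by (simp add: r_def)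
        have A: "- of_rat (Q (smul (inverse (of_int (t l))) u)) / z = of_rat (Q u) * Z' $ l $ l"
          using r znz by (simp add: Q_scale of_rat_mult of_rat_power of_rat_inverse of_rat_divide Z'_def invZ_def z_def[symmetric] r_def[symmetric] field_simps)
        have B: "(\<Sum>a\<in>UNIV. of_rat (polar Q (smul (inverse (of_int (t l))) u) (y a)) * Z $ l $ a) / z =
           (\<Sum>a\<in>UNIV. of_rat (polar Q u (y a)) * Z' $ l $ a)"
          unfolding sum_divide_distrib
        proof (rule sum.cong)
          fix a
          show "of_rat (polar Q (smul (inverse (of_int (t l))) u) (y a)) * Z $ l $ a / z = of_rat (polar Q u (y a)) * Z' $ l $ a"
            by (cases "a = l")
               (simp_all add: y polar_scale_left of_rat_mult of_rat_inverse of_rat_divide Z'_def invZ_def z_def[symmetric] r_def[symmetric] field_simps)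
        qed simp
        \<comment> \<open>The correction from completing the square is exactly the one in the Schur
          complement. Entries in row or column l are irrelevant because
          \<open>y l = 0\<close>.\<close>
        have C: "tform y Z - (\<Sum>a\<in>UNIV. \<Sum>b\<in>UNIV. of_rat (half_polar Q (y a) (y b)) * (Z $ l $ b * Z $ l $ a)) / z = tform y Z'"
          unfolding tform_def sum_divide_distrib sum_subtractf[symmetric]
        proof (intro sum.cong refl)
          fix a b
          show "of_rat (half_polar Q (y a) (y b)) * Z $ b $ a - of_rat (half_polar Q (y a) (y b)) * (Z $ l $ b * Z $ l $ a) / z =
            of_rat (half_polar Q (y a) (y b)) * Z' $ b $ a"
          proof (cases "a = l \<or> b = l")
            case True
            hence "half_polar Q (y a) (y b) = 0" by (auto simp: y half_polar_def)
            thus ?thesis by simp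
          next
            case False
            thus ?thesis by (simp add: Z'_def invZ_def z_def[symmetric] Zs[of b l] algebra_simps)
          qed
        qed
        show ?thesis
          unfolding tform_split[where y = y, OF y symZ(2)] W_def qdual_eq[OF E(1)] A B C[symmetric] by simp
      qed
      have "(\<Sum>\<^sub>\<infinity>u\<in>L l. fexp (tform (y(l := u)) Z)) = fexp (tform y Z) * (\<Sum>\<^sub>\<infinity>u\<in>L l. fexp (qexp E z W u))"
        unfolding 1 fexp_add by (rule infsum_cmult_right')
      also have "\<dots> = of_real K / csqrt (- \<i> * z) ^ m * (fexp (tform y Z) *
          (\<Sum>\<^sub>\<infinity>u\<in>L l. fexp (qdual E z W (smul (inverse (of_int (t l))) u))))"
        unfolding K(2)[OF z] by (simp add: mult_ac)
      also have "fexp (tform y Z) * (\<Sum>\<^sub>\<infinity>u\<in>L l. fexp (qdual E z W (smul (inverse (of_int (t l))) u))) =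
          (\<Sum>\<^sub>\<infinity>u\<in>L l. fexp (tform (y(l := u)) Z'))"
        unfolding 2[symmetric] fexp_add by (rule infsum_cmult_right'[symmetric])
      finally show ?thesis .
    qed
    have "theta Q L Z = (\<Sum>\<^sub>\<infinity>y\<in>Y. of_real K / csqrt (- \<i> * z) ^ m * (\<Sum>\<^sub>\<infinity>u\<in>L l. fexp (tform (y(l := u)) Z')))"
      unfolding split[OF Z] by (rule infsum_cong) (rule inner)
    also have "\<dots> = of_real K / csqrt (- \<i> * z) ^ m * theta Q L Z'"
      unfolding split[OF Z'H] by (rule infsum_cmult_right')
    finally show ?thesis unfolding Z'm z_def .
  qed
  thus ?thesis using K(1) by blast
qed

text \<open>With \<open>m = 2 * k\<close> the power of the square root becomes
  \<open>(- \<i> * z) ^ k\<close>, and the automorphy factor is \<open>(t l * z) ^ k\<close>. Their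
  ratio no longer depends on z, which gives the constant c.\<close>

lemma semi_invariant_pinv: "\<exists>c. c \<noteq> 0 \<and> semi_invariant (int m div 2) (theta Q L) (pinv l) c"
proof -
  obtain k where k: "m = 2 * k" using rank_even by (auto elim: evenE)
  obtain K where K: "K > 0" "\<And>Z. Z \<in> siegel_upper_half \<Longrightarrow>
      theta Q L Z = of_real K / csqrt (- \<i> * Z $ l $ l) ^ m * theta Q L (moeb (pinv l) Z)"
    using theta_pinv[of l] by blast
  define c where "c = (- \<i> / of_int (t l)) ^ k / of_real K"
  have "det (den (pinv l) Z) powi (- (int m div 2)) * theta Q L (moeb (pinv l) Z) = c * theta Q L Z"
    if Z: "Z \<in> siegel_upper_half" for Z
  proof -
    define z where "z = Z $ l $ l"
    have z: "z \<noteq> 0" using siegel_diag[OF Z, of l] by (auto simp: z_def)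
    have s: "csqrt (- \<i> * z) ^ m = (- \<i> * z) ^ k"
      unfolding k power_mult by simp
    have "theta Q L Z = of_real K / (- \<i> * z) ^ k * theta Q L (moeb (pinv l) Z)"
      using K(2)[OF Z] unfolding z_def[symmetric] s .
    hence "theta Q L (moeb (pinv l) Z) = (- \<i> * z) ^ k / of_real K * theta Q L Z"
      using z K(1) by (simp add: field_simps)
    moreover have "det (den (pinv l) Z) powi (- (int m div 2)) = 1 / (of_int (t l) * z) ^ k"
      unfolding det_den_pinv z_def[symmetric] k by (simp add: power_int_minus_divide)
    moreover have "1 / (of_int (t l) * z) ^ k * ((- \<i> * z) ^ k / of_real K) = c"
    proof -
      have "(- \<i> * z) ^ k = (- \<i> / of_int (t l)) ^ k * (of_int (t l) * z) ^ k"
        by (simp flip: power_mult_distrib)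
      moreover have "(of_int (t l) * z) ^ k \<noteq> 0" using z by simp
      ultimately show ?thesis by (simp add: c_def)
    qed
    ultimately show ?thesis by (simp only: mult.assoc[symmetric])
  qed
  moreover have "c \<noteq> 0" using K(1) by (simp add: c_def)
  ultimately show ?thesis unfolding semi_invariant_def by blast
qed

theorem semi_invariant_paramodular:
  assumes "g \<in> symplectic_group" "\<And>x. x \<in> Lam \<Longrightarrow> g *v x \<in> Lam"
  shows "semi_invariant (int m div 2) (theta Q L) g 1"
proof -
  let ?H = "{g \<in> symplectic_group. semi_invariant (int m div 2) (theta Q L) g 1}"
  have "g \<in> ?H"
  proof (rule generation[OF _ _ _ _ assms])
    show "mat 1 \<in> ?H" by (simp add: mat_1_symplectic semi_invariant_1)
    show "a \<in> ?H" if "a \<in> gens i" for a i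
      using that gens_symplectic semi_invariant_gens[OF semi_invariant_pinv] by blast
    show "a ** b \<in> ?H" if "a \<in> ?H" "b \<in> ?H" for a b
      using that symplectic_mult[of a b] semi_invariant_mult[of a b "int m div 2" "theta Q L" 1 1] by simp
    show "b \<in> ?H" if "a \<in> ?H" "b \<in> symplectic_group" "a ** b \<in> ?H" for a b
      using that semi_invariant_cancel[of a b "int m div 2" "theta Q L" 1 1] by simp
  qed
  thus ?thesis by simp
qed

end

section \<open>Modularity\<close>

text \<open>The block matrix with diagonal blocks 1 and T carries the integral vectors onto
  \<open>Lam\<close>, and \<open>co\<close> are the coordinates under this identification. An
  integral matrix conjugated by it therefore acts on the coordinates integrally.\<close>

lemma paramodular_preserves:
  fixes T :: "int^('n::{finite,linorder})^('n::{finite,linorder})"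
  assumes T: "elementary_divisor_matrix T" and g: "g \<in> paramodular_group T"
    and x: "x \<in> divisor_chain.Lam (\<lambda>i. T $ i $ i)"
  shows "g *v x \<in> divisor_chain.Lam (\<lambda>i. T $ i $ i)"
proof -
  interpret divisor_chain "\<lambda>i. T $ i $ i"
    using T by unfold_locales (auto simp: elementary_divisor_matrix_def)
  have diag: "T $ i $ j = (if i = j then T $ i $ i else 0)" for i j
    using T by (auto simp: elementary_divisor_matrix_def)
  define Ti :: "rat^('n::{finite,linorder})^('n::{finite,linorder})" where
    "Ti = (\<chi> i j. if i = j then 1 / of_int (T $ i $ i) else 0)"
  have "map_mat of_int T ** Ti = mat 1"
  proof -
    have "(\<Sum>k\<in>UNIV. of_int (T $ i $ k) * (if k = j then 1 / of_int (T $ k $ k) else 0)) = (if i = j then 1 else (0::rat))" for i j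
    proof -
      have "of_int (T $ i $ k) * (if k = j then 1 / of_int (T $ k $ k) else 0) = (if k = i then (if i = j then 1 else 0) else (0::rat))" for k
        by (subst diag) auto
      thus ?thesis by simp
    qed
    thus ?thesis by (simp add: vec_eq_iff matrix_matrix_mult_def map_mat_def Ti_def mat_def)
  qed
  hence inv: "matrix_inv (map_mat of_int T) = Ti" by (rule matrix_inv_unique)
  define P :: "rat^('n + 'n)^('n + 'n)" where "P = block_mat (mat 1) 0 0 (map_mat of_int T)"
  define P' :: "rat^('n + 'n)^('n + 'n)" where "P' = block_mat (mat 1) 0 0 Ti"
  obtain M :: "int^('n + 'n)^('n + 'n)" where M: "g = P ** map_mat of_int M ** P'"
    using g unfolding paramodular_group_def P_def P'_def inv by blast
  have P: "co (P *v y) s = y $ s" for y s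
  proof (cases s)
    case (Inl i)
    thus ?thesis
      by (simp add: co_def P_def block_mat_def matrix_vector_mult_def sum_UNIV_Plus mat_def if_distrib if_distribR sum.If_cases cong: if_cong)
  next
    case (Inr i)
    have "(P *v y) $ Inr i = (\<Sum>k\<in>UNIV. of_int (T $ i $ k) * y $ Inr k)"
      by (simp add: P_def block_mat_def matrix_vector_mult_def sum_UNIV_Plus map_mat_def)
    also have "\<dots> = of_int (T $ i $ i) * y $ Inr i"
      by (subst diag) (simp add: if_distrib if_distribR sum.If_cases cong: if_cong)
    finally show ?thesis using Inr by (simp add: co_def)
  qed
  have P': "(P' *v x) $ s = co x s" for s
  proof (cases s)
    case (Inl i)
    thus ?thesis
      by (simp add: co_def P'_def block_mat_def matrix_vector_mult_def sum_UNIV_Plus mat_def if_distrib if_distribR sum.If_cases cong: if_cong)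
  next
    case (Inr i)
    thus ?thesis
      by (simp add: co_def P'_def Ti_def block_mat_def matrix_vector_mult_def sum_UNIV_Plus if_distrib if_distribR sum.If_cases cong: if_cong)
  qed
  have "co (g *v x) s = (\<Sum>r\<in>UNIV. of_int (M $ s $ r) * co x r)" for s
  proof -
    have "(map_mat of_int M *v y) $ s = (\<Sum>r\<in>UNIV. of_int (M $ s $ r) * y $ r)" for y :: "rat^('n + 'n)"
      by (simp add: map_mat_def matrix_vector_mult_def)
    thus ?thesis unfolding M matrix_vector_mul_assoc[symmetric] P by (simp only: P')
  qed
  thus ?thesis using x by (auto simp: Lam_def intro!: Ints_sum Ints_mult)
qed

section \<open>Holomorphy and the expansions at the cusps\<close>

context modular_lattices
begin

lemma theta_siegel_holomorphic: "siegel_holomorphic (theta Q L)"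
proof -
  obtain E where E: "orth_basis E" "\<forall>j. E \<subseteq> L j" using basis_exists by blast
  note D = theta_has_derivative[OF E(1) tuples_subset[OF E(2)]]
  show ?thesis unfolding siegel_holomorphic_def theta_tuples[abs_def]
  proof (rule ballI)
    fix Z :: "complex^('n::{finite,linorder})^('n::{finite,linorder})" assume Z: "Z \<in> siegel_upper_half"
    show "\<exists>F. ((\<lambda>Z. \<Sum>\<^sub>\<infinity>x\<in>tuples. fexp (tform x Z)) has_derivative F) (at Z within siegel_upper_half) \<and>
        (\<forall>c H. F (map_mat ((*) c) H) = c * F H)"
      using has_derivative_at_withinI[OF D(1)[OF Z]] D(2)[OF Z] by blast
  qed
qed

text \<open>In degree one the terms are grouped by the value of Q, a natural number because the
  lattice is even and Q is nonnegative. The absence of negative indices and the width 1 are then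
  immediate.\<close>

lemma theta_expansion:
  assumes one: "CARD('n) = 1"
  shows "\<exists>a :: nat \<Rightarrow> complex. \<forall>Z\<in>siegel_upper_half.
    (\<lambda>l. a l * exp (2 * pi * \<i> * of_nat l * trace Z / of_nat 1)) sums theta Q L Z"
proof -
  obtain E where E: "orth_basis E" "\<forall>j. E \<subseteq> L j" using basis_exists by blast
  obtain i :: 'n where i: "UNIV = {i}" using one card_1_singletonE by blast
  define q where "q x = nat \<lfloor>Q (x i)\<rfloor>" for x :: "'n \<Rightarrow> 'v"
  have q: "of_nat (q x) = Q (x i)" if "x \<in> tuples" for x
  proof -
    have "Q (x i) \<in> \<int>" using even[of i] that by (auto simp: even_lattice_def tuples_def)
    thus ?thesis using Q_nonneg[of "x i"] by (auto simp: q_def elim!: Ints_cases)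
  qed
  define Xl where "Xl l = {x \<in> tuples. q x = l}" for l
  have tr: "trace Z = Z $ i $ i" for Z :: "complex^('n::{finite,linorder})^('n::{finite,linorder})"
    by (simp add: trace_def i)
  have tf: "tform x Z = of_nat l * trace Z" if "x \<in> Xl l" for x l and Z :: "complex^('n::{finite,linorder})^('n::{finite,linorder})"
  proof -
    have "of_rat (Q (x i)) = (of_nat l :: complex)" using that q[of x] by (auto simp: Xl_def) (metis of_rat_of_nat_eq)
    thus ?thesis by (simp add: tform_def i tr half_polar_self)
  qed
  \<comment> \<open>The number of representations of l, written as an infinite sum. That the level
    set is finite is implicit in the summability of a nonzero constant over it.\<close>
  define a where "a l = (\<Sum>\<^sub>\<infinity>x\<in>Xl l. (1::complex))" for l
  have "(\<lambda>l. a l * exp (2 * pi * \<i> * of_nat l * trace Z / of_nat 1)) sums theta Q L Z"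
    if Z: "Z \<in> siegel_upper_half" for Z
  proof -
    have sum: "(\<lambda>x. fexp (tform x Z)) summable_on tuples"
      by (rule abs_summable_summable[OF theta_abs_summable[OF E(1) tuples_subset[OF E(2)] Z]])
    have bij: "bij_betw snd (Sigma UNIV Xl) tuples"
      by (rule bij_betw_byWitness[where f' = "\<lambda>x. (q x, x)"]) (auto simp: Xl_def)
    have "((\<lambda>x. fexp (tform x Z)) has_sum theta Q L Z) tuples"
      unfolding theta_tuples by (rule has_sum_infsum[OF sum])
    hence hs: "((\<lambda>p. fexp (tform (snd p) Z)) has_sum theta Q L Z) (Sigma UNIV Xl)"
      by (subst has_sum_reindex_bij_betw[OF bij, of "\<lambda>x. fexp (tform x Z)"])
    have "((\<lambda>x. fexp (tform (snd (l, x)) Z)) has_sum a l * fexp (of_nat l * trace Z)) (Xl l)" for l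
    proof -
      have "(\<lambda>x. fexp (tform x Z)) summable_on Xl l"
        by (rule summable_on_subset_banach[OF sum]) (auto simp: Xl_def)
      hence "((\<lambda>x. fexp (tform x Z)) has_sum (\<Sum>\<^sub>\<infinity>x\<in>Xl l. fexp (tform x Z))) (Xl l)" by (rule has_sum_infsum)
      moreover have "(\<Sum>\<^sub>\<infinity>x\<in>Xl l. fexp (tform x Z)) = (\<Sum>\<^sub>\<infinity>x\<in>Xl l. 1 * fexp (of_nat l * trace Z))"
        by (rule infsum_cong) (simp add: tf)
      moreover have "\<dots> = a l * fexp (of_nat l * trace Z)" unfolding a_def by (rule infsum_cmult_left')
      ultimately show ?thesis by simp
    qed
    from has_sum_SigmaD[OF hs this]
    have "((\<lambda>l. a l * fexp (of_nat l * trace Z)) has_sum theta Q L Z) UNIV" .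
    hence "(\<lambda>l. a l * fexp (of_nat l * trace Z)) sums theta Q L Z" by (rule has_sum_imp_sums)
    thus ?thesis by (simp add: fexp_def mult_ac)
  qed
  thus ?thesis by blast
qed

end

text \<open>The parity of m is part of the conclusion since only with it is
  \<open>int m div 2\<close> the weight m/2.\<close>

theorem theorem5p4:
  fixes T :: "int^('n::{finite,linorder})^('n::{finite,linorder})"
    and smul :: "rat \<Rightarrow> 'v::ab_group_add \<Rightarrow> 'v"
    and Q :: "'v \<Rightarrow> rat"
    and m :: nat
    and L :: "'n \<Rightarrow> 'v set"
  assumes "elementary_divisor_matrix T"
    and "T $ Min UNIV $ Min UNIV = 1"
    and "pos_def_quadratic_space smul Q"
    and "\<And>j. lattice_of_rank smul m (L j)"
    and "\<And>i j. i \<le> j \<Longrightarrow> L j \<subseteq> L i"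
    and "\<And>j. even_lattice Q (L j)"
    and "\<And>j. modular_lattice smul Q (T $ j $ j) (L j)"
    and "\<And>j. even (T $ j $ j) \<Longrightarrow> even_lattice (\<lambda>x. Q x / of_int (T $ j $ j)) (L j)"
  shows "even m \<and> siegel_modular_form (int m div 2) (paramodular_group T) (theta Q L)"
proof -
  interpret modular_lattices smul Q "\<lambda>i. T $ i $ i" m L
    using assms by unfold_locales (auto simp: elementary_divisor_matrix_def)
  have slash: "slash (int m div 2) (theta Q L) A B C D Z = theta Q L Z"
    if "block_mat A B C D \<in> symplectic_group" "\<And>x. x \<in> Lam \<Longrightarrow> block_mat A B C D *v x \<in> Lam" "Z \<in> siegel_upper_half"
    for A B C D and Z :: "complex^('n::{finite,linorder})^('n::{finite,linorder})"
    using semi_invariant_paramodular[OF that(1,2)] that(3) by (simp add: slash_eq semi_invariant_def)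
  have "slash (int m div 2) (theta Q L) A B C D Z = theta Q L Z"
    if "block_mat A B C D \<in> paramodular_group T" "Z \<in> siegel_upper_half"
    for A B C D and Z :: "complex^('n::{finite,linorder})^('n::{finite,linorder})"
  proof (rule slash)
    show "block_mat A B C D \<in> symplectic_group" using that by (simp add: paramodular_group_def)
    show "block_mat A B C D *v x \<in> Lam" if "x \<in> Lam" for x
      using paramodular_preserves[OF assms(1) \<open>block_mat A B C D \<in> paramodular_group T\<close> that] .
  qed (rule that)
  \<comment> \<open>In degree one T is the matrix 1, so every integral symplectic matrix stabilizes
    \<open>Lam\<close> and leaves the theta series invariant. The expansion at each cusp is thus the
    one at infinity.\<close>
  moreover have "holomorphic_at_cusps (int m div 2) (theta Q L)" if one: "CARD('n) = 1"
  proof -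
    obtain a :: "nat \<Rightarrow> complex" where a: "\<And>Z. Z \<in> siegel_upper_half \<Longrightarrow>
        (\<lambda>l. a l * exp (2 * pi * \<i> * of_nat l * trace Z / of_nat 1)) sums theta Q L Z"
      using theta_expansion[OF one] by blast
    obtain i :: 'n where i: "UNIV = {i}" using one card_1_singletonE by blast
    have "j = Min UNIV" for j :: 'n using i by (metis UNIV_I singletonD Min_singleton)
    hence T1: "T $ j $ j = 1" for j using assms(2) by metis
    have "wt (Inr b) = 1" for b by (subst wt.simps(2)) (simp only: T1 of_int_1)
    hence "wt s = 1" for s by (cases s) (simp_all only: wt.simps(1))
    hence co: "co x s = x $ s" for x s by (simp only: co_def div_by_1)
    have "slash (int m div 2) (theta Q L) (map_mat of_int A) (map_mat of_int B) (map_mat of_int C) (map_mat of_int D) Z = theta Q L Z"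
      if sp: "block_mat (map_mat of_int A) (map_mat of_int B) (map_mat of_int C) (map_mat of_int D) \<in> symplectic_group"
        and Z: "Z \<in> siegel_upper_half"
      for A B C D :: "int^('n::{finite,linorder})^('n::{finite,linorder})" and Z
    proof (rule slash[OF sp _ Z])
      let ?g = "block_mat (map_mat of_int A) (map_mat of_int B) (map_mat of_int C) (map_mat of_int D) :: rat^('n + 'n)^('n + 'n)"
      have "?g $ r $ s \<in> \<int>" for r s
        by (cases r; cases s) (auto simp: block_mat_def map_mat_def)
      thus "?g *v x \<in> Lam" if "x \<in> Lam" for x
        using that unfolding Lam_def co by (auto simp: matrix_vector_mult_def intro!: Ints_sum Ints_mult)
    qed
    note cusp = this
    show ?thesis
      unfolding holomorphic_at_cusps_def
    proof (intro allI impI)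
      fix A B C D :: "int^('n::{finite,linorder})^('n::{finite,linorder})"
      assume sp: "block_mat (map_mat of_int A) (map_mat of_int B) (map_mat of_int C) (map_mat of_int D) \<in> symplectic_group"
      show "\<exists>h>0. \<exists>a :: nat \<Rightarrow> complex. \<forall>Z\<in>siegel_upper_half.
           (\<lambda>l. a l * exp (2 * pi * \<i> * of_nat l * trace Z / of_nat h)) sums
             slash (int m div 2) (theta Q L) (map_mat of_int A) (map_mat of_int B)
               (map_mat of_int C) (map_mat of_int D) Z"
        using a by (intro exI[of _ 1] exI[of _ a] conjI ballI zero_less_one) (simp only: cusp[OF sp])
    qed
  qed
  ultimately show ?thesis
    unfolding siegel_modular_form_def using rank_even theta_siegel_holomorphic by blast
qed

end
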